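(* Let $\rho_0\in C^\infty(\mathbb{T}^2)$ be odd in $x_2$ and even in $x_1$, and let $\omega_0\in C^\infty(\mathbb{T}^2)$ be odd in both $x_1$ and $x_2$. Assume $\rho_0\ge 0$ on $\{0\}\times[0,\pi]$ with $k_0:=\sup_{x_2\in[0,\pi]}\rho_0(0,x_2)>0$, and $\rho_0\le 0$ on $\{\pi\}\times[0,\pi]$. Then there exists some constant $c(\rho_0,\omega_0)>0$ such that the corresponding solution $(\rho,\omega)$ of the inviscid Boussinesq system in vorticity form $$\rho_t+u\cdot\nabla\rho=0,\qquad \omega_t+u\cdot\nabla\omega=-\partial_1\rho,\qquad u=\nabla^\perp(-\Delta)^{-1}\omega$$ on $\mathbb{T}^2$ with initial data $(\rho_0,\omega_0)$ satisfies $$\sup_{\tau\in[0,t]}\|\nabla\rho(\tau)\|_{L^\infty(\mathbb{T}^2)}>c(\rho_0,\omega_0)\,t^{1/2}\quad\text{for all }t\in[0,T),$$ where $T$ is the lifespan of the smooth solution $(\rho,\omega)$.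
   Context: $\mathbb{T}^2=(-\pi,\pi]^2$ is the torus (functions $2\pi$-periodic in both variables). The vorticity is $\omega=\partial_1u_2-\partial_2u_1$; the velocity $u=(u_1,u_2)$ is divergence free and recovered from $\omega$ by the Biot–Savart law $u=\nabla^\perp(-\Delta)^{-1}\omega$ with $\nabla^\perp=(\partial_2,-\partial_1)$, so that $\partial_1u_2-\partial_2u_1=\omega$. The system is equivalent to $\rho_t+u\cdot\nabla\rho=0$, $u_t+u\cdot\nabla u=-\nabla p-\rho e_2$, $\nabla\cdot u=0$, with $e_2=(0,1)^T$. Smooth solutions exist locally in time; $T\in(0,\infty]$ denotes the maximal time of existence of the smooth solution. *)

theory Defs
  imports "HOL-Analysis.Analysis" "HOL-Probability.Essential_Supremum"
begin

text \<open>Derivatives are taken within \<^term>\<open>S\<close>, so that smoothness on a set such as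
  \<open>[0,T) \<times> \<real>\<^sup>2\<close> includes one-sided smoothness up to the boundary. This is meant for
  convex sets with nonempty interior, where the derivative within the set is unique.\<close>

primrec Ck_on :: "nat \<Rightarrow> 'a::real_normed_vector set \<Rightarrow> ('a \<Rightarrow> 'b::real_normed_vector) \<Rightarrow> bool" where
  "Ck_on 0 S f \<longleftrightarrow> continuous_on S f"
| "Ck_on (Suc n) S f \<longleftrightarrow> f differentiable_on S \<and>
     (\<forall>v. Ck_on n S (\<lambda>x. frechet_derivative f (at x within S) v))"

definition smooth_on :: "'a::real_normed_vector set \<Rightarrow> ('a \<Rightarrow> 'b::real_normed_vector) \<Rightarrow> bool" where
  "smooth_on S f \<longleftrightarrow> (\<forall>n. Ck_on n S f)"

text \<open>Functions on the torus are functions on \<open>\<real>\<^sup>2\<close> that are \<open>2\<pi>\<close>-periodic in both variables;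
  \<open>torus_cell\<close> is a fundamental domain.\<close>

definition torus_cell :: "(real \<times> real) set" where
  "torus_cell = {-pi<..pi} \<times> {-pi<..pi}"

definition periodic :: "(real \<times> real \<Rightarrow> 'b) \<Rightarrow> bool" where
  "periodic f \<longleftrightarrow> (\<forall>x1 x2. f (x1 + 2 * pi, x2) = f (x1, x2) \<and> f (x1, x2 + 2 * pi) = f (x1, x2))"

definition torus_smooth :: "(real \<times> real \<Rightarrow> real) \<Rightarrow> bool" where
  "torus_smooth f \<longleftrightarrow> periodic f \<and> smooth_on UNIV f"

definition odd_x1 :: "(real \<times> real \<Rightarrow> real) \<Rightarrow> bool" where
  "odd_x1 f \<longleftrightarrow> (\<forall>x1 x2. f (- x1, x2) = - f (x1, x2))"

definition odd_x2 :: "(real \<times> real \<Rightarrow> real) \<Rightarrow> bool" where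
  "odd_x2 f \<longleftrightarrow> (\<forall>x1 x2. f (x1, - x2) = - f (x1, x2))"

definition even_x1 :: "(real \<times> real \<Rightarrow> real) \<Rightarrow> bool" where
  "even_x1 f \<longleftrightarrow> (\<forall>x1 x2. f (- x1, x2) = f (x1, x2))"

definition d1 :: "(real \<times> real \<Rightarrow> real) \<Rightarrow> real \<times> real \<Rightarrow> real" where
  "d1 f x = frechet_derivative f (at x) (1, 0)"

definition d2 :: "(real \<times> real \<Rightarrow> real) \<Rightarrow> real \<times> real \<Rightarrow> real" where
  "d2 f x = frechet_derivative f (at x) (0, 1)"

definition grad :: "(real \<times> real \<Rightarrow> real) \<Rightarrow> real \<times> real \<Rightarrow> real \<times> real" where
  "grad f x = (d1 f x, d2 f x)"

definition grad_perp :: "(real \<times> real \<Rightarrow> real) \<Rightarrow> real \<times> real \<Rightarrow> real \<times> real" where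
  "grad_perp f x = (d2 f x, - d1 f x)"

definition laplacian :: "(real \<times> real \<Rightarrow> real) \<Rightarrow> real \<times> real \<Rightarrow> real" where
  "laplacian f x = d1 (d1 f) x + d2 (d2 f) x"

definition linfty_norm :: "(real \<times> real \<Rightarrow> real \<times> real) \<Rightarrow> ereal" where
  "linfty_norm v = esssup (restrict_space lborel torus_cell) (\<lambda>x. ereal (norm (v x)))"

text \<open>The graph of \<open>(-\<Delta>)\<^sup>-\<^sup>1\<close> on the torus: \<open>\<psi>\<close> is the mean-zero periodic solution of
  \<open>-\<Delta>\<psi> = w\<close>. It is unique, and can only exist when \<open>w\<close> has mean zero.\<close>

definition is_inverse_neg_laplacian ::
  "(real \<times> real \<Rightarrow> real) \<Rightarrow> (real \<times> real \<Rightarrow> real) \<Rightarrow> bool" where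
  "is_inverse_neg_laplacian w \<psi> \<longleftrightarrow>
     torus_smooth \<psi> \<and> (LINT x:torus_cell|lborel. \<psi> x) = 0 \<and> (\<forall>x. - laplacian \<psi> x = w x)"

definition biot_savart :: "(real \<times> real \<Rightarrow> real) \<Rightarrow> (real \<times> real \<Rightarrow> real \<times> real) \<Rightarrow> bool" where
  "biot_savart w v \<longleftrightarrow> (\<exists>\<psi>. is_inverse_neg_laplacian w \<psi> \<and> v = grad_perp \<psi>)"

definition times_upto :: "ereal \<Rightarrow> real set" where
  "times_upto T = {t. 0 \<le> t \<and> ereal t < T}"

text \<open>Smoothness is joint in time and space, up to \<open>t = 0\<close>. Asking it of \<open>u\<close> as well is
  no restriction: it follows from the smoothness of \<open>\<omega>\<close> by elliptic regularity.\<close>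

definition boussinesq_solution ::
  "(real \<times> real \<Rightarrow> real) \<Rightarrow> (real \<times> real \<Rightarrow> real) \<Rightarrow> ereal \<Rightarrow>
   (real \<Rightarrow> real \<times> real \<Rightarrow> real) \<Rightarrow> (real \<Rightarrow> real \<times> real \<Rightarrow> real) \<Rightarrow> bool" where
  "boussinesq_solution \<rho>0 \<omega>0 T \<rho> \<omega> \<longleftrightarrow>
     0 < T \<and> \<rho> 0 = \<rho>0 \<and> \<omega> 0 = \<omega>0 \<and>
     smooth_on (times_upto T \<times> UNIV) (\<lambda>(t, x). \<rho> t x) \<and>
     smooth_on (times_upto T \<times> UNIV) (\<lambda>(t, x). \<omega> t x) \<and>
     (\<forall>t\<in>times_upto T. periodic (\<rho> t) \<and> periodic (\<omega> t)) \<and>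
     (\<exists>u :: real \<Rightarrow> real \<times> real \<Rightarrow> real \<times> real.
        smooth_on (times_upto T \<times> UNIV) (\<lambda>(t, x). u t x) \<and>
        (\<forall>t\<in>times_upto T. biot_savart (\<omega> t) (u t) \<and>
          (\<forall>x. ((\<lambda>s. \<rho> s x) has_real_derivative - (u t x \<bullet> grad (\<rho> t) x))
                 (at t within times_upto T) \<and>
               ((\<lambda>s. \<omega> s x) has_real_derivative - (u t x \<bullet> grad (\<omega> t) x) - d1 (\<rho> t) x)
                 (at t within times_upto T))))"

text \<open>A solution whose time of existence \<open>T \<in> (0,\<infinity>]\<close> is the lifespan, i.e. the largest
  time up to which a smooth solution with the given initial data exists.\<close>

definition maximal_boussinesq_solution ::
  "(real \<times> real \<Rightarrow> real) \<Rightarrow> (real \<times> real \<Rightarrow> real) \<Rightarrow> ereal \<Rightarrow>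
   (real \<Rightarrow> real \<times> real \<Rightarrow> real) \<Rightarrow> (real \<Rightarrow> real \<times> real \<Rightarrow> real) \<Rightarrow> bool" where
  "maximal_boussinesq_solution \<rho>0 \<omega>0 T \<rho> \<omega> \<longleftrightarrow>
     boussinesq_solution \<rho>0 \<omega>0 T \<rho> \<omega> \<and>
     (\<forall>T' \<rho>' \<omega>'. boussinesq_solution \<rho>0 \<omega>0 T' \<rho>' \<omega>' \<longrightarrow> T' \<le> T)"

end

theory Submission
  imports Defs
begin

text \<open>
  Symmetry, energy and circulation together force the density gradient to grow.

  The reflection symmetries of the data persist by uniqueness
  (\<open>boussinesq_flow_unique\<close>, \<open>reflection_symmetry\<close>), so no fluid crosses the sides of the quarter torus
  \<open>[0,\<pi>]\<^sup>2\<close>, and \<open>\<rho>\<close> vanishes on its horizontal sides. Let \<open>\<Gamma>(t)\<close> be the integral of \<open>\<omega>\<close> over this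
  square. Then \<open>\<Gamma>' = \<integral>\<^sub>0\<^sup>\<pi> \<rho>(t,0,y) - \<rho>(t,\<pi>,y) dy\<close> (\<open>circulation_derivative\<close>). On the two vertical sides \<open>\<rho>\<close> is
  transported along the side, so it keeps its sign there, and its maximum on the left side does not
  drop below an initial value \<open>k > 0\<close>. If \<open>M\<close> bounds \<open>|\<nabla>\<rho>|\<close> up to time \<open>t\<close>, a profile of height \<open>k\<close> with slope at
  most \<open>M\<close> has integral at least \<open>k\<^sup>2/(4M)\<close>, and \<open>\<Gamma>(t) \<ge> \<Gamma>(0) + t k\<^sup>2/(4M)\<close>.

  In the other direction, \<open>|\<omega>(t)| \<le> sup |\<omega>\<^sub>0| + M t\<close> by the maximum principle, and the kinetic energy
  stays below a constant \<open>E\<close> depending on the data (\<open>kinetic_energy_bound\<close>). A large circulation means large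
  velocities along the boundary; bounded vorticity spreads them over a layer of some
  thickness, which costs energy. Quantitatively \<open>\<Gamma>\<^sup>3 \<le> C E sup |\<omega>|\<close> (\<open>circulation_cubed_bound\<close>).

  For large \<open>t\<close> the two bounds give \<open>(t/M)\<^sup>3 \<le> C (1 + M t)\<close>, that is \<open>M \<ge> c \<sqrt>t\<close>. For small \<open>t\<close> it suffices
  that \<open>M \<ge> k/\<pi>\<close>, because \<open>\<rho>\<close> climbs from \<open>0\<close> to \<open>k\<close> on an interval of length at most \<open>\<pi>\<close>.

  Transport enters through maximum principles and through integral identities, all of which are
  instances of the divergence theorem on a rectangle.
\<close>

section \<open>Differential calculus of functions on the plane\<close>

lemma d1_eqI: "(f has_derivative f') (at x) \<Longrightarrow> d1 f x = f' (1, 0)"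
  unfolding d1_def by (metis frechet_derivative_at)

lemma d2_eqI: "(f has_derivative f') (at x) \<Longrightarrow> d2 f x = f' (0, 1)"
  unfolding d2_def by (metis frechet_derivative_at)

lemma has_derivative_partials:
  assumes "f differentiable (at x)"
  shows "(f has_derivative (\<lambda>h. fst h * d1 f x + snd h * d2 f x)) (at x)"
proof -
  let ?D = "frechet_derivative f (at x)"
  have D: "(f has_derivative ?D) (at x)" using assms frechet_derivative_works by blast
  then interpret bounded_linear ?D by (rule has_derivative_bounded_linear)
  have "?D h = fst h * d1 f x + snd h * d2 f x" for h
  proof -
    have "h = fst h *\<^sub>R (1,0) + snd h *\<^sub>R (0,1)" by (simp add: prod_eq_iff)
    then have "?D h = fst h *\<^sub>R ?D (1,0) + snd h *\<^sub>R ?D (0,1)"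
      by (metis add scaleR)
    then show ?thesis by (simp add: d1_def d2_def)
  qed
  then have "?D = (\<lambda>h. fst h * d1 f x + snd h * d2 f x)" by auto
  with D show ?thesis by simp
qed

lemma has_real_derivative_d1:
  assumes "f differentiable (at (x, y))"
  shows "((\<lambda>s. f (s, y)) has_real_derivative d1 f (x, y)) (at x within S)"
proof -
  have "((\<lambda>s. (s, y)) has_derivative (\<lambda>h. (h, 0))) (at x within S)"
    by (auto intro!: derivative_eq_intros)
  from has_derivative_compose[OF this has_derivative_partials[OF assms]]
  show ?thesis by (simp add: has_field_derivative_def mult_commute_abs)
qed

lemma has_real_derivative_d2:
  assumes "f differentiable (at (x, y))"
  shows "((\<lambda>s. f (x, s)) has_real_derivative d2 f (x, y)) (at y within S)"
proof -
  have "((\<lambda>s. (x, s)) has_derivative (\<lambda>h. (0, h))) (at y within S)"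
    by (auto intro!: derivative_eq_intros)
  from has_derivative_compose[OF this has_derivative_partials[OF assms]]
  show ?thesis by (simp add: has_field_derivative_def mult_commute_abs)
qed

definition C1 :: "(real \<times> real \<Rightarrow> real) \<Rightarrow> bool" where
  "C1 f \<longleftrightarrow> (\<forall>x. f differentiable (at x)) \<and> continuous_on UNIV (d1 f) \<and> continuous_on UNIV (d2 f)"

lemma C1_differentiable: "C1 f \<Longrightarrow> f differentiable (at x)"
  unfolding C1_def by blast

lemma C1_continuous: "C1 f \<Longrightarrow> continuous_on S f"
  by (meson C1_def continuous_on_subset differentiable_imp_continuous_on
      differentiable_on_def differentiable_at_withinI subset_UNIV)

lemma C1_continuous_d1: "C1 f \<Longrightarrow> continuous_on S (d1 f)"
  and C1_continuous_d2: "C1 f \<Longrightarrow> continuous_on S (d2 f)"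
  by (meson C1_def continuous_on_subset subset_UNIV)+

lemma partials_mult:
  assumes "C1 f" "C1 g"
  shows "d1 (\<lambda>x. f x * g x) = (\<lambda>x. d1 f x * g x + f x * d1 g x)"
    and "d2 (\<lambda>x. f x * g x) = (\<lambda>x. d2 f x * g x + f x * d2 g x)"
proof -
  have "((\<lambda>x. f x * g x) has_derivative (\<lambda>h. f x * (fst h * d1 g x + snd h * d2 g x) +
      (fst h * d1 f x + snd h * d2 f x) * g x)) (at x)" for x
    using assms by (intro has_derivative_mult has_derivative_partials) (auto intro: C1_differentiable)
  from d1_eqI[OF this] d2_eqI[OF this] show
    "d1 (\<lambda>x. f x * g x) = (\<lambda>x. d1 f x * g x + f x * d1 g x)"
    "d2 (\<lambda>x. f x * g x) = (\<lambda>x. d2 f x * g x + f x * d2 g x)"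
    by auto
qed

lemma C1_mult:
  assumes "C1 f" "C1 g"
  shows "C1 (\<lambda>x. f x * g x)"
  unfolding C1_def partials_mult[OF assms]
  using assms C1_continuous[OF assms(1)] C1_continuous[OF assms(2)]
  by (simp add: C1_def continuous_on_mult continuous_on_add)

lemma partials_add:
  assumes "C1 f" "C1 g"
  shows "d1 (\<lambda>x. f x + g x) = (\<lambda>x. d1 f x + d1 g x)"
    and "d2 (\<lambda>x. f x + g x) = (\<lambda>x. d2 f x + d2 g x)"
proof -
  have "((\<lambda>x. f x + g x) has_derivative (\<lambda>h. (fst h * d1 f x + snd h * d2 f x) +
      (fst h * d1 g x + snd h * d2 g x))) (at x)" for x
    using assms by (intro has_derivative_add has_derivative_partials) (auto intro: C1_differentiable)
  from d1_eqI[OF this] d2_eqI[OF this] show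
    "d1 (\<lambda>x. f x + g x) = (\<lambda>x. d1 f x + d1 g x)"
    "d2 (\<lambda>x. f x + g x) = (\<lambda>x. d2 f x + d2 g x)"
    by auto
qed

lemma C1_add:
  assumes "C1 f" "C1 g"
  shows "C1 (\<lambda>x. f x + g x)"
  unfolding C1_def partials_add[OF assms]
  using assms C1_continuous[OF assms(1)] C1_continuous[OF assms(2)]
  by (simp add: C1_def continuous_on_mult continuous_on_add)

lemma partials_reflect:
  fixes a b c :: real
  assumes "\<And>x. f differentiable (at x)"
  shows "d1 (\<lambda>x. c * f (a * fst x, b * snd x)) = (\<lambda>x. c * a * d1 f (a * fst x, b * snd x))"
    and "d2 (\<lambda>x. c * f (a * fst x, b * snd x)) = (\<lambda>x. c * b * d2 f (a * fst x, b * snd x))"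
    and "(\<lambda>x. c * f (a * fst x, b * snd x)) differentiable (at x)"
proof -
  have *: "((\<lambda>x. c * f (a * fst x, b * snd x)) has_derivative
     (\<lambda>h. c * ((a * fst h) * d1 f (a * fst x, b * snd x) + (b * snd h) * d2 f (a * fst x, b * snd x)))) (at x)" for x
  proof -
    have R: "((\<lambda>x. (a * fst x, b * snd x)) has_derivative (\<lambda>h. (a * fst h, b * snd h))) (at x)"
      by (auto intro!: derivative_eq_intros)
    show ?thesis
      by (intro has_derivative_mult_right)
         (use has_derivative_compose[OF R has_derivative_partials[OF assms]] in simp)
  qed
  from d1_eqI[OF *] d2_eqI[OF *]
  show "d1 (\<lambda>x. c * f (a * fst x, b * snd x)) = (\<lambda>x. c * a * d1 f (a * fst x, b * snd x))"
    and "d2 (\<lambda>x. c * f (a * fst x, b * snd x)) = (\<lambda>x. c * b * d2 f (a * fst x, b * snd x))"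
    by auto
  from * show "(\<lambda>x. c * f (a * fst x, b * snd x)) differentiable (at x)"
    unfolding differentiable_def by blast
qed

lemma C1_reflect: 
  fixes a b c :: real
  assumes "C1 f" shows "C1 (\<lambda>x. c * f (a * fst x, b * snd x))"
proof -
  have "\<And>x. f differentiable (at x)" using assms by (rule C1_differentiable)
  note p = partials_reflect[OF this]
  have "continuous_on UNIV (\<lambda>x. g (a * fst x, b * snd x))" if "continuous_on UNIV g"
    for g :: "real \<times> real \<Rightarrow> real"
    by (rule continuous_on_compose2[OF that]) (auto intro!: continuous_intros)
  then show ?thesis using assms p(3)
    unfolding C1_def p(1,2) by (auto intro!: continuous_intros)
qed

lemma partials_cmult:
  assumes "C1 f"
  shows "d1 (\<lambda>x. c * f x) = (\<lambda>x. c * d1 f x)" "d2 (\<lambda>x. c * f x) = (\<lambda>x. c * d2 f x)"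
  using partials_reflect(1,2)[of f c 1 1, OF C1_differentiable[OF assms]] by simp_all

lemma C1_cmult: "C1 f \<Longrightarrow> C1 (\<lambda>x. c * f x)"
  using C1_reflect[of f c 1 1] by simp

lemma partials_minus:
  assumes "C1 f"
  shows "d1 (\<lambda>x. - f x) = (\<lambda>x. - d1 f x)" "d2 (\<lambda>x. - f x) = (\<lambda>x. - d2 f x)"
  using partials_cmult[OF assms, of "-1"] by simp_all

lemma C1_minus: "C1 f \<Longrightarrow> C1 (\<lambda>x. - f x)"
  using C1_cmult[of f "-1"] by simp

lemma partials_diff:
  assumes "C1 f" "C1 g"
  shows "d1 (\<lambda>x. f x - g x) = (\<lambda>x. d1 f x - d1 g x)"
    and "d2 (\<lambda>x. f x - g x) = (\<lambda>x. d2 f x - d2 g x)"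
  using partials_add[OF assms(1) C1_minus[OF assms(2)]] partials_minus[OF assms(2)] by simp_all

lemma C1_diff: "C1 f \<Longrightarrow> C1 g \<Longrightarrow> C1 (\<lambda>x. f x - g x)"
  using C1_add[OF _ C1_minus, of f g] by simp

lemma partials_snd: "d1 snd = (\<lambda>x. 0)" "d2 snd = (\<lambda>x. 1)"
proof -
  have "(snd has_derivative snd) (at x)" for x :: "real \<times> real"
    by (auto intro!: derivative_eq_intros)
  from d1_eqI[OF this] d2_eqI[OF this] show "d1 snd = (\<lambda>x. 0)" "d2 snd = (\<lambda>x. 1)" by auto
qed

lemma C1_snd: "C1 snd"
proof -
  have "(snd has_derivative snd) (at x)" for x :: "real \<times> real"
    by (auto intro!: derivative_eq_intros)
  then have "snd differentiable (at x)" for x :: "real \<times> real"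
    unfolding differentiable_def by blast
  then show ?thesis unfolding C1_def partials_snd by auto
qed

lemmas C1_intros = C1_add C1_mult C1_diff C1_minus C1_cmult C1_snd
lemmas partials = partials_add partials_mult partials_diff partials_minus partials_cmult partials_snd

lemma continuous_on_pair: 
  assumes "continuous_on UNIV (f :: real \<times> real \<Rightarrow> real)"
  shows "continuous_on S (\<lambda>y. f (x, y))" "continuous_on S (\<lambda>y. f (y, x))"
  by (rule continuous_on_compose2[OF assms]; auto intro!: continuous_intros)+

lemma integral_d1_rectangle:
  assumes "C1 f" "a \<le> b"
  shows "integral (cbox (a, c) (b, d)) (d1 f) = integral {c..d} (\<lambda>y. f (b, y) - f (a, y))"
proof -
  have c: "continuous_on S (d1 f)" for S using assms C1_continuous_d1 by blast
  have "integral (cbox (a, c) (b, d)) (\<lambda>(x,y). d1 f (x,y)) =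
      integral (cbox c d) (\<lambda>y. integral (cbox a b) (\<lambda>x. d1 f (x, y)))"
    using integral_prod_continuous[OF c, of a c b d] integral_swap_continuous[of a c b d "\<lambda>x y. d1 f (x,y)"] c
    by simp
  also have "\<dots> = integral (cbox c d) (\<lambda>y. f (b, y) - f (a, y))"
  proof (rule integral_cong)
    fix y
    have "((\<lambda>x. d1 f (x, y)) has_integral (f (b, y) - f (a, y))) {a..b}"
      using assms has_real_derivative_d1[OF C1_differentiable[OF assms(1)]]
      by (intro fundamental_theorem_of_calculus)
         (auto simp: has_real_derivative_iff_has_vector_derivative[symmetric])
    then show "integral (cbox a b) (\<lambda>x. d1 f (x, y)) = f (b, y) - f (a, y)"
      by (simp add: integral_unique)
  qed
  finally show ?thesis by (simp add: case_prod_unfold)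
qed

lemma integral_d2_rectangle:
  assumes "C1 f" "c \<le> d"
  shows "integral (cbox (a, c) (b, d)) (d2 f) = integral {a..b} (\<lambda>x. f (x, d) - f (x, c))"
proof -
  have c: "continuous_on S (d2 f)" for S using assms C1_continuous_d2 by blast
  have "integral (cbox (a, c) (b, d)) (d2 f) =
      integral (cbox a b) (\<lambda>x. integral (cbox c d) (\<lambda>y. d2 f (x, y)))"
    using integral_prod_continuous[OF c, of a c b d] .
  also have "\<dots> = integral (cbox a b) (\<lambda>x. f (x, d) - f (x, c))"
  proof (rule integral_cong)
    fix x
    have "((\<lambda>y. d2 f (x, y)) has_integral (f (x, d) - f (x, c))) {c..d}"
      using assms has_real_derivative_d2[OF C1_differentiable[OF assms(1)]]
      by (intro fundamental_theorem_of_calculus)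
         (auto simp: has_real_derivative_iff_has_vector_derivative[symmetric])
    then show "integral (cbox c d) (\<lambda>y. d2 f (x, y)) = f (x, d) - f (x, c)"
      by (simp add: integral_unique)
  qed
  finally show ?thesis by simp
qed

lemma divergence_theorem_rectangle:
  assumes "C1 F" "C1 G" "a \<le> b" "c \<le> d"
  shows "integral (cbox (a, c) (b, d)) (\<lambda>x. d1 F x + d2 G x) =
    integral {c..d} (\<lambda>y. F (b, y) - F (a, y)) + integral {a..b} (\<lambda>x. G (x, d) - G (x, c))"
  using assms integral_d1_rectangle integral_d2_rectangle
  by (subst Henstock_Kurzweil_Integration.integral_add)
     (auto intro!: integrable_continuous C1_continuous_d1 C1_continuous_d2)

lemma continuous_rectangle_integral_pos:
  assumes "continuous_on UNIV (f :: real \<times> real \<Rightarrow> real)" "f p > 0"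
  obtains a b c d where "a < b" "c < d" "0 < integral (cbox (a, c) (b, d)) f"
proof -
  have "open {x. f x > f p / 2}"
    using assms(1) by (intro open_Collect_less) (auto intro!: continuous_intros)
  moreover have "p \<in> {x. f x > f p / 2}" using assms(2) by simp
  ultimately obtain e where e: "e > 0" "ball p e \<subseteq> {x. f x > f p / 2}" by (rule openE)
  let ?a = "fst p - e/2" and ?b = "fst p + e/2" and ?c = "snd p - e/2" and ?d = "snd p + e/2"
  have sub: "cbox (?a, ?c) (?b, ?d) \<subseteq> ball p e"
  proof
    fix z assume z: "z \<in> cbox (?a, ?c) (?b, ?d)"
    obtain z1 z2 p1 p2 where zp: "z = (z1, z2)" "p = (p1, p2)" by fastforce
    then have "p1 - e/2 \<le> z1 \<and> z1 \<le> p1 + e/2 \<and> p2 - e/2 \<le> z2 \<and> z2 \<le> p2 + e/2"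
      using z by (auto simp: cbox_Pair_eq)
    then have "\<bar>p1 - z1\<bar> \<le> e/2" "\<bar>p2 - z2\<bar> \<le> e/2" by linarith+
    then have "(p1 - z1)\<^sup>2 \<le> (e/2)\<^sup>2" "(p2 - z2)\<^sup>2 \<le> (e/2)\<^sup>2" by (simp_all add: abs_le_square_iff[symmetric])
    then have "(p1 - z1)\<^sup>2 + (p2 - z2)\<^sup>2 \<le> e\<^sup>2 / 2" by (simp add: power_divide)
    also have "\<dots> < e\<^sup>2" using e(1) by simp
    finally have "(p1 - z1)\<^sup>2 + (p2 - z2)\<^sup>2 < e\<^sup>2" .
    then have "sqrt ((p1 - z1)\<^sup>2 + (p2 - z2)\<^sup>2) < e" using e(1) real_sqrt_less_mono by fastforce
    then show "z \<in> ball p e" by (simp add: zp dist_Pair_Pair dist_real_def)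
  qed
  have "integral (cbox (?a, ?c) (?b, ?d)) (\<lambda>x. f p / 2) \<le> integral (cbox (?a, ?c) (?b, ?d)) f"
  proof (rule integral_le)
    show "f integrable_on cbox (?a, ?c) (?b, ?d)"
      by (intro integrable_continuous continuous_on_subset[OF assms(1)] subset_UNIV)
    show "f p / 2 \<le> f x" if "x \<in> cbox (?a, ?c) (?b, ?d)" for x
      using that sub e(2) by force
  qed (rule integrable_const)
  moreover have "integral (cbox (?a, ?c) (?b, ?d)) (\<lambda>x. f p / 2) > 0"
    using e assms(2) by (simp add: content_Pair)
  ultimately show ?thesis using that[of ?a ?b ?c ?d] e by simp
qed

lemma continuous_zero_rectangle_integrals:
  assumes "continuous_on UNIV (f :: real \<times> real \<Rightarrow> real)"
    and "\<And>a b c d. a < b \<Longrightarrow> c < d \<Longrightarrow> integral (cbox (a, c) (b, d)) f = 0"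
  shows "f x = 0"
proof (rule ccontr)
  assume "f x \<noteq> 0"
  then consider "f x > 0" | "- f x > 0" by linarith
  then show False
  proof cases
    case 1
    from continuous_rectangle_integral_pos[OF assms(1) this] obtain a b c d
      where "a < b" "c < d" "0 < integral (cbox (a, c) (b, d)) f" .
    with assms(2)[of a b c d] show ?thesis by simp
  next
    case 2
    have "continuous_on UNIV (\<lambda>x. - f x)" using assms(1) by (intro continuous_intros)
    from continuous_rectangle_integral_pos[OF this 2] obtain a b c d
      where "a < b" "c < d" "0 < integral (cbox (a, c) (b, d)) (\<lambda>x. - f x)" .
    with assms(2)[of a b c d] show ?thesis by simp
  qed
qed

text \<open>Over a rectangle both iterated integrals equal the alternating sum of \<open>f\<close> over the four
  corners, so the continuous function \<open>\<partial>\<^sub>1\<partial>\<^sub>2f - \<partial>\<^sub>2\<partial>\<^sub>1f\<close> has mean zero on every rectangle.\<close>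

lemma mixed_partials_commute:
  assumes "C1 f" "C1 (d1 f)" "C1 (d2 f)"
  shows "d1 (d2 f) = d2 (d1 f)"
proof -
  have "d1 (d2 f) x + - d2 (d1 f) x = 0" for x
  proof (rule continuous_zero_rectangle_integrals[where f="\<lambda>x. d1 (d2 f) x + - d2 (d1 f) x"])
    show "continuous_on UNIV (\<lambda>x. d1 (d2 f) x + - d2 (d1 f) x)"
      using assms by (auto intro!: continuous_intros C1_continuous_d1 C1_continuous_d2)
    fix a b c d :: real assume ab: "a < b" "c < d"
    have i1: "integral {c..d} (\<lambda>y. d2 f (x, y)) = f (x, d) - f (x, c)" for x
      using assms ab has_real_derivative_d2[OF C1_differentiable[OF assms(1)]]
      by (intro integral_unique fundamental_theorem_of_calculus)
         (auto simp: has_real_derivative_iff_has_vector_derivative[symmetric])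
    have i2: "integral {a..b} (\<lambda>x. d1 f (x, y)) = f (b, y) - f (a, y)" for y
      using assms ab has_real_derivative_d1[OF C1_differentiable[OF assms(1)]]
      by (intro integral_unique fundamental_theorem_of_calculus)
         (auto simp: has_real_derivative_iff_has_vector_derivative[symmetric])
    have c1: "continuous_on UNIV (d1 f)" and c2: "continuous_on UNIV (d2 f)" using assms by (auto simp: C1_def)
    have "integral (cbox (a, c) (b, d)) (\<lambda>x. d1 (d2 f) x + d2 (\<lambda>x. - d1 f x) x) =
      integral {c..d} (\<lambda>y. d2 f (b, y) - d2 f (a, y)) + integral {a..b} (\<lambda>x. - d1 f (x, d) - - d1 f (x, c))"
      using assms ab by (intro divergence_theorem_rectangle) (auto intro: C1_intros)
    also have "integral {c..d} (\<lambda>y. d2 f (b, y) - d2 f (a, y)) = (f (b, d) - f (b, c)) - (f (a, d) - f (a, c))"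
      by (subst Henstock_Kurzweil_Integration.integral_diff)
         (auto simp: i1 intro!: integrable_continuous_interval continuous_on_pair c1 c2)
    also have "integral {a..b} (\<lambda>x. - d1 f (x, d) - - d1 f (x, c)) = (f (b, c) - f (a, c)) - (f (b, d) - f (a, d))"
      by (subst Henstock_Kurzweil_Integration.integral_diff)
         (auto simp: i2 intro!: integrable_continuous_interval integrable_neg continuous_on_pair c1 c2)
    finally show "integral (cbox (a, c) (b, d)) (\<lambda>x. d1 (d2 f) x + - d2 (d1 f) x) = 0"
      using assms by (simp add: partials_minus)
  qed
  then show ?thesis by (auto simp: fun_eq_iff add_eq_0_iff)
qed

section \<open>Integration by parts on the torus\<close>

abbreviation torus_integral :: "(real \<times> real \<Rightarrow> real) \<Rightarrow> real" where
  "torus_integral f \<equiv> integral (cbox (-pi, -pi) (pi, pi)) f"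

definition C2 :: "(real \<times> real \<Rightarrow> real) \<Rightarrow> bool" where
  "C2 f \<longleftrightarrow> C1 f \<and> C1 (d1 f) \<and> C1 (d2 f)"

lemma C2_D: "C2 f \<Longrightarrow> C1 f" "C2 f \<Longrightarrow> C1 (d1 f)" "C2 f \<Longrightarrow> C1 (d2 f)"
  by (auto simp: C2_def)

lemma C2_mixed_partials: "C2 f \<Longrightarrow> d2 (d1 f) = d1 (d2 f)"
  using mixed_partials_commute by (auto simp: C2_def)

lemma periodic_partials:
  assumes "periodic f" "C1 f"
  shows "periodic (d1 f)" "periodic (d2 f)"
proof -
  have *: "d1 f (x + v) = d1 f x \<and> d2 f (x + v) = d2 f x" if v: "\<And>x. f (x + v) = f x" for v x
  proof -
    have "((\<lambda>x. f (x + v)) has_derivative (\<lambda>h. fst h * d1 f (x + v) + snd h * d2 f (x + v))) (at x)"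
      using has_derivative_partials[OF C1_differentiable[OF assms(2)], of "x + v"]
      by (intro has_derivative_compose[of "\<lambda>x. x + v" "\<lambda>h. h" x UNIV f, simplified])
         (auto intro!: derivative_eq_intros)
    then have "(f has_derivative (\<lambda>h. fst h * d1 f (x + v) + snd h * d2 f (x + v))) (at x)"
      using v by simp
    from d1_eqI[OF this] d2_eqI[OF this] show ?thesis by simp
  qed
  have "f (x + (2 * pi, 0)) = f x" "f (x + (0, 2 * pi)) = f x" for x
    using assms(1) by (cases x; simp add: periodic_def)+
  from *[OF this(1)] *[OF this(2)] show "periodic (d1 f)" "periodic (d2 f)"
    by (auto simp: periodic_def)
qed

lemma periodic_add: "periodic f \<Longrightarrow> periodic g \<Longrightarrow> periodic (\<lambda>x. f x + g x)"
  and periodic_diff: "periodic f \<Longrightarrow> periodic g \<Longrightarrow> periodic (\<lambda>x. f x - g x)"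
  and periodic_mult: "periodic f \<Longrightarrow> periodic g \<Longrightarrow> periodic (\<lambda>x. f x * g x)"
  and periodic_minus: "periodic f \<Longrightarrow> periodic (\<lambda>x. - f x)"
  and periodic_cmult: "periodic f \<Longrightarrow> periodic (\<lambda>x. c * f x)"
  for f g :: "real \<times> real \<Rightarrow> real"
  by (auto simp: periodic_def)

lemmas periodic_intros = periodic_add periodic_diff periodic_mult periodic_minus periodic_cmult

lemma continuous_integrable: "continuous_on UNIV f \<Longrightarrow> (f :: real \<times> real \<Rightarrow> real) integrable_on cbox a b"
  by (meson continuous_on_subset integrable_continuous subset_UNIV)

lemma torus_integral_divergence:
  assumes "C1 F" "C1 G" "periodic F" "periodic G"
  shows "torus_integral (\<lambda>x. d1 F x + d2 G x) = 0"
proof -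
  have "F (pi, y) = F (-pi, y)" "G (y, pi) = G (y, -pi)" for y
    using assms(3,4) unfolding periodic_def
    by (metis add.commute diff_add_cancel mult_2 uminus_add_conv_diff)+
  then show ?thesis
    by (subst divergence_theorem_rectangle) (use assms in auto)
qed

lemma torus_integration_by_parts:
  assumes "C1 f" "C1 a" "C1 b" "periodic f" "periodic a" "periodic b"
  shows "torus_integral (\<lambda>x. d1 f x * a x + d2 f x * b x) =
       - torus_integral (\<lambda>x. f x * (d1 a x + d2 b x))"
proof -
  note c = C1_continuous C1_continuous_d1 C1_continuous_d2
  have "torus_integral (\<lambda>x. d1 (\<lambda>x. f x * a x) x + d2 (\<lambda>x. f x * b x) x) = 0"
    using assms by (intro torus_integral_divergence C1_intros periodic_intros)
  also have "(\<lambda>x. d1 (\<lambda>x. f x * a x) x + d2 (\<lambda>x. f x * b x) x) =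
     (\<lambda>x. (d1 f x * a x + d2 f x * b x) + f x * (d1 a x + d2 b x))"
    using assms by (simp add: partials algebra_simps)
  also have "torus_integral \<dots> = torus_integral (\<lambda>x. d1 f x * a x + d2 f x * b x)
      + torus_integral (\<lambda>x. f x * (d1 a x + d2 b x))"
    by (intro Henstock_Kurzweil_Integration.integral_add continuous_integrable continuous_on_add continuous_on_mult c assms)
  finally show ?thesis by simp
qed

text \<open>The derivative of \<open>f\<close> along the velocity \<open>\<nabla>\<^sup>\<bottom>\<psi>\<close>.\<close>

definition advect :: "(real \<times> real \<Rightarrow> real) \<Rightarrow> (real \<times> real \<Rightarrow> real) \<Rightarrow> real \<times> real \<Rightarrow> real" where
  "advect \<psi> f x = d2 \<psi> x * d1 f x - d1 \<psi> x * d2 f x"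

lemma advect_self: "advect \<psi> \<psi> = (\<lambda>x. 0)"
  by (simp add: advect_def fun_eq_iff)

lemma advect_eq_divergence:
  assumes "C2 \<psi>" "C1 f"
  shows "advect \<psi> f = (\<lambda>x. d1 (\<lambda>x. f x * d2 \<psi> x) x + d2 (\<lambda>x. f x * - d1 \<psi> x) x)"
  using assms C2_D[OF assms(1)]
  by (simp add: partials C1_intros C2_mixed_partials advect_def fun_eq_iff algebra_simps)

text \<open>Transport by a divergence-free velocity is antisymmetric in \<open>L\<^sup>2\<close>. It is used in three ways: with
  \<open>g = f\<close> both sides vanish, with \<open>g = \<psi>\<close> the right-hand side vanishes because \<open>\<nabla>\<^sup>\<bottom>\<psi>\<close> is tangent to the
  level sets of \<open>\<psi>\<close>, and in general a derivative is moved from \<open>f\<close> to \<open>g\<close>.\<close>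

lemma advect_skew:
  assumes "C2 \<psi>" "C1 f" "C1 g" "periodic \<psi>" "periodic f" "periodic g"
  shows "torus_integral (\<lambda>x. g x * advect \<psi> f x) = - torus_integral (\<lambda>x. f x * advect \<psi> g x)"
proof -
  note C = C2_D[OF assms(1)]
  note p = periodic_partials[OF assms(4) C(1)]
  have "torus_integral (\<lambda>x. f x * advect \<psi> g x) =
     torus_integral (\<lambda>x. d1 g x * (f x * d2 \<psi> x) + d2 g x * (f x * - d1 \<psi> x))"
    by (simp add: advect_def algebra_simps)
  also have "\<dots> = - torus_integral (\<lambda>x. g x * advect \<psi> f x)"
    unfolding advect_eq_divergence[OF assms(1,2)]
    using assms p C by (intro torus_integration_by_parts C1_intros periodic_intros)
  finally show ?thesis by simp
qed

text \<open>The left-hand side contains second derivatives of \<open>\<psi>\<close>, the right-hand side only first ones.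
  The reason is that \<open>\<Delta>\<psi>\<nabla>\<psi>\<close> is the divergence of the stress tensor \<open>\<nabla>\<psi>\<otimes>\<nabla>\<psi> - |\<nabla>\<psi>|\<^sup>2/2\<close>: after an
  integration by parts the remaining derivative falls on the velocity \<open>\<nabla>\<^sup>\<bottom>\<phi>\<close>.\<close>

lemma stress_estimate:
  assumes "C2 \<phi>" "C2 \<psi>" "periodic \<phi>" "periodic \<psi>"
    and K: "\<And>x. \<bar>d1 (d1 \<phi>) x\<bar> \<le> K" "\<And>x. \<bar>d1 (d2 \<phi>) x\<bar> \<le> K" "\<And>x. \<bar>d2 (d2 \<phi>) x\<bar> \<le> K"
  shows "\<bar>torus_integral (\<lambda>x. laplacian \<psi> x * advect \<phi> \<psi> x)\<bar> \<le>
    2 * K * torus_integral (\<lambda>x. (d1 \<psi> x)\<^sup>2 + (d2 \<psi> x)\<^sup>2)"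
proof -
  define a b p q where "a = d1 \<psi>" "b = d2 \<psi>" "p = d2 \<phi>" "q = (\<lambda>x. - d1 \<phi> x)"
  note ab = this
  note Cp = C2_D[OF assms(1)] and Cs = C2_D[OF assms(2)]
  have C: "C1 a" "C1 b" "C1 p" "C1 q" using Cp Cs by (auto simp: ab intro: C1_intros)
  have P: "periodic a" "periodic b" "periodic p" "periodic q"
    using assms Cp Cs by (auto simp: ab intro!: periodic_intros periodic_partials)
  have q: "d1 q = (\<lambda>x. - d1 (d1 \<phi>) x)" "d2 q = (\<lambda>x. - d1 (d2 \<phi>) x)"
    using Cp C2_mixed_partials[OF assms(1)] by (auto simp: ab partials)
  have mixed: "d2 a = d1 b" using C2_mixed_partials[OF assms(2)] by (simp add: ab)
  \<comment> \<open>The vector field \<open>(F, G)\<close> is the stress tensor applied to the velocity \<open>(p, q)\<close>; \<open>r\<close> collects the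
    terms of its divergence in which \<open>(p, q)\<close> is differentiated.\<close>
  define F where "F = (\<lambda>x. (1/2) * (p x * (a x * a x - b x * b x)) + q x * (a x * b x))"
  define G where "G = (\<lambda>x. (1/2) * (q x * (b x * b x - a x * a x)) + p x * (a x * b x))"
  define r where "r = (\<lambda>x. d1 (d2 \<phi>) x * (a x * a x - b x * b x) + (d2 (d2 \<phi>) x - d1 (d1 \<phi>) x) * (a x * b x))"
  have FG: "C1 F" "C1 G" "periodic F" "periodic G"
    unfolding F_def G_def by (intro C1_intros periodic_intros C P)+
  have dF: "d1 F = (\<lambda>x. (1/2) * (d1 p x * (a x * a x - b x * b x) + p x * ((d1 a x * a x + a x * d1 a x) - (d1 b x * b x + b x * d1 b x)))
      + (d1 q x * (a x * b x) + q x * (d1 a x * b x + a x * d1 b x)))"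
    unfolding F_def by (simp only: partials C1_intros C)
  have dG: "d2 G = (\<lambda>x. (1/2) * (d2 q x * (b x * b x - a x * a x) + q x * ((d2 b x * b x + b x * d2 b x) - (d2 a x * a x + a x * d2 a x)))
      + (d2 p x * (a x * b x) + p x * (d2 a x * b x + a x * d2 b x)))"
    unfolding G_def by (simp only: partials C1_intros C)
  have eq: "laplacian \<psi> x * advect \<phi> \<psi> x = (d1 F x + d2 G x) - r x" for x
  proof -
    have "laplacian \<psi> x = d1 a x + d2 b x" "advect \<phi> \<psi> x = p x * a x + q x * b x"
      by (simp_all add: laplacian_def advect_def ab)
    moreover have "d1 p x = d1 (d2 \<phi>) x" "d2 p x = d2 (d2 \<phi>) x" by (simp_all add: ab)
    ultimately show ?thesis
      unfolding dF dG r_def by (simp only: q mixed) (simp add: field_simps)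
  qed
  note c = C1_continuous C1_continuous_d1 C1_continuous_d2
  have rc: "continuous_on UNIV r" unfolding r_def
    by (intro continuous_intros c C Cp)
  have "torus_integral (\<lambda>x. laplacian \<psi> x * advect \<phi> \<psi> x) = torus_integral (\<lambda>x. (d1 F x + d2 G x) - r x)"
    using eq by simp
  also have "\<dots> = torus_integral (\<lambda>x. d1 F x + d2 G x) - torus_integral r"
    by (intro Henstock_Kurzweil_Integration.integral_diff continuous_integrable continuous_on_add c FG rc)
  also have "\<dots> = - torus_integral r" using torus_integral_divergence[OF FG] by simp
  finally have "\<bar>torus_integral (\<lambda>x. laplacian \<psi> x * advect \<phi> \<psi> x)\<bar> = norm (torus_integral r)" by simp
  also have "\<dots> \<le> torus_integral (\<lambda>x. 2 * K * ((d1 \<psi> x)\<^sup>2 + (d2 \<psi> x)\<^sup>2))"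
  proof (rule integral_norm_bound_integral)
    show "(\<lambda>x. 2 * K * ((d1 \<psi> x)\<^sup>2 + (d2 \<psi> x)\<^sup>2)) integrable_on cbox (- pi, - pi) (pi, pi)"
      by (intro continuous_integrable continuous_intros c Cs)
    fix x
    have "0 \<le> K" using K(1)[of x] by linarith
    have "\<bar>d1 (d2 \<phi>) x * (a x * a x - b x * b x)\<bar> \<le> K * (a x * a x + b x * b x)"
      unfolding abs_mult using \<open>0 \<le> K\<close> K(2) by (intro mult_mono) (auto simp: abs_le_iff)
    moreover have "\<bar>(d2 (d2 \<phi>) x - d1 (d1 \<phi>) x) * (a x * b x)\<bar> \<le> (2 * K) * ((a x * a x + b x * b x) / 2)"
    proof -
      have "\<bar>d2 (d2 \<phi>) x - d1 (d1 \<phi>) x\<bar> \<le> 2 * K" using K(1,3)[of x] by linarith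
      moreover have "\<bar>a x * b x\<bar> \<le> (a x * a x + b x * b x) / 2"
        using sum_squares_bound[of "a x" "b x"] sum_squares_bound[of "- a x" "b x"]
        by (simp add: abs_le_iff power2_eq_square)
      ultimately show ?thesis unfolding abs_mult[of "_ - _"] using \<open>0 \<le> K\<close> by (intro mult_mono) auto
    qed
    ultimately show "norm (r x) \<le> 2 * K * ((d1 \<psi> x)\<^sup>2 + (d2 \<psi> x)\<^sup>2)"
      unfolding r_def ab[symmetric] real_norm_def power2_eq_square by argo
  qed (intro continuous_integrable rc)
  finally show ?thesis by simp
qed

section \<open>Functions of time and space\<close>

definition jcont :: "real \<Rightarrow> (real \<Rightarrow> real \<times> real \<Rightarrow> real) \<Rightarrow> bool" where
  "jcont t1 f \<longleftrightarrow> continuous_on ({0..t1} \<times> UNIV) (\<lambda>(t, x). f t x)"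

lemma jcont_add: "jcont T f \<Longrightarrow> jcont T g \<Longrightarrow> jcont T (\<lambda>t x. f t x + g t x)"
  and jcont_diff: "jcont T f \<Longrightarrow> jcont T g \<Longrightarrow> jcont T (\<lambda>t x. f t x - g t x)"
  and jcont_mult: "jcont T f \<Longrightarrow> jcont T g \<Longrightarrow> jcont T (\<lambda>t x. f t x * g t x)"
  and jcont_minus: "jcont T f \<Longrightarrow> jcont T (\<lambda>t x. - f t x)"
  and jcont_const: "jcont T (\<lambda>t x. c)"
  unfolding jcont_def by (auto simp: case_prod_unfold intro!: continuous_intros)

lemmas jcont_intros = jcont_add jcont_diff jcont_mult jcont_minus jcont_const

lemma jcont_cong: "jcont T g \<Longrightarrow> (\<And>t. t \<in> {0..T} \<Longrightarrow> f t = g t) \<Longrightarrow> jcont T f"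
  unfolding jcont_def by (erule continuous_on_eq) auto

lemma jcont_compose:
  assumes "jcont T f" "continuous_on S g" "continuous_on S h" "\<And>z. z \<in> S \<Longrightarrow> g z \<in> {0..T}"
  shows "continuous_on S (\<lambda>z. f (g z) (h z))"
proof -
  have "continuous_on S (\<lambda>z. (\<lambda>(t, x). f t x) (g z, h z))"
    using assms by (intro continuous_on_compose2[OF assms(1)[unfolded jcont_def]])
      (auto intro!: continuous_intros)
  then show ?thesis by simp
qed

lemma jcont_slice: "jcont T f \<Longrightarrow> t \<in> {0..T} \<Longrightarrow> continuous_on S (f t)"
  by (rule jcont_compose[where g="\<lambda>_. t" and h="\<lambda>x. x"]) (auto intro!: continuous_intros)

text \<open>One point of the square serves all periodic functions at once, so that a bound proved at it for
  several functions can be combined.\<close>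

lemma torus_representative:
  "\<exists>y \<in> cbox (-pi, -pi) (pi, pi). \<forall>f :: real \<times> real \<Rightarrow> 'b. periodic f \<longrightarrow> f y = f x"
proof -
  obtain x1 x2 where x: "x = (x1, x2)" by fastforce
  define r where "r s = s - of_int \<lfloor>(s + pi) / (2 * pi)\<rfloor> * (2 * pi)" for s :: real
  have r: "- pi \<le> r s \<and> r s \<le> pi" for s
  proof -
    have "of_int \<lfloor>(s + pi) / (2 * pi)\<rfloor> \<le> (s + pi) / (2 * pi)"
      "(s + pi) / (2 * pi) \<le> of_int \<lfloor>(s + pi) / (2 * pi)\<rfloor> + 1" by linarith+
    then have "of_int \<lfloor>(s + pi) / (2 * pi)\<rfloor> * (2 * pi) \<le> s + pi"
      "s + pi \<le> (of_int \<lfloor>(s + pi) / (2 * pi)\<rfloor> + 1) * (2 * pi)"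
      by (simp_all only: pos_le_divide_eq pos_divide_le_eq pi_gt_zero zero_less_mult_iff zero_less_numeral simp_thms)
    then show ?thesis unfolding r_def by (simp only: distrib_right) linarith
  qed
  show ?thesis
  proof (intro bexI allI impI)
    show "(r x1, r x2) \<in> cbox (-pi, -pi) (pi, pi)" using r by (auto simp: cbox_Pair_eq)
    fix f :: "real \<times> real \<Rightarrow> 'b" assume f: "periodic f"
    interpret P1: periodic_fun_simple "\<lambda>s. f (s, s')" "2 * pi" for s'
      using f by unfold_locales (simp add: periodic_def)
    interpret P2: periodic_fun_simple "\<lambda>s. f (s', s)" "2 * pi" for s'
      using f by unfold_locales (simp add: periodic_def)
    show "f (r x1, r x2) = f x" by (simp add: r_def x P1.minus_of_int P2.minus_of_int)
  qed
qed

lemma jcont_bounded: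
  assumes "jcont T f" "\<And>t. t \<in> {0..T} \<Longrightarrow> periodic (f t)"
  obtains K where "\<And>t x. t \<in> {0..T} \<Longrightarrow> \<bar>f t x\<bar> \<le> K"
proof -
  have "compact ((\<lambda>(t, x). f t x) ` ({0..T} \<times> cbox (-pi, -pi) (pi, pi)))"
    using assms(1) unfolding jcont_def
    by (intro compact_continuous_image compact_Times) (auto elim: continuous_on_subset)
  then obtain K where K: "\<And>t x. t \<in> {0..T} \<Longrightarrow> x \<in> cbox (-pi, -pi) (pi, pi) \<Longrightarrow> \<bar>f t x\<bar> \<le> K"
    by (fastforce dest!: compact_imp_bounded simp: bounded_iff)
  have "\<bar>f t x\<bar> \<le> K" if "t \<in> {0..T}" for t x
  proof -
    obtain y where "y \<in> cbox (-pi, -pi) (pi, pi)" "\<forall>f :: real \<times> real \<Rightarrow> real. periodic f \<longrightarrow> f y = f x"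
      using torus_representative[of x] by blast
    then show ?thesis using K[OF that, of y] assms(2)[OF that] by metis
  qed
  then show ?thesis using that by blast
qed

lemma derivative_under_integral:
  assumes "\<And>s x. s \<in> {0..T} \<Longrightarrow> ((\<lambda>s. f s x) has_real_derivative f' s x) (at s within {0..T})"
    and "jcont T f" "jcont T f'" "t \<in> {0..T}"
  shows "((\<lambda>s. integral (cbox a b) (f s)) has_real_derivative integral (cbox a b) (f' t)) (at t within {0..T})"
proof (rule leibniz_rule_field_derivative)
  show "f s integrable_on cbox a b" if "s \<in> {0..T}" for s
    using jcont_slice[OF assms(2) that] by (rule continuous_integrable)
  show "continuous_on ({0..T} \<times> cbox a b) (\<lambda>(t, x). f' t x)"
    using assms(3) unfolding jcont_def by (rule continuous_on_subset) auto
qed (use assms in auto)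

lemma interval_mvt:
  fixes f :: "real \<Rightarrow> real"
  assumes "\<And>s. s \<in> {0..T} \<Longrightarrow> (f has_real_derivative f' s) (at s within {0..T})"
    and "0 \<le> r" "r \<le> t" "t \<le> T"
  obtains s where "r \<le> s" "s \<le> t" "f t - f r = f' s * (t - r)"
proof (cases "r = t")
  case True then show ?thesis using that by force
next
  case False
  have "\<exists>s\<in>{r<..<t}. f t - f r = (\<lambda>s h. f' s * h) s (t - r)"
  proof (rule mvt_simple)
    fix s assume "r \<le> s" "s \<le> t"
    then have "(f has_real_derivative f' s) (at s within {r..t})"
      using assms by (intro DERIV_subset[OF assms(1)[of s]]) auto
    then show "(f has_derivative (\<lambda>h. f' s * h)) (at s within {r..t})"
      by (simp add: has_field_derivative_def)
  qed (use assms False in simp)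
  then obtain s where "s \<in> {r<..<t}" "f t - f r = f' s * (t - r)" by blast
  then show ?thesis using that[of s] by simp
qed

lemma gronwall_zero:
  fixes y :: "real \<Rightarrow> real"
  assumes y': "\<And>s. s \<in> {0..T} \<Longrightarrow> (y has_real_derivative y' s) (at s within {0..T})"
    and "\<And>s. s \<in> {0..T} \<Longrightarrow> y' s \<le> C * y s" "\<And>s. s \<in> {0..T} \<Longrightarrow> 0 \<le> y s" "y 0 = 0"
    and t: "t \<in> {0..T}"
  shows "y t = 0"
proof -
  define g where "g s = exp (- C * s) * y s" for s
  have g': "(g has_real_derivative exp (- C * s) * (y' s - C * y s)) (at s within {0..T})" if "s \<in> {0..T}" for s
    unfolding g_def using y'[OF that] by (auto intro!: derivative_eq_intros simp: algebra_simps)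
  obtain s where s: "0 \<le> s" "s \<le> t" "g t - g 0 = exp (- C * s) * (y' s - C * y s) * (t - 0)"
    by (rule interval_mvt[OF g', of 0 t]) (use t in auto)
  have "exp (- C * s) * (y' s - C * y s) * (t - 0) \<le> 0"
    using assms(2)[of s] s t by (intro mult_nonpos_nonneg mult_nonneg_nonpos) auto
  then have "g t \<le> 0" using s(3) assms(4) by (simp add: g_def)
  then have "y t \<le> 0" by (simp add: g_def mult_le_0_iff)
  then show ?thesis using assms(3)[OF t] by simp
qed

section \<open>Uniqueness of classical solutions\<close>

lemma C1_zero: "C1 (\<lambda>x. 0)" and partials_zero: "d1 (\<lambda>x. 0) = (\<lambda>x. 0)" "d2 (\<lambda>x. 0) = (\<lambda>x. 0)"
  using C1_cmult[OF C1_snd, of 0] partials_cmult[OF C1_snd, of 0] by simp_all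

lemma advect_diff:
  assumes "C1 \<psi>1" "C1 \<psi>2" "C1 f" "C1 g"
  shows "advect \<psi>1 f x - advect \<psi>2 g x = advect \<psi>1 (\<lambda>x. f x - g x) x + advect (\<lambda>x. \<psi>1 x - \<psi>2 x) g x"
  using assms by (simp add: advect_def partials algebra_simps)

lemma laplacian_diff: "C2 f \<Longrightarrow> C2 g \<Longrightarrow> laplacian (\<lambda>x. f x - g x) = (\<lambda>x. laplacian f x - laplacian g x)"
  by (simp add: laplacian_def fun_eq_iff partials C2_D)

lemma C2_diff: "C2 f \<Longrightarrow> C2 g \<Longrightarrow> C2 (\<lambda>x. f x - g x)"
  by (simp add: C2_def partials C1_intros)

lemma laplacian_continuous: "C2 f \<Longrightarrow> continuous_on S (laplacian f)"
  unfolding laplacian_def[abs_def] by (intro continuous_on_add C1_continuous_d1 C1_continuous_d2 C2_D)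

lemma advect_continuous: "C1 f \<Longrightarrow> C1 g \<Longrightarrow> continuous_on S (advect f g)"
  unfolding advect_def[abs_def] by (intro continuous_intros C1_continuous_d1 C1_continuous_d2)

lemma periodic_laplacian: "C2 f \<Longrightarrow> periodic f \<Longrightarrow> periodic (laplacian f)"
  unfolding laplacian_def[abs_def] by (intro periodic_intros periodic_partials C2_D)

lemma dirichlet_identity:
  assumes "C1 f" "C2 g" "periodic f" "periodic g"
  shows "torus_integral (\<lambda>x. d1 f x * d1 g x + d2 f x * d2 g x) = - torus_integral (\<lambda>x. f x * laplacian g x)"
  unfolding laplacian_def using assms C2_D[OF assms(2)]
  by (intro torus_integration_by_parts periodic_partials)

lemma zero_if_torus_integral_zero:
  assumes "continuous_on UNIV f" "\<And>x. 0 \<le> f x" "torus_integral f = 0" "periodic f"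
  shows "f x = (0::real)"
proof -
  obtain y where y: "y \<in> cbox (-pi, -pi) (pi, pi)" "f y = f x"
    using torus_representative[of x] assms(4) by blast
  have "f y = 0"
  proof (rule has_integral_0_cbox_imp_0[where a="(-pi,-pi)" and b="(pi,pi)"])
    show "(f has_integral 0) (cbox (-pi, -pi) (pi, pi))"
      using integrable_integral[OF continuous_integrable[OF assms(1)], of "(-pi,-pi)" "(pi,pi)"] assms(3) by simp
    show "box (-pi, -pi) (pi, pi) \<noteq> ({} :: (real \<times> real) set)"
      by (simp add: box_ne_empty Basis_prod_def)
  qed (use assms(1,2) y in \<open>auto elim: continuous_on_subset\<close>)
  with y show ?thesis by simp
qed

text \<open>A difference \<open>h\<close> with \<open>\<Delta>h = 0\<close> has \<open>\<integral>|\<nabla>h|\<^sup>2 = - \<integral>h\<Delta>h = 0\<close>. This makes the velocity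
  a function of the vorticity.\<close>

lemma gradient_determined_by_laplacian:
  assumes "C2 f" "C2 g" "periodic f" "periodic g" "laplacian f = laplacian g"
  shows "d1 f x = d1 g x" "d2 f x = d2 g x"
proof -
  let ?h = "\<lambda>x. f x - g x"
  have C: "C2 ?h" "periodic ?h" using assms by (auto intro: C2_diff periodic_diff)
  note C1h = C2_D[OF C(1)]
  let ?e = "\<lambda>x. d1 ?h x * d1 ?h x + d2 ?h x * d2 ?h x"
  have "?e x = 0"
  proof (rule zero_if_torus_integral_zero)
    show "continuous_on UNIV ?e" by (intro continuous_intros C1_continuous C1h)
    show "torus_integral ?e = 0"
      using dirichlet_identity[OF C1h(1) C(1) C(2) C(2)] laplacian_diff[OF assms(1,2)] assms(5) by simp
    show "periodic ?e" by (intro periodic_intros periodic_partials C C1h)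
  qed simp
  then show "d1 f x = d1 g x" "d2 f x = d2 g x"
    using assms(1,2) by (simp_all add: sum_squares_eq_zero_iff partials C2_D)
qed

lemma derivative_within_cong:
  "t \<in> S \<Longrightarrow> (f has_real_derivative D) (at t within S) \<Longrightarrow> (\<And>s. s \<in> S \<Longrightarrow> g s = f s) \<Longrightarrow>
    (g has_real_derivative D) (at t within S)"
  unfolding has_field_derivative_def by (rule has_derivative_transform)

text \<open>The parameters \<open>A\<close>, \<open>B\<close>, \<open>L\<close> are the time derivatives of \<open>\<partial>\<^sub>1\<psi>\<close>, \<open>\<partial>\<^sub>2\<psi>\<close> and \<open>\<Delta>\<psi>\<close>. Regularity in time is
  asked of these derivatives of \<open>\<psi>\<close> only, because a stream function is selected separately at each
  time and only the velocity and the vorticity are known to be smooth in time.\<close>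

locale evolving_stream =
  fixes T :: real and \<psi> A B L :: "real \<Rightarrow> real \<times> real \<Rightarrow> real"
  assumes T_pos: "0 < T"
    and periodic_stream: "t \<in> {0..T} \<Longrightarrow> periodic (\<psi> t)"
    and C2_stream: "t \<in> {0..T} \<Longrightarrow> C2 (\<psi> t)"
    and deriv_d1: "t \<in> {0..T} \<Longrightarrow> ((\<lambda>s. d1 (\<psi> s) x) has_real_derivative A t x) (at t within {0..T})"
    and deriv_d2: "t \<in> {0..T} \<Longrightarrow> ((\<lambda>s. d2 (\<psi> s) x) has_real_derivative B t x) (at t within {0..T})"
    and deriv_laplacian: "t \<in> {0..T} \<Longrightarrow>
      ((\<lambda>s. laplacian (\<psi> s) x) has_real_derivative L t x) (at t within {0..T})"
    and jcont_stream: "jcont T (\<lambda>t. d1 (\<psi> t))" "jcont T (\<lambda>t. d2 (\<psi> t))"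
      "jcont T (\<lambda>t. d1 (d1 (\<psi> t)))" "jcont T (\<lambda>t. d1 (d2 (\<psi> t)))" "jcont T (\<lambda>t. d2 (d2 (\<psi> t)))"
      "jcont T A" "jcont T B" "jcont T L"
begin

lemma jcont_laplacian: "jcont T (\<lambda>t. laplacian (\<psi> t))"
  unfolding laplacian_def[abs_def] by (intro jcont_intros jcont_stream)

text \<open>The polarised identity \<open>\<integral>\<nabla>\<psi>(t)\<cdot>\<nabla>\<psi>(s) = -\<integral>\<psi>(t)\<Delta>\<psi>(s)\<close> is differentiated in \<open>s\<close> only, so
  that the time derivative of \<open>\<psi>\<close> itself, about which nothing is known, does not occur.\<close>

lemma kinetic_energy_derivative:
  assumes t: "t \<in> {0..T}"
  shows "((\<lambda>s. torus_integral (\<lambda>x. ((d1 (\<psi> s) x)\<^sup>2 + (d2 (\<psi> s) x)\<^sup>2) / 2))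
    has_real_derivative - torus_integral (\<lambda>x. \<psi> t x * L t x)) (at t within {0..T})"
proof -
  note C = C2_D[OF C2_stream]
  have jc: "jcont T (\<lambda>s x. f x * g s x)" if "continuous_on UNIV f" "jcont T g" 
    for f :: "real \<times> real \<Rightarrow> real" and g
  proof -
    have "continuous_on ({0..T} \<times> UNIV) (\<lambda>z. f (snd z))"
      by (rule continuous_on_compose2[OF that(1)]) (auto intro!: continuous_intros)
    with that(2) show ?thesis unfolding jcont_def case_prod_unfold by (intro continuous_intros)
  qed
  note c = C1_continuous C1_continuous_d1 C1_continuous_d2
  have D1: "((\<lambda>s. torus_integral (\<lambda>x. d1 (\<psi> t) x * d1 (\<psi> s) x + d2 (\<psi> t) x * d2 (\<psi> s) x))
      has_real_derivative torus_integral (\<lambda>x. d1 (\<psi> t) x * A t x + d2 (\<psi> t) x * B t x)) (at t within {0..T})"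
    using t by (intro derivative_under_integral jcont_add jc c C jcont_stream DERIV_add DERIV_cmult deriv_d1 deriv_d2)
  have "((\<lambda>s. torus_integral (\<lambda>x. \<psi> t x * laplacian (\<psi> s) x))
      has_real_derivative torus_integral (\<lambda>x. \<psi> t x * L t x)) (at t within {0..T})"
    using t by (intro derivative_under_integral jc c C jcont_stream jcont_laplacian DERIV_cmult deriv_laplacian)
  from DERIV_minus[OF this]
  have D2: "((\<lambda>s. torus_integral (\<lambda>x. d1 (\<psi> t) x * d1 (\<psi> s) x + d2 (\<psi> t) x * d2 (\<psi> s) x))
      has_real_derivative - torus_integral (\<lambda>x. \<psi> t x * L t x)) (at t within {0..T})"
    by (rule derivative_within_cong[OF t])
       (use dirichlet_identity C2_stream C periodic_stream t in auto)
  have "torus_integral (\<lambda>x. d1 (\<psi> t) x * A t x + d2 (\<psi> t) x * B t x) = - torus_integral (\<lambda>x. \<psi> t x * L t x)"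
    using vector_derivative_unique_within_closed_interval[OF T_pos, of t] t D1 D2
    by (simp add: has_real_derivative_iff_has_vector_derivative)
  moreover have "((\<lambda>s. torus_integral (\<lambda>x. ((d1 (\<psi> s) x)\<^sup>2 + (d2 (\<psi> s) x)\<^sup>2) / 2))
    has_real_derivative torus_integral (\<lambda>x. d1 (\<psi> t) x * A t x + d2 (\<psi> t) x * B t x)) (at t within {0..T})"
  proof (rule derivative_under_integral[OF _ _ _ t])
    show "((\<lambda>s. ((d1 (\<psi> s) x)\<^sup>2 + (d2 (\<psi> s) x)\<^sup>2) / 2) has_real_derivative
       d1 (\<psi> s) x * A s x + d2 (\<psi> s) x * B s x) (at s within {0..T})" if "s \<in> {0..T}" for s x
      using deriv_d1[OF that, of x] deriv_d2[OF that, of x] by (auto intro!: derivative_eq_intros)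
    show "jcont T (\<lambda>s x. ((d1 (\<psi> s) x)\<^sup>2 + (d2 (\<psi> s) x)\<^sup>2) / 2)"
      using jcont_mult[OF jcont_const[of T "1/2"] jcont_add[OF jcont_mult[OF jcont_stream(1,1)] jcont_mult[OF jcont_stream(2,2)]]]
      by (simp add: power2_eq_square)
  qed (intro jcont_intros jcont_stream)
  ultimately show ?thesis by simp
qed

end

lemma evolving_stream_diff:
  assumes "evolving_stream T \<psi>1 A1 B1 L1" "evolving_stream T \<psi>2 A2 B2 L2"
  shows "evolving_stream T (\<lambda>t x. \<psi>1 t x - \<psi>2 t x) (\<lambda>t x. A1 t x - A2 t x) (\<lambda>t x. B1 t x - B2 t x)
    (\<lambda>t x. L1 t x - L2 t x)"
proof -
  interpret s1: evolving_stream T \<psi>1 A1 B1 L1 by fact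
  interpret s2: evolving_stream T \<psi>2 A2 B2 L2 by fact
  note C = C2_D[OF s1.C2_stream] C2_D[OF s2.C2_stream] s1.C2_stream s2.C2_stream
  show ?thesis
  proof
    show "((\<lambda>s. d1 (\<lambda>x. \<psi>1 s x - \<psi>2 s x) x) has_real_derivative A1 t x - A2 t x) (at t within {0..T})"
      if "t \<in> {0..T}" for t x
      using DERIV_diff[OF s1.deriv_d1 s2.deriv_d1, OF that that]
      by (rule derivative_within_cong[OF that]) (simp add: partials C)
    show "((\<lambda>s. d2 (\<lambda>x. \<psi>1 s x - \<psi>2 s x) x) has_real_derivative B1 t x - B2 t x) (at t within {0..T})"
      if "t \<in> {0..T}" for t x
      using DERIV_diff[OF s1.deriv_d2 s2.deriv_d2, OF that that]
      by (rule derivative_within_cong[OF that]) (simp add: partials C)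
    show "((\<lambda>s. laplacian (\<lambda>x. \<psi>1 s x - \<psi>2 s x) x) has_real_derivative L1 t x - L2 t x) (at t within {0..T})"
      if "t \<in> {0..T}" for t x
      using DERIV_diff[OF s1.deriv_laplacian s2.deriv_laplacian, OF that that]
      by (rule derivative_within_cong[OF that]) (simp add: laplacian_diff C)
    show "jcont T (\<lambda>t. d1 (\<lambda>x. \<psi>1 t x - \<psi>2 t x))"
      by (rule jcont_cong[OF jcont_diff[OF s1.jcont_stream(1) s2.jcont_stream(1)]]) (simp add: partials C)
    show "jcont T (\<lambda>t. d2 (\<lambda>x. \<psi>1 t x - \<psi>2 t x))"
      by (rule jcont_cong[OF jcont_diff[OF s1.jcont_stream(2) s2.jcont_stream(2)]]) (simp add: partials C)
    show "jcont T (\<lambda>t. d1 (d1 (\<lambda>x. \<psi>1 t x - \<psi>2 t x)))"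
      by (rule jcont_cong[OF jcont_diff[OF s1.jcont_stream(3) s2.jcont_stream(3)]]) (simp add: partials C)
    show "jcont T (\<lambda>t. d1 (d2 (\<lambda>x. \<psi>1 t x - \<psi>2 t x)))"
      by (rule jcont_cong[OF jcont_diff[OF s1.jcont_stream(4) s2.jcont_stream(4)]]) (simp add: partials C)
    show "jcont T (\<lambda>t. d2 (d2 (\<lambda>x. \<psi>1 t x - \<psi>2 t x)))"
      by (rule jcont_cong[OF jcont_diff[OF s1.jcont_stream(5) s2.jcont_stream(5)]]) (simp add: partials C)
    show "periodic (\<lambda>x. \<psi>1 t x - \<psi>2 t x)" "C2 (\<lambda>x. \<psi>1 t x - \<psi>2 t x)" if "t \<in> {0..T}" for t
      by (intro periodic_diff C2_diff s1.periodic_stream s2.periodic_stream C that)+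
  qed (intro s1.T_pos jcont_diff s1.jcont_stream s2.jcont_stream)+
qed

text \<open>The system in terms of density and stream function: the velocity is \<open>\<nabla>\<^sup>\<bottom>\<psi>\<close> and the vorticity
  \<open>-\<Delta>\<psi>\<close>, so the value given to \<open>L\<close> is the vorticity equation with its sign reversed.\<close>

locale boussinesq_flow =
  evolving_stream T \<psi> A B "\<lambda>t x. d1 (\<rho> t) x - advect (\<psi> t) (laplacian (\<psi> t)) x"
  for T and \<rho> \<psi> A B :: "real \<Rightarrow> real \<times> real \<Rightarrow> real" +
  assumes periodic_density: "t \<in> {0..T} \<Longrightarrow> periodic (\<rho> t)"
    and C1_density: "t \<in> {0..T} \<Longrightarrow> C1 (\<rho> t)"
    and C1_laplacian: "t \<in> {0..T} \<Longrightarrow> C1 (laplacian (\<psi> t))"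
    and deriv_density: "t \<in> {0..T} \<Longrightarrow>
      ((\<lambda>s. \<rho> s x) has_real_derivative - advect (\<psi> t) (\<rho> t) x) (at t within {0..T})"
    and jcont_density: "jcont T \<rho>" "jcont T (\<lambda>t. d1 (\<rho> t))" "jcont T (\<lambda>t. d2 (\<rho> t))"
begin

lemma jcont_advect_density: "jcont T (\<lambda>t. advect (\<psi> t) (\<rho> t))"
  unfolding advect_def[abs_def] by (intro jcont_intros jcont_stream jcont_density)

end

text \<open>Energy estimate for the pair \<open>(R, \<nabla>\<Psi>)\<close> of differences: testing the difference of the
  vorticity equations with \<open>\<Psi>\<close> moves every derivative off \<open>R\<close> and off the vorticities, so that
  Gronwall's inequality applies at the level of \<open>L\<^sup>2\<close>.\<close>

theorem boussinesq_flow_unique: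
  assumes "boussinesq_flow T \<rho>1 \<psi>1 A1 B1" "boussinesq_flow T \<rho>2 \<psi>2 A2 B2"
    and init: "\<rho>1 0 = \<rho>2 0" "laplacian (\<psi>1 0) = laplacian (\<psi>2 0)"
    and t: "t \<in> {0..T}"
  shows "\<rho>1 t x = \<rho>2 t x" "d1 (\<psi>1 t) x = d1 (\<psi>2 t) x" "d2 (\<psi>1 t) x = d2 (\<psi>2 t) x"
proof -
  interpret f1: boussinesq_flow T \<rho>1 \<psi>1 A1 B1 by fact
  interpret f2: boussinesq_flow T \<rho>2 \<psi>2 A2 B2 by fact
  define \<Psi> R where "\<Psi> = (\<lambda>t x. \<psi>1 t x - \<psi>2 t x)" and "R = (\<lambda>t x. \<rho>1 t x - \<rho>2 t x)"
  interpret d: evolving_stream T \<Psi> "\<lambda>t x. A1 t x - A2 t x" "\<lambda>t x. B1 t x - B2 t x"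
    "\<lambda>t x. (d1 (\<rho>1 t) x - advect (\<psi>1 t) (laplacian (\<psi>1 t)) x) - (d1 (\<rho>2 t) x - advect (\<psi>2 t) (laplacian (\<psi>2 t)) x)"
    unfolding \<Psi>_def
    by (rule evolving_stream_diff) (rule f1.evolving_stream_axioms f2.evolving_stream_axioms)+
  note Cpsi = C2_D[OF f1.C2_stream] C2_D[OF f2.C2_stream] C2_D[OF d.C2_stream] f1.C2_stream f2.C2_stream d.C2_stream
  note Crho = f1.C1_density f2.C1_density f1.C1_laplacian f2.C1_laplacian
  have lapl: "laplacian (\<Psi> t) = (\<lambda>x. laplacian (\<psi>1 t) x - laplacian (\<psi>2 t) x)" if "t \<in> {0..T}" for t
    unfolding \<Psi>_def using that by (intro laplacian_diff Cpsi)
  have CR: "C1 (R t)" "periodic (R t)" if "t \<in> {0..T}" for t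
    using that unfolding R_def by (auto intro!: C1_diff Crho periodic_diff f1.periodic_density f2.periodic_density)
  have CL: "C1 (laplacian (\<Psi> t))" "periodic (laplacian (\<Psi> t))" if "t \<in> {0..T}" for t
    using that by (auto simp: lapl[OF that] intro!: C1_diff Crho periodic_diff periodic_laplacian 
       f1.C2_stream f1.periodic_stream f2.C2_stream f2.periodic_stream)
  obtain K where K: "0 \<le> K" "\<And>t x. t \<in> {0..T} \<Longrightarrow> \<bar>d1 (d1 (\<psi>1 t)) x\<bar> \<le> K"
    "\<And>t x. t \<in> {0..T} \<Longrightarrow> \<bar>d1 (d2 (\<psi>1 t)) x\<bar> \<le> K" "\<And>t x. t \<in> {0..T} \<Longrightarrow> \<bar>d2 (d2 (\<psi>1 t)) x\<bar> \<le> K"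
    "\<And>t x. t \<in> {0..T} \<Longrightarrow> \<bar>d1 (\<rho>2 t) x\<bar> \<le> K" "\<And>t x. t \<in> {0..T} \<Longrightarrow> \<bar>d2 (\<rho>2 t) x\<bar> \<le> K"
  proof -
    note p = periodic_partials
    obtain K1 where K1: "\<And>t x. t \<in> {0..T} \<Longrightarrow> \<bar>d1 (d1 (\<psi>1 t)) x\<bar> \<le> K1"
      using jcont_bounded[OF f1.jcont_stream(3)] by (metis p f1.periodic_stream Cpsi(1,2))
    obtain K2 where K2: "\<And>t x. t \<in> {0..T} \<Longrightarrow> \<bar>d1 (d2 (\<psi>1 t)) x\<bar> \<le> K2"
      using jcont_bounded[OF f1.jcont_stream(4)] by (metis p f1.periodic_stream Cpsi(1,3))
    obtain K3 where K3: "\<And>t x. t \<in> {0..T} \<Longrightarrow> \<bar>d2 (d2 (\<psi>1 t)) x\<bar> \<le> K3"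
      using jcont_bounded[OF f1.jcont_stream(5)] by (metis p f1.periodic_stream Cpsi(1,3))
    obtain K4 where K4: "\<And>t x. t \<in> {0..T} \<Longrightarrow> \<bar>d1 (\<rho>2 t) x\<bar> \<le> K4"
      using jcont_bounded[OF f2.jcont_density(2)] by (metis p f2.periodic_density Crho(2))
    obtain K5 where K5: "\<And>t x. t \<in> {0..T} \<Longrightarrow> \<bar>d2 (\<rho>2 t) x\<bar> \<le> K5"
      using jcont_bounded[OF f2.jcont_density(3)] by (metis p f2.periodic_density Crho(2))
    let ?K = "\<bar>K1\<bar> + \<bar>K2\<bar> + \<bar>K3\<bar> + \<bar>K4\<bar> + \<bar>K5\<bar>"
    have "K1 \<le> ?K" "K2 \<le> ?K" "K3 \<le> ?K" "K4 \<le> ?K" "K5 \<le> ?K" "0 \<le> ?K" by linarith+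
    then show thesis
      by (intro that[of ?K]) (use K1 K2 K3 K4 K5 in \<open>blast intro: order_trans\<close>)+
  qed
  define e where "e = (\<lambda>t x. (d1 (\<Psi> t) x)\<^sup>2 + (d2 (\<Psi> t) x)\<^sup>2)"
  define y where "y t = torus_integral (\<lambda>x. e t x / 2) + torus_integral (\<lambda>x. (R t x)\<^sup>2 / 2)" for t
  define y' where "y' t = - torus_integral (\<lambda>x. \<Psi> t x * ((d1 (\<rho>1 t) x - advect (\<psi>1 t) (laplacian (\<psi>1 t)) x) - (d1 (\<rho>2 t) x - advect (\<psi>2 t) (laplacian (\<psi>2 t)) x)))
     + torus_integral (\<lambda>x. R t x * (- advect (\<psi>1 t) (\<rho>1 t) x - - advect (\<psi>2 t) (\<rho>2 t) x))" for t
  note c = C1_continuous C1_continuous_d1 C1_continuous_d2 advect_continuous laplacian_continuous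
  have deriv: "(y has_real_derivative y' t) (at t within {0..T})" if t: "t \<in> {0..T}" for t
  proof -
    have "((\<lambda>s. torus_integral (\<lambda>x. (R s x)\<^sup>2 / 2)) has_real_derivative
       torus_integral (\<lambda>x. R t x * (- advect (\<psi>1 t) (\<rho>1 t) x - - advect (\<psi>2 t) (\<rho>2 t) x))) (at t within {0..T})"
    proof (rule derivative_under_integral[OF _ _ _ t])
      have jR: "jcont T R" unfolding R_def by (intro jcont_intros f1.jcont_density f2.jcont_density)
      then show "jcont T (\<lambda>s x. R s x * (- advect (\<psi>1 s) (\<rho>1 s) x - - advect (\<psi>2 s) (\<rho>2 s) x))"
        by (intro jcont_intros f1.jcont_advect_density f2.jcont_advect_density)
      show "jcont T (\<lambda>s x. (R s x)\<^sup>2 / 2)"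
        using jcont_mult[OF jcont_const[of T "1/2"] jcont_mult[OF jR jR]] by (simp add: power2_eq_square)
      show "((\<lambda>s. (R s x)\<^sup>2 / 2) has_real_derivative R s x * (- advect (\<psi>1 s) (\<rho>1 s) x - - advect (\<psi>2 s) (\<rho>2 s) x))
         (at s within {0..T})" if "s \<in> {0..T}" for s x
        unfolding R_def using f1.deriv_density[OF that, of x] f2.deriv_density[OF that, of x]
        by (auto intro!: derivative_eq_intros simp: field_simps)
    qed
    then show ?thesis unfolding y_def[abs_def] y'_def e_def
      by (intro DERIV_add d.kinetic_energy_derivative t)
  qed
  have ec: "continuous_on UNIV (e t)" if "t \<in> {0..T}" for t
    unfolding e_def using that by (intro continuous_intros c Cpsi)
  have growth: "y' t \<le> (6 * K + 1) * y t" if t: "t \<in> {0..T}" for t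
  proof -
    note CR = CR[OF t] and CL = CL[OF t]
    have pp: "periodic (\<psi>1 t)" "periodic (\<Psi> t)" "periodic (laplacian (\<psi>2 t))"
      by (intro f1.periodic_stream d.periodic_stream periodic_laplacian f2.periodic_stream Cpsi t)+
    have cont: "continuous_on UNIV (R t)" "continuous_on UNIV (d1 (R t))" "continuous_on UNIV (d2 (R t))"
      "continuous_on UNIV (\<Psi> t)" "continuous_on UNIV (d1 (\<Psi> t))" 
      "continuous_on UNIV (advect (\<psi>1 t) (laplacian (\<Psi> t)))"
      "continuous_on UNIV (advect (\<Psi> t) (laplacian (\<psi>2 t)))"
      "continuous_on UNIV (advect (\<psi>1 t) (R t))" "continuous_on UNIV (advect (\<Psi> t) (\<rho>2 t))"
      using CR CL Cpsi[OF t] Crho[OF t] by (blast intro: c)+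
    note int = continuous_integrable continuous_on_add continuous_on_diff continuous_on_mult continuous_on_minus
      continuous_on_const cont
    let ?i1 = "\<lambda>x. \<Psi> t x * advect (\<psi>1 t) (laplacian (\<Psi> t)) x"
    let ?i2 = "\<lambda>x. \<Psi> t x * advect (\<Psi> t) (laplacian (\<psi>2 t)) x"
    let ?i3 = "\<lambda>x. d1 (R t) x * \<Psi> t x + d2 (R t) x * 0"
    \<comment> \<open>The difference of the transport terms is \<open>\<nabla>\<^sup>\<bottom>\<psi>1 \<cdot> \<nabla>\<Delta>\<Psi> + \<nabla>\<^sup>\<bottom>\<Psi> \<cdot> \<nabla>\<Delta>\<psi>2\<close>; tested with \<open>\<Psi>\<close>, the second
      term disappears and the first is controlled by the stress estimate.\<close>
    have I1: "torus_integral ?i1 = - torus_integral (\<lambda>x. laplacian (\<Psi> t) x * advect (\<psi>1 t) (\<Psi> t) x)"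
      using t by (intro advect_skew Cpsi CL pp)
    have I2: "torus_integral ?i2 = 0"
      using t by (subst advect_skew) (auto simp: advect_self intro!: Cpsi Crho pp)
    have I3: "torus_integral ?i3 = - torus_integral (\<lambda>x. R t x * d1 (\<Psi> t) x)"
      using torus_integration_by_parts[OF CR(1) Cpsi(7) C1_zero CR(2) pp(2), OF t]
      by (simp add: partials_zero periodic_def)
    have "torus_integral (\<lambda>x. \<Psi> t x * ((d1 (\<rho>1 t) x - advect (\<psi>1 t) (laplacian (\<psi>1 t)) x) - (d1 (\<rho>2 t) x - advect (\<psi>2 t) (laplacian (\<psi>2 t)) x)))
      = torus_integral (\<lambda>x. ?i3 x - (?i1 x + ?i2 x))"
    proof (rule integral_cong)
      fix x
      have "advect (\<psi>1 t) (laplacian (\<psi>1 t)) x - advect (\<psi>2 t) (laplacian (\<psi>2 t)) x =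
        advect (\<psi>1 t) (laplacian (\<Psi> t)) x + advect (\<Psi> t) (laplacian (\<psi>2 t)) x"
        using advect_diff[OF Cpsi(1) Cpsi(4) Crho(3) Crho(4), OF t t t t] lapl[OF t] by (simp add: \<Psi>_def)
      moreover have "d1 (R t) x = d1 (\<rho>1 t) x - d1 (\<rho>2 t) x"
        using t by (simp add: R_def partials Crho)
      ultimately have "(d1 (\<rho>1 t) x - advect (\<psi>1 t) (laplacian (\<psi>1 t)) x) - (d1 (\<rho>2 t) x - advect (\<psi>2 t) (laplacian (\<psi>2 t)) x)
        = d1 (R t) x - (advect (\<psi>1 t) (laplacian (\<Psi> t)) x + advect (\<Psi> t) (laplacian (\<psi>2 t)) x)" by linarith
      then show "\<Psi> t x * ((d1 (\<rho>1 t) x - advect (\<psi>1 t) (laplacian (\<psi>1 t)) x) - (d1 (\<rho>2 t) x - advect (\<psi>2 t) (laplacian (\<psi>2 t)) x))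
        = ?i3 x - (?i1 x + ?i2 x)" by (simp only:) (simp add: algebra_simps)
    qed
    also have "\<dots> = torus_integral ?i3 - (torus_integral ?i1 + torus_integral ?i2)"
    proof -
      have "torus_integral (\<lambda>x. ?i3 x - (?i1 x + ?i2 x)) = torus_integral ?i3 - torus_integral (\<lambda>x. ?i1 x + ?i2 x)"
        by (intro Henstock_Kurzweil_Integration.integral_diff int)
      also have "torus_integral (\<lambda>x. ?i1 x + ?i2 x) = torus_integral ?i1 + torus_integral ?i2"
        by (intro Henstock_Kurzweil_Integration.integral_add int)
      finally show ?thesis .
    qed
    finally have J1: "- torus_integral (\<lambda>x. \<Psi> t x * ((d1 (\<rho>1 t) x - advect (\<psi>1 t) (laplacian (\<psi>1 t)) x) - (d1 (\<rho>2 t) x - advect (\<psi>2 t) (laplacian (\<psi>2 t)) x)))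
      = torus_integral (\<lambda>x. R t x * d1 (\<Psi> t) x) - torus_integral (\<lambda>x. laplacian (\<Psi> t) x * advect (\<psi>1 t) (\<Psi> t) x)"
      unfolding I1 I2 I3 by simp
    have J0: "torus_integral (\<lambda>x. R t x * advect (\<psi>1 t) (R t) x) = 0"
      using advect_skew[OF Cpsi(10)[OF t] CR(1) CR(1) pp(1) CR(2) CR(2)] by simp
    have "torus_integral (\<lambda>x. R t x * (- advect (\<psi>1 t) (\<rho>1 t) x - - advect (\<psi>2 t) (\<rho>2 t) x))
      = torus_integral (\<lambda>x. - (R t x * advect (\<psi>1 t) (R t) x) - R t x * advect (\<Psi> t) (\<rho>2 t) x)"
      using advect_diff[OF Cpsi(1) Cpsi(4) Crho(1) Crho(2), OF t t t t]
      by (intro integral_cong) (simp add: \<Psi>_def R_def algebra_simps)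
    also have "\<dots> = - torus_integral (\<lambda>x. R t x * advect (\<Psi> t) (\<rho>2 t) x)"
    proof -
      have "torus_integral (\<lambda>x. - (R t x * advect (\<psi>1 t) (R t) x) - R t x * advect (\<Psi> t) (\<rho>2 t) x)
        = torus_integral (\<lambda>x. - (R t x * advect (\<psi>1 t) (R t) x)) - torus_integral (\<lambda>x. R t x * advect (\<Psi> t) (\<rho>2 t) x)"
        by (intro Henstock_Kurzweil_Integration.integral_diff int)
      then show ?thesis using J0 by simp
    qed
    finally have J2: "torus_integral (\<lambda>x. R t x * (- advect (\<psi>1 t) (\<rho>1 t) x - - advect (\<psi>2 t) (\<rho>2 t) x))
      = - torus_integral (\<lambda>x. R t x * advect (\<Psi> t) (\<rho>2 t) x)" .
    have S: "- torus_integral (\<lambda>x. laplacian (\<Psi> t) x * advect (\<psi>1 t) (\<Psi> t) x) \<le> 2 * K * torus_integral (e t)"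
      using stress_estimate[OF Cpsi(10)[OF t] Cpsi(12)[OF t] pp(1,2) K(2-4)[OF t]] by (simp add: e_def)
    have "torus_integral (\<lambda>x. R t x * d1 (\<Psi> t) x) - torus_integral (\<lambda>x. R t x * advect (\<Psi> t) (\<rho>2 t) x)
      = torus_integral (\<lambda>x. R t x * d1 (\<Psi> t) x - R t x * advect (\<Psi> t) (\<rho>2 t) x)"
      by (intro Henstock_Kurzweil_Integration.integral_diff[symmetric] int)
    also have "\<dots> \<le> torus_integral (\<lambda>x. (K + 1/2) * e t x + (2 * K + 1) * ((R t x)\<^sup>2 / 2))"
    proof (rule integral_le)
      show "(\<lambda>x. R t x * d1 (\<Psi> t) x - R t x * advect (\<Psi> t) (\<rho>2 t) x) integrable_on cbox (-pi, -pi) (pi, pi)"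
        by (intro int)
      show "(\<lambda>x. (K + 1/2) * e t x + (2 * K + 1) * ((R t x)\<^sup>2 / 2)) integrable_on cbox (-pi, -pi) (pi, pi)"
        by (intro continuous_integrable continuous_intros ec[OF t] cont) simp
      fix x
      define r a b p q where "r = R t x" "a = d1 (\<Psi> t) x" "b = d2 (\<Psi> t) x" "p = d1 (\<rho>2 t) x" "q = d2 (\<rho>2 t) x"
      have young: "\<bar>u * v * w\<bar> \<le> K * ((u\<^sup>2 + v\<^sup>2) / 2)" if "\<bar>w\<bar> \<le> K" for u v w :: real
      proof -
        have "\<bar>u * v\<bar> \<le> (u\<^sup>2 + v\<^sup>2) / 2" 
          using sum_squares_bound[of u v] sum_squares_bound[of "-u" v] by (simp add: abs_le_iff)
        then show ?thesis unfolding abs_mult[of "u * v" w] using that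
          by (subst mult.commute) (intro mult_mono, auto)
      qed
      have "r * a \<le> (r\<^sup>2 + a\<^sup>2) / 2" using sum_squares_bound[of r a] by simp
      moreover have "\<bar>r * b * p\<bar> \<le> K * ((r\<^sup>2 + b\<^sup>2) / 2)" "\<bar>r * a * q\<bar> \<le> K * ((r\<^sup>2 + a\<^sup>2) / 2)"
        using K(5,6)[OF t] by (intro young; simp add: r_a_b_p_q_def)+
      moreover have "0 \<le> K * a\<^sup>2" "0 \<le> K * b\<^sup>2" using K(1) by auto
      ultimately have "r * a - r * (b * p - a * q) \<le> (K + 1/2) * (a\<^sup>2 + b\<^sup>2) + (2 * K + 1) * (r\<^sup>2 / 2)"
        by (simp add: algebra_simps abs_le_iff add_divide_distrib) (use zero_le_power2[of b] in linarith)
      then show "R t x * d1 (\<Psi> t) x - R t x * advect (\<Psi> t) (\<rho>2 t) x \<le> (K + 1/2) * e t x + (2 * K + 1) * ((R t x)\<^sup>2 / 2)"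
        by (simp add: r_a_b_p_q_def e_def advect_def)
    qed
    also have "\<dots> = (K + 1/2) * torus_integral (e t) + (2 * K + 1) * torus_integral (\<lambda>x. (R t x)\<^sup>2 / 2)"
    proof -
      have "torus_integral (\<lambda>x. (K + 1/2) * e t x + (2 * K + 1) * ((R t x)\<^sup>2 / 2)) =
        torus_integral (\<lambda>x. (K + 1/2) * e t x) + torus_integral (\<lambda>x. (2 * K + 1) * ((R t x)\<^sup>2 / 2))"
        by (intro Henstock_Kurzweil_Integration.integral_add continuous_integrable continuous_intros ec[OF t] cont) simp
      then show ?thesis by (simp only: integral_mult_right)
    qed
    finally have "y' t \<le> (3 * K + 1/2) * torus_integral (e t) + (2 * K + 1) * torus_integral (\<lambda>x. (R t x)\<^sup>2 / 2)"
      unfolding y'_def J1 J2 using S by (simp add: algebra_simps)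
    also have "\<dots> \<le> (6 * K + 1) * y t"
    proof -
      have "0 \<le> torus_integral (\<lambda>x. (R t x)\<^sup>2 / 2)" 
        using t by (intro integral_nonneg continuous_integrable continuous_intros c CR) auto
      then have "0 \<le> K * torus_integral (\<lambda>x. (R t x)\<^sup>2 / 2)" using K(1) by simp
      moreover have "torus_integral (\<lambda>x. e t x / 2) = torus_integral (e t) / 2" by simp
      ultimately show ?thesis unfolding y_def by (simp add: algebra_simps add_divide_distrib)
    qed
    finally show ?thesis .
  qed
  have e_nonneg: "0 \<le> e t x" for t x by (simp add: e_def)
  have parts_nonneg: "0 \<le> torus_integral (\<lambda>x. e t x / 2)" "0 \<le> torus_integral (\<lambda>x. (R t x)\<^sup>2 / 2)"
    if "t \<in> {0..T}" for t
    using that by (intro integral_nonneg continuous_integrable continuous_intros c ec CR; simp add: e_nonneg)+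
  have zero_in: "0 \<in> {0..T}" using f1.T_pos by simp
  have y0: "y 0 = 0"
  proof -
    have "d1 (\<psi>1 0) x = d1 (\<psi>2 0) x" "d2 (\<psi>1 0) x = d2 (\<psi>2 0) x" for x
      using init(2) zero_in
      by (auto intro!: gradient_determined_by_laplacian f1.C2_stream f2.C2_stream f1.periodic_stream f2.periodic_stream)
    then have "e 0 = (\<lambda>x. 0)"
      using zero_in by (simp add: e_def \<Psi>_def partials Cpsi)
    then show ?thesis unfolding y_def using init(1) by (simp add: R_def)
  qed
  have "y t = 0"
    by (rule gronwall_zero[OF deriv growth _ y0 t]) (use parts_nonneg in \<open>auto simp: y_def\<close>)
  then have *: "torus_integral (\<lambda>x. e t x / 2) = 0" "torus_integral (\<lambda>x. (R t x)\<^sup>2 / 2) = 0"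
    using parts_nonneg[OF t] by (auto simp: y_def)
  have pe: "periodic (e t)" unfolding e_def power2_eq_square
    using t by (intro periodic_intros periodic_partials d.periodic_stream Cpsi)
  have "e t x / 2 = 0"
    using t pe by (intro zero_if_torus_integral_zero[OF _ _ *(1)] continuous_intros ec)
       (auto simp: e_nonneg periodic_def)
  moreover have "(R t x)\<^sup>2 / 2 = 0"
    using t CR(2)[OF t] by (intro zero_if_torus_integral_zero[OF _ _ *(2)] continuous_intros c CR)
       (auto simp: periodic_def)
  moreover have "d1 (\<Psi> t) x = d1 (\<psi>1 t) x - d1 (\<psi>2 t) x" "d2 (\<Psi> t) x = d2 (\<psi>1 t) x - d2 (\<psi>2 t) x"
    using t by (simp_all add: \<Psi>_def partials Cpsi)
  ultimately show "\<rho>1 t x = \<rho>2 t x" "d1 (\<psi>1 t) x = d1 (\<psi>2 t) x" "d2 (\<psi>1 t) x = d2 (\<psi>2 t) x"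
    by (auto simp: R_def e_def add_nonneg_eq_0_iff)
qed

section \<open>Reflection symmetry\<close>

lemma jcont_reflect: 
  fixes a b c :: real
  assumes "jcont T f" shows "jcont T (\<lambda>t x. c * f t (a * fst x, b * snd x))"
  unfolding jcont_def case_prod_unfold
  by (intro continuous_on_mult continuous_on_const jcont_compose[OF assms])
     (auto intro!: continuous_intros)

lemma periodic_reflect:
  assumes "periodic (f :: real \<times> real \<Rightarrow> real)" "a \<in> {1, -1}" "b \<in> {1, -1 :: real}"
  shows "periodic (\<lambda>x. c * f (a * fst x, b * snd x))"
proof -
  have 1: "f (s - 2 * pi, r) = f (s, r)" "f (s, r - 2 * pi) = f (s, r)" for s r
    using assms(1) unfolding periodic_def by (metis diff_add_cancel)+
  have 2: "f (s + 2 * pi, r) = f (s, r)" "f (s, r + 2 * pi) = f (s, r)" for s r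
    using assms(1) unfolding periodic_def by blast+
  have "f (- s - 2 * pi, r) = f (- s, r)" "f (r, - s - 2 * pi) = f (r, - s)" for s r
    using 1[of "-s" r] 1[of r "-s"] by auto
  then show ?thesis using assms(2,3) 2 by (auto simp: periodic_def)
qed

lemma C2_reflect: "C2 f \<Longrightarrow> C2 (\<lambda>x. c * f (a * fst x, b * snd x))" for a b c :: real
  unfolding C2_def by (simp add: partials_reflect C1_differentiable C1_reflect)

lemma laplacian_reflect:
  assumes "C2 f" "a \<in> {1, -1}" "b \<in> {1, -1 :: real}"
  shows "laplacian (\<lambda>x. c * f (a * fst x, b * snd x)) = (\<lambda>x. c * laplacian f (a * fst x, b * snd x))"
proof -
  note D = C1_differentiable[OF C2_D(1)[OF assms(1)]] C1_differentiable[OF C2_D(2)[OF assms(1)]]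
    C1_differentiable[OF C2_D(3)[OF assms(1)]]
  have "a * a = 1" "b * b = 1" using assms by auto
  then show ?thesis
    unfolding laplacian_def[abs_def] partials_reflect(1,2)[OF D(1)] partials_reflect(1,2)[OF D(2)]
      partials_reflect(1,2)[OF D(3)]
    by (simp add: mult.assoc distrib_left)
qed

text \<open>The sign \<open>b\<close> of the reflected density is forced by buoyancy acting along \<open>x\<^sub>2\<close>, and \<open>a b\<close> is
  the determinant of the reflection, by which a vorticity is multiplied.\<close>

lemma boussinesq_flow_reflect:
  assumes "boussinesq_flow T \<rho> \<psi> A B" and ab: "a \<in> {1, -1}" "b \<in> {1, -1 :: real}"
  shows "boussinesq_flow T (\<lambda>t x. b * \<rho> t (a * fst x, b * snd x))
    (\<lambda>t x. (a * b) * \<psi> t (a * fst x, b * snd x))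
    (\<lambda>t x. (a * b * a) * A t (a * fst x, b * snd x)) (\<lambda>t x. (a * b * b) * B t (a * fst x, b * snd x))"
proof -
  interpret boussinesq_flow T \<rho> \<psi> A B by fact
  let ?R = "\<lambda>x. (a * fst x, b * snd x)"
  let ?\<psi> = "\<lambda>t x. (a * b) * \<psi> t (a * fst x, b * snd x)"
  let ?\<rho> = "\<lambda>t x. b * \<rho> t (a * fst x, b * snd x)"
  note D = C1_differentiable[OF C2_D(1)[OF C2_stream]] C1_differentiable[OF C2_D(2)[OF C2_stream]]
    C1_differentiable[OF C2_D(3)[OF C2_stream]] C1_differentiable[OF C1_density] C1_differentiable[OF C1_laplacian]
  have p: "d1 (?\<psi> t) = (\<lambda>x. (a * b * a) * d1 (\<psi> t) (?R x))" "d2 (?\<psi> t) = (\<lambda>x. (a * b * b) * d2 (\<psi> t) (?R x))"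
    "d1 (d1 (?\<psi> t)) = (\<lambda>x. (a * b * a * a) * d1 (d1 (\<psi> t)) (?R x))"
    "d1 (d2 (?\<psi> t)) = (\<lambda>x. (a * b * b * a) * d1 (d2 (\<psi> t)) (?R x))"
    "d2 (d2 (?\<psi> t)) = (\<lambda>x. (a * b * b * b) * d2 (d2 (\<psi> t)) (?R x))"
    "d1 (?\<rho> t) = (\<lambda>x. (b * a) * d1 (\<rho> t) (?R x))" "d2 (?\<rho> t) = (\<lambda>x. (b * b) * d2 (\<rho> t) (?R x))"
    if "t \<in> {0..T}" for t
    using D[OF that] by (simp_all add: partials_reflect)
  have lap: "laplacian (?\<psi> t) = (\<lambda>x. (a * b) * laplacian (\<psi> t) (?R x))" if "t \<in> {0..T}" for t
    by (intro laplacian_reflect C2_stream that ab)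
  have dlap: "d1 (laplacian (?\<psi> t)) = (\<lambda>x. (a * b * a) * d1 (laplacian (\<psi> t)) (?R x))"
     "d2 (laplacian (?\<psi> t)) = (\<lambda>x. (a * b * b) * d2 (laplacian (\<psi> t)) (?R x))" if "t \<in> {0..T}" for t
    unfolding lap[OF that] using D[OF that] by (simp_all add: partials_reflect)
  have L: "d1 (?\<rho> t) x - advect (?\<psi> t) (laplacian (?\<psi> t)) x =
     (a * b) * (d1 (\<rho> t) (?R x) - advect (\<psi> t) (laplacian (\<psi> t)) (?R x))" if "t \<in> {0..T}" for t x
    unfolding advect_def p(1,2,6)[OF that] dlap[OF that] using ab by auto
  have adv: "advect (?\<psi> t) (?\<rho> t) x = b * advect (\<psi> t) (\<rho> t) (?R x)" if "t \<in> {0..T}" for t x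
    unfolding advect_def p(1,2,6,7)[OF that] using ab by auto
  have jr: "jcont T f" if "jcont T g" "\<And>t. t \<in> {0..T} \<Longrightarrow> f t = (\<lambda>x. c * g t (?R x))" for f g c
    by (rule jcont_cong[OF jcont_reflect[OF that(1)] that(2)])
  show ?thesis
  proof
    show "0 < T" by (rule T_pos)
    show "jcont T (\<lambda>t. d1 (?\<psi> t))" by (rule jr[OF jcont_stream(1)]) (rule p)
    show "jcont T (\<lambda>t. d2 (?\<psi> t))" by (rule jr[OF jcont_stream(2)]) (rule p)
    show "jcont T (\<lambda>t. d1 (d1 (?\<psi> t)))" by (rule jr[OF jcont_stream(3)]) (rule p)
    show "jcont T (\<lambda>t. d1 (d2 (?\<psi> t)))" by (rule jr[OF jcont_stream(4)]) (rule p)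
    show "jcont T (\<lambda>t. d2 (d2 (?\<psi> t)))" by (rule jr[OF jcont_stream(5)]) (rule p)
    show "jcont T (\<lambda>t x. (a * b * a) * A t (?R x))" by (rule jr[OF jcont_stream(6)]) simp
    show "jcont T (\<lambda>t x. (a * b * b) * B t (?R x))" by (rule jr[OF jcont_stream(7)]) simp
    show "jcont T (\<lambda>t x. d1 (?\<rho> t) x - advect (?\<psi> t) (laplacian (?\<psi> t)) x)"
      by (rule jr[OF jcont_stream(8)]) (use L in auto)
    show "jcont T ?\<rho>" by (rule jr[OF jcont_density(1)]) simp
    show "jcont T (\<lambda>t. d1 (?\<rho> t))" by (rule jr[OF jcont_density(2)]) (rule p)
    show "jcont T (\<lambda>t. d2 (?\<rho> t))" by (rule jr[OF jcont_density(3)]) (rule p)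
    fix t x assume t: "t \<in> {0..T}"
    show "periodic (?\<psi> t)" "periodic (?\<rho> t)"
      by (intro periodic_reflect periodic_stream periodic_density t ab)+
    show "C2 (?\<psi> t)" by (intro C2_reflect C2_stream t)
    show "C1 (?\<rho> t)" by (intro C1_reflect C1_density t)
    show "C1 (laplacian (?\<psi> t))" unfolding lap[OF t] by (intro C1_reflect C1_laplacian t)
    show "((\<lambda>s. d1 (?\<psi> s) x) has_real_derivative (a * b * a) * A t (?R x)) (at t within {0..T})"
      by (rule derivative_within_cong[OF t DERIV_cmult[OF deriv_d1[OF t]]]) (simp add: p)
    show "((\<lambda>s. d2 (?\<psi> s) x) has_real_derivative (a * b * b) * B t (?R x)) (at t within {0..T})"
      by (rule derivative_within_cong[OF t DERIV_cmult[OF deriv_d2[OF t]]]) (simp add: p)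
    show "((\<lambda>s. laplacian (?\<psi> s) x) has_real_derivative
       d1 (?\<rho> t) x - advect (?\<psi> t) (laplacian (?\<psi> t)) x) (at t within {0..T})"
      unfolding L[OF t]
      by (rule derivative_within_cong[OF t DERIV_cmult[OF deriv_laplacian[OF t]]]) (simp add: lap)
    show "((\<lambda>s. ?\<rho> s x) has_real_derivative - advect (?\<psi> t) (?\<rho> t) x) (at t within {0..T})"
      unfolding adv[OF t] using DERIV_cmult[OF deriv_density[OF t], of b "?R x"] by simp
  qed
qed

section \<open>Conserved quantities\<close>

lemma constant_if_derivative_zero:
  assumes "\<And>s. s \<in> {0..T} \<Longrightarrow> (f has_real_derivative 0) (at s within {0..T})" "t \<in> {0..T}"
  shows "f t = f (0::real)"
  by (rule interval_mvt[OF assms(1), of 0 t]) (use assms(2) in auto)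

context boussinesq_flow
begin

lemma density_square_conserved:
  assumes "t \<in> {0..T}"
  shows "torus_integral (\<lambda>x. (\<rho> t x)\<^sup>2) = torus_integral (\<lambda>x. (\<rho> 0 x)\<^sup>2)"
proof (rule constant_if_derivative_zero[OF _ assms])
  fix s assume s: "s \<in> {0..T}"
  have "torus_integral (\<lambda>x. \<rho> s x * advect (\<psi> s) (\<rho> s) x) = 0"
    using advect_skew[OF C2_stream C1_density C1_density periodic_stream periodic_density periodic_density, OF s s s s s s]
    by simp
  moreover have "((\<lambda>s. torus_integral (\<lambda>x. (\<rho> s x)\<^sup>2)) has_real_derivative
     torus_integral (\<lambda>x. (- 2) * (\<rho> s x * advect (\<psi> s) (\<rho> s) x))) (at s within {0..T})"
  proof (rule derivative_under_integral[OF _ _ _ s])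
    show "((\<lambda>s. (\<rho> s x)\<^sup>2) has_real_derivative (- 2) * (\<rho> r x * advect (\<psi> r) (\<rho> r) x)) (at r within {0..T})"
      if "r \<in> {0..T}" for r x
      using deriv_density[OF that, of x] by (auto intro!: derivative_eq_intros)
    show "jcont T (\<lambda>s x. (\<rho> s x)\<^sup>2)" unfolding power2_eq_square by (intro jcont_intros jcont_density)
    show "jcont T (\<lambda>s x. (- 2) * (\<rho> s x * advect (\<psi> s) (\<rho> s) x))"
      by (intro jcont_mult jcont_const jcont_density jcont_advect_density)
  qed
  ultimately show "((\<lambda>s. torus_integral (\<lambda>x. (\<rho> s x)\<^sup>2)) has_real_derivative 0) (at s within {0..T})"
    by (simp only: integral_mult_right mult_zero_right)
qed

text \<open>Kinetic energy is gained at the rate \<open>\<integral>\<rho> \<partial>\<^sub>1\<psi> = - \<integral>\<rho> u\<^sub>2\<close>, which is the rate at which potential energy is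
  lost. The weight \<open>x\<^sub>2\<close> of the potential energy is not periodic; since no fluid crosses
  \<open>x\<^sub>2 = \<plusminus>\<pi>\<close>, the boundary terms vanish nevertheless.\<close>

lemma energy_conserved:
  assumes wall: "\<And>t x1. t \<in> {0..T} \<Longrightarrow> d1 (\<psi> t) (x1, pi) = 0 \<and> d1 (\<psi> t) (x1, -pi) = 0"
    and t: "t \<in> {0..T}"
  defines "E \<equiv> \<lambda>t. torus_integral (\<lambda>x. ((d1 (\<psi> t) x)\<^sup>2 + (d2 (\<psi> t) x)\<^sup>2) / 2) +
    torus_integral (\<lambda>x. snd x * \<rho> t x)"
  shows "E t = E 0"
proof (rule constant_if_derivative_zero[OF _ t])
  fix s assume s: "s \<in> {0..T}"
  note C = C2_D[OF C2_stream[OF s]] C1_density[OF s] C1_laplacian[OF s] C2_stream[OF s]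
  note P = periodic_stream[OF s] periodic_density[OF s] periodic_laplacian[OF C2_stream[OF s] periodic_stream[OF s]]
  note c = C1_continuous C1_continuous_d1 C1_continuous_d2 advect_continuous
  have "torus_integral (\<lambda>x. \<psi> s x * (d1 (\<rho> s) x - advect (\<psi> s) (laplacian (\<psi> s)) x)) =
    torus_integral (\<lambda>x. (d1 (\<rho> s) x * \<psi> s x + d2 (\<rho> s) x * 0) - \<psi> s x * advect (\<psi> s) (laplacian (\<psi> s)) x)"
    by (simp add: algebra_simps)
  also have "\<dots> = torus_integral (\<lambda>x. d1 (\<rho> s) x * \<psi> s x + d2 (\<rho> s) x * 0)
      - torus_integral (\<lambda>x. \<psi> s x * advect (\<psi> s) (laplacian (\<psi> s)) x)"
    by (intro Henstock_Kurzweil_Integration.integral_diff continuous_integrable continuous_intros c C)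
  also have "torus_integral (\<lambda>x. \<psi> s x * advect (\<psi> s) (laplacian (\<psi> s)) x) = 0"
    by (subst advect_skew) (auto simp: advect_self C P)
  also have "torus_integral (\<lambda>x. d1 (\<rho> s) x * \<psi> s x + d2 (\<rho> s) x * 0) = - torus_integral (\<lambda>x. \<rho> s x * d1 (\<psi> s) x)"
    by (subst torus_integration_by_parts) (auto simp: partials_zero C P C1_zero periodic_def[of "\<lambda>x. 0"])
  finally have kin: "((\<lambda>s. torus_integral (\<lambda>x. ((d1 (\<psi> s) x)\<^sup>2 + (d2 (\<psi> s) x)\<^sup>2) / 2))
     has_real_derivative torus_integral (\<lambda>x. \<rho> s x * d1 (\<psi> s) x)) (at s within {0..T})"
    using kinetic_energy_derivative[OF s] by simp
  have "((\<lambda>s. torus_integral (\<lambda>x. snd x * \<rho> s x)) has_real_derivative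
      torus_integral (\<lambda>x. snd x * - advect (\<psi> s) (\<rho> s) x)) (at s within {0..T})"
  proof (rule derivative_under_integral[OF _ _ _ s])
    have "jcont T (\<lambda>s. snd)" unfolding jcont_def by (auto intro!: continuous_intros simp: case_prod_unfold)
    then show "jcont T (\<lambda>s x. snd x * \<rho> s x)" "jcont T (\<lambda>s x. snd x * - advect (\<psi> s) (\<rho> s) x)"
      by (intro jcont_intros jcont_density jcont_advect_density; assumption)+
  qed (intro DERIV_cmult deriv_density)
  moreover have "torus_integral (\<lambda>x. snd x * - advect (\<psi> s) (\<rho> s) x) = - torus_integral (\<lambda>x. \<rho> s x * d1 (\<psi> s) x)"
  proof -
    define F G where "F = (\<lambda>x. snd x * (\<rho> s x * d2 (\<psi> s) x))" and "G = (\<lambda>x. snd x * (\<rho> s x * - d1 (\<psi> s) x))"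
    have CFG: "C1 F" "C1 G" unfolding F_def G_def by (intro C1_intros C)+
    have "d2 (\<psi> s) (pi, y) = d2 (\<psi> s) (-pi, y)" "\<rho> s (pi, y) = \<rho> s (-pi, y)" for y
      using periodic_partials(2)[OF P(1) C(1)] P(2) unfolding periodic_def
      by (metis add.commute diff_add_cancel mult_2 uminus_add_conv_diff)+
    then have "torus_integral (\<lambda>x. d1 F x + d2 G x) = 0"
      using wall[OF s] by (subst divergence_theorem_rectangle) (auto simp: CFG, simp add: F_def G_def)
    moreover have "d1 F x + d2 G x = snd x * advect (\<psi> s) (\<rho> s) x - \<rho> s x * d1 (\<psi> s) x" for x
      unfolding F_def G_def advect_def using C2_mixed_partials[OF C(6)]
      by (simp add: partials C1_intros C algebra_simps)
    ultimately have "torus_integral (\<lambda>x. snd x * advect (\<psi> s) (\<rho> s) x - \<rho> s x * d1 (\<psi> s) x) = 0" by simp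
    moreover have "torus_integral (\<lambda>x. snd x * advect (\<psi> s) (\<rho> s) x - \<rho> s x * d1 (\<psi> s) x) =
      torus_integral (\<lambda>x. snd x * advect (\<psi> s) (\<rho> s) x) - torus_integral (\<lambda>x. \<rho> s x * d1 (\<psi> s) x)"
      by (intro Henstock_Kurzweil_Integration.integral_diff continuous_integrable continuous_intros c C)
    ultimately show ?thesis by simp
  qed
  ultimately show "(E has_real_derivative 0) (at s within {0..T})"
    unfolding E_def using DERIV_add[OF kin] by fastforce
qed

text \<open>The potential energy cannot release more than a fixed amount, because \<open>|x\<^sub>2 \<rho>| \<le> (\<pi>\<^sup>2 + \<rho>\<^sup>2) / 2\<close> and
  \<open>\<integral>\<rho>\<^sup>2\<close> is conserved.\<close>

lemma kinetic_energy_bound: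
  assumes wall: "\<And>t x1. t \<in> {0..T} \<Longrightarrow> d1 (\<psi> t) (x1, pi) = 0 \<and> d1 (\<psi> t) (x1, -pi) = 0"
    and t: "t \<in> {0..T}"
  shows "torus_integral (\<lambda>x. ((d1 (\<psi> t) x)\<^sup>2 + (d2 (\<psi> t) x)\<^sup>2) / 2) \<le>
    torus_integral (\<lambda>x. ((d1 (\<psi> 0) x)\<^sup>2 + (d2 (\<psi> 0) x)\<^sup>2) / 2) + torus_integral (\<lambda>x. pi\<^sup>2 + (\<rho> 0 x)\<^sup>2)"
proof -
  have zero: "0 \<in> {0..T}" using T_pos by simp
  have pot: "\<bar>torus_integral (\<lambda>x. snd x * \<rho> s x)\<bar> \<le> torus_integral (\<lambda>x. pi\<^sup>2 + (\<rho> 0 x)\<^sup>2) / 2" if s: "s \<in> {0..T}" for s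
  proof -
    have c: "continuous_on UNIV (\<rho> r)" if "r \<in> {0..T}" for r by (intro C1_continuous C1_density that)
    have "norm (torus_integral (\<lambda>x. snd x * \<rho> s x)) \<le> torus_integral (\<lambda>x. (1/2) * (pi\<^sup>2 + (\<rho> s x)\<^sup>2))"
    proof (rule integral_norm_bound_integral)
      show "(\<lambda>x. snd x * \<rho> s x) integrable_on cbox (-pi, -pi) (pi, pi)"
        by (intro continuous_integrable continuous_intros c s)
      show "(\<lambda>x. (1/2) * (pi\<^sup>2 + (\<rho> s x)\<^sup>2)) integrable_on cbox (-pi, -pi) (pi, pi)"
        by (intro continuous_integrable continuous_intros c s)
      fix x :: "real \<times> real" assume "x \<in> cbox (-pi, -pi) (pi, pi)"
      then have "(snd x)\<^sup>2 \<le> pi\<^sup>2" by (cases x) (auto simp: cbox_Pair_eq intro!: power2_le_iff_abs_le[THEN iffD2] abs_leI)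
      then show "norm (snd x * \<rho> s x) \<le> (1/2) * (pi\<^sup>2 + (\<rho> s x)\<^sup>2)"
        using sum_squares_bound[of "snd x" "\<rho> s x"] sum_squares_bound[of "- snd x" "\<rho> s x"] by (simp add: abs_le_iff)
    qed
    also have "\<dots> = (1/2) * torus_integral (\<lambda>x. pi\<^sup>2 + (\<rho> s x)\<^sup>2)" by (rule integral_mult_right)
    also have "torus_integral (\<lambda>x. pi\<^sup>2 + (\<rho> s x)\<^sup>2) = torus_integral (\<lambda>x. pi\<^sup>2 + (\<rho> 0 x)\<^sup>2)"
      using density_square_conserved[OF s]
      by (subst (1 2) Henstock_Kurzweil_Integration.integral_add)
         (auto intro!: continuous_integrable continuous_on_power c s zero)
    finally show ?thesis by simp
  qed
  show ?thesis using energy_conserved[OF wall t] pot[OF t] pot[OF zero] by (simp add: abs_le_iff)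
qed

end

section \<open>Maximum principles\<close>

lemma left_derivative_nonneg_at_max:
  fixes h :: "real \<Rightarrow> real"
  assumes "(h has_real_derivative D) (at s within {0..T})" "0 < s" "s \<le> T"
    and "\<And>r. 0 \<le> r \<Longrightarrow> r \<le> s \<Longrightarrow> h r \<le> h s"
  shows "0 \<le> D"
proof (rule ccontr)
  assume "\<not> 0 \<le> D"
  then obtain d where d: "d > 0" "\<And>e. 0 < e \<Longrightarrow> s - e \<in> {0..T} \<Longrightarrow> e < d \<Longrightarrow> h s < h (s - e)"
    using has_real_derivative_neg_dec_left[OF assms(1)] by (meson not_le)
  define e where "e = min (d / 2) s"
  have "0 < e" "e < d" "e \<le> s" using d(1) assms(2) by (auto simp: e_def min_def)
  then show False using d(2)[of e] assms(3) assms(4)[of "s - e"] by auto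
qed

text \<open>Let \<open>e > 0\<close>. At a point where \<open>f - (M + e) t\<close> is maximal over \<open>[0, t] \<times> K\<close>, \<open>f\<close> is
  maximal in space, where its time derivative is at most \<open>M\<close>, while maximality in time requires at
  least \<open>M + e\<close>. The bound on \<open>f'\<close> is asked only where \<open>f\<close> exceeds \<open>W\<close>, so that points with prescribed
  small values, such as end points of an interval, are exempt.\<close>

lemma maximum_principle:
  fixes f f' :: "real \<Rightarrow> 'a::topological_space \<Rightarrow> real"
  assumes K: "compact K" and cont: "continuous_on ({0..T} \<times> K) (\<lambda>(t, x). f t x)"
    and deriv: "\<And>t x. t \<in> {0..T} \<Longrightarrow> x \<in> K \<Longrightarrow> ((\<lambda>s. f s x) has_real_derivative f' t x) (at t within {0..T})"
    and init: "\<And>x. x \<in> K \<Longrightarrow> f 0 x \<le> W" and M: "0 \<le> M"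
    and crit: "\<And>t x. t \<in> {0..T} \<Longrightarrow> x \<in> K \<Longrightarrow> (\<And>y. y \<in> K \<Longrightarrow> f t y \<le> f t x) \<Longrightarrow> W < f t x \<Longrightarrow> f' t x \<le> M"
    and t: "t \<in> {0..T}" and x: "x \<in> K"
  shows "f t x \<le> W + M * t"
proof (rule ccontr)
  assume "\<not> f t x \<le> W + M * t"
  moreover define q where "q = f t x - W - M * t"
  ultimately have q: "0 < q" "f t x = q + W + M * t" by simp_all
  define e where "e = q / (2 * (t + 1))"
  have e: "0 < e" "e * t < q"
    using q(1) t by (simp_all add: e_def field_simps add_strict_increasing)
  define g where "g = (\<lambda>(s, y). f s y - (M + e) * s)"
  have "compact ({0..t} \<times> K)" using K by (intro compact_Times) auto
  moreover have "continuous_on ({0..t} \<times> K) g"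
    unfolding g_def case_prod_unfold
    using t by (intro continuous_intros continuous_on_subset[OF cont[unfolded case_prod_unfold]]) auto
  moreover have "{0..t} \<times> K \<noteq> {}" using x t by auto
  ultimately obtain z where z: "z \<in> {0..t} \<times> K" "\<forall>w \<in> {0..t} \<times> K. g w \<le> g z"
    using continuous_attains_sup by blast
  obtain s y where sy: "z = (s, y)" by fastforce
  have s: "0 \<le> s" "s \<le> t" "s \<in> {0..T}" and y: "y \<in> K" using z(1) t by (auto simp: sy)
  have max: "f r w - (M + e) * r \<le> f s y - (M + e) * s" if "0 \<le> r" "r \<le> t" "w \<in> K" for r w
    using z(2) that by (auto simp: g_def sy)
  have "W < f t x - (M + e) * t" using e(2) q(2) by (simp add: algebra_simps)
  also have "\<dots> \<le> f s y - (M + e) * s" using max[of t x] t x by simp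
  finally have W: "W < f s y - (M + e) * s" .
  have "s \<noteq> 0" using W init[OF y] by auto
  then have "0 < s" using s by simp
  have "0 \<le> f' s y - (M + e)"
  proof (rule left_derivative_nonneg_at_max[where h="\<lambda>r. f r y - (M + e) * r" and T=T])
    show "((\<lambda>r. f r y - (M + e) * r) has_real_derivative f' s y - (M + e)) (at s within {0..T})"
      using deriv[OF s(3) y] by (auto intro!: derivative_eq_intros)
  qed (use \<open>0 < s\<close> s max y in auto)
  moreover have "f' s y \<le> M"
  proof (rule crit[OF s(3) y])
    show "f s w \<le> f s y" if "w \<in> K" for w using max[OF s(1,2) that] by simp
    have "0 \<le> (M + e) * s" using M e(1) s(1) by simp
    then show "W < f s y" using W by linarith
  qed
  ultimately show False using e(1) by linarith
qed

lemma partials_zero_at_max: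
  assumes "f differentiable (at x)" "\<And>y. f y \<le> f x"
  shows "d1 f x = 0" "d2 f x = 0"
proof -
  have "(\<lambda>h. fst h * d1 f x + snd h * d2 f x) = (\<lambda>h. 0)"
    by (rule differential_zero_maxmin[OF UNIV_I open_UNIV has_derivative_partials[OF assms(1)]]) (use assms(2) in auto)
  from fun_cong[OF this, of "(1,0)"] fun_cong[OF this, of "(0,1)"] show "d1 f x = 0" "d2 f x = 0" by auto
qed

context boussinesq_flow
begin

text \<open>At a spatial extremum of the vorticity the transport term vanishes and only the forcing
  \<open>\<partial>\<^sub>1\<rho>\<close> remains. The sign \<open>\<sigma>\<close> covers maxima and minima.\<close>

lemma vorticity_one_sided_bound:
  assumes \<sigma>: "\<sigma> \<in> {1, -1 :: real}"
    and M: "\<And>s x. s \<in> {0..T} \<Longrightarrow> \<bar>d1 (\<rho> s) x\<bar> \<le> M" and W: "\<And>x. \<bar>laplacian (\<psi> 0) x\<bar> \<le> W"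
    and t: "t \<in> {0..T}"
  shows "\<sigma> * laplacian (\<psi> t) x \<le> W + M * t"
proof -
  let ?K = "cbox (-pi, -pi) (pi, pi) :: (real \<times> real) set"
  let ?f = "\<lambda>t x. \<sigma> * laplacian (\<psi> t) x"
  obtain y where y: "y \<in> ?K" "\<And>f. periodic f \<Longrightarrow> f y = (f x :: real)"
    using torus_representative[of x] by blast
  have per: "periodic (?f s)" if "s \<in> {0..T}" for s
    using that by (intro periodic_cmult periodic_laplacian C2_stream periodic_stream)
  have "?f t y \<le> W + M * t"
  proof (rule maximum_principle[where f="?f" and K="?K" and T=T])
    have "jcont T ?f" by (intro jcont_mult jcont_const jcont_laplacian)
    then show "continuous_on ({0..T} \<times> ?K) (\<lambda>(t, x). ?f t x)"
      unfolding jcont_def by (rule continuous_on_subset) auto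
    show "((\<lambda>s. ?f s x) has_real_derivative \<sigma> * (d1 (\<rho> s) x - advect (\<psi> s) (laplacian (\<psi> s)) x)) (at s within {0..T})"
      if "s \<in> {0..T}" for s x
      by (intro DERIV_cmult deriv_laplacian that)
    show "?f 0 x \<le> W" for x using W[of x] \<sigma> by (auto simp: abs_le_iff)
    show "0 \<le> M" using M[OF t, of x] by linarith
    fix s z assume s: "s \<in> {0..T}" and z: "\<And>y. y \<in> ?K \<Longrightarrow> ?f s y \<le> ?f s z"
    have max: "?f s w \<le> ?f s z" for w
    proof -
      obtain v where "v \<in> ?K" "\<And>f. periodic f \<Longrightarrow> f v = (f w :: real)"
        using torus_representative[of w] by blast
      from z[OF this(1)] this(2)[OF per[OF s]] show ?thesis by simp
    qed
    have C: "C1 (laplacian (\<psi> s))" by (rule C1_laplacian[OF s])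
    have "d1 (?f s) z = 0" "d2 (?f s) z = 0"
      using max by (intro partials_zero_at_max C1_differentiable C1_cmult C; blast)+
    then have "d1 (laplacian (\<psi> s)) z = 0" "d2 (laplacian (\<psi> s)) z = 0"
      using \<sigma> by (auto simp: partials_cmult[OF C])
    then have "\<sigma> * (d1 (\<rho> s) z - advect (\<psi> s) (laplacian (\<psi> s)) z) = \<sigma> * d1 (\<rho> s) z"
      by (simp add: advect_def)
    also have "\<dots> \<le> M" using M[OF s, of z] \<sigma> by (auto simp: abs_le_iff)
    finally show "\<sigma> * (d1 (\<rho> s) z - advect (\<psi> s) (laplacian (\<psi> s)) z) \<le> M" .
  qed (use t y in auto)
  then show ?thesis using y(2)[OF per[OF t]] by simp
qed

lemma vorticity_bound:
  assumes "\<And>s x. s \<in> {0..T} \<Longrightarrow> \<bar>d1 (\<rho> s) x\<bar> \<le> M" "\<And>x. \<bar>laplacian (\<psi> 0) x\<bar> \<le> W" "t \<in> {0..T}"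
  shows "\<bar>laplacian (\<psi> t) x\<bar> \<le> W + M * t"
  using vorticity_one_sided_bound[OF _ assms, of 1 x] vorticity_one_sided_bound[OF _ assms, of "-1" x]
  by (simp add: abs_le_iff)

lemma jcont_vertical:
  assumes "jcont T f" shows "continuous_on ({0..T} \<times> S) (\<lambda>(t, y). f t (c, y))"
  unfolding case_prod_unfold by (rule jcont_compose[OF assms]) (auto intro!: continuous_intros)

lemma vertical_derivative_zero_at_max:
  assumes "t \<in> {0..T}" "\<sigma> \<in> {1, -1 :: real}" "y \<in> {0<..<pi}"
    and "\<And>z. z \<in> {0..pi} \<Longrightarrow> \<sigma> * \<rho> t (c, z) \<le> \<sigma> * \<rho> t (c, y)"
  shows "d2 (\<rho> t) (c, y) = 0"
proof -
  have "((\<lambda>z. \<sigma> * \<rho> t (c, z)) has_real_derivative \<sigma> * d2 (\<rho> t) (c, y)) (at y)"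
    by (intro DERIV_cmult has_real_derivative_d2 C1_differentiable C1_density assms(1))
  then have "\<sigma> * d2 (\<rho> t) (c, y) = 0"
  proof (rule DERIV_local_max)
    show "0 < min y (pi - y)" using assms(3) by auto
    show "\<forall>z. \<bar>y - z\<bar> < min y (pi - y) \<longrightarrow> \<sigma> * \<rho> t (c, z) \<le> \<sigma> * \<rho> t (c, y)"
      using assms(3,4) by (auto simp: abs_less_iff)
  qed
  then show ?thesis using assms(2) by auto
qed

text \<open>On a vertical line that no fluid crosses the density solves a one-dimensional transport
  equation, so its range cannot grow, in either direction of time.\<close>

lemma vertical_line_bound_forward:
  assumes line: "\<And>t y. t \<in> {0..T} \<Longrightarrow> d2 (\<psi> t) (c, y) = 0"
    and ends: "\<And>t. t \<in> {0..T} \<Longrightarrow> \<rho> t (c, 0) = 0 \<and> \<rho> t (c, pi) = 0"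
    and \<sigma>: "\<sigma> \<in> {1, -1 :: real}"
    and W: "0 \<le> W" "\<And>y. y \<in> {0..pi} \<Longrightarrow> \<sigma> * \<rho> 0 (c, y) \<le> W"
    and t: "t \<in> {0..T}" and y: "y \<in> {0..pi}"
  shows "\<sigma> * \<rho> t (c, y) \<le> W"
proof -
  have "\<sigma> * \<rho> t (c, y) \<le> W + 0 * t"
  proof (rule maximum_principle[where f="\<lambda>t y. \<sigma> * \<rho> t (c, y)" and K="{0..pi}" and T=T])
    show "continuous_on ({0..T} \<times> {0..pi}) (\<lambda>(t, y). \<sigma> * \<rho> t (c, y))"
      using jcont_vertical[OF jcont_mult[OF jcont_const jcont_density(1)]] .
    show "((\<lambda>s. \<sigma> * \<rho> s (c, y)) has_real_derivative \<sigma> * - advect (\<psi> s) (\<rho> s) (c, y)) (at s within {0..T})"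
      if "s \<in> {0..T}" for s y by (intro DERIV_cmult deriv_density that)
    fix s z assume s: "s \<in> {0..T}" and z: "z \<in> {0..pi}"
      and max: "\<And>y. y \<in> {0..pi} \<Longrightarrow> \<sigma> * \<rho> s (c, y) \<le> \<sigma> * \<rho> s (c, z)" and "W < \<sigma> * \<rho> s (c, z)"
    then have "z \<noteq> 0" "z \<noteq> pi" using ends[OF s] W(1) by auto
    then have "d2 (\<rho> s) (c, z) = 0" using vertical_derivative_zero_at_max[OF s \<sigma> _ max] z by auto
    then show "\<sigma> * - advect (\<psi> s) (\<rho> s) (c, z) \<le> 0" by (simp add: advect_def line[OF s])
  qed (use W t y in auto)
  then show ?thesis by simp
qed

lemma vertical_line_bound_backward:
  assumes line: "\<And>t y. t \<in> {0..T} \<Longrightarrow> d2 (\<psi> t) (c, y) = 0"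
    and ends: "\<And>t. t \<in> {0..T} \<Longrightarrow> \<rho> t (c, 0) = 0 \<and> \<rho> t (c, pi) = 0"
    and W: "0 \<le> W" "\<And>y. y \<in> {0..pi} \<Longrightarrow> \<rho> t (c, y) \<le> W"
    and t: "t \<in> {0..T}" and y: "y \<in> {0..pi}"
  shows "\<rho> 0 (c, y) \<le> W"
proof -
  have "\<rho> (t - t) (c, y) \<le> W + 0 * t"
  proof (rule maximum_principle[where f="\<lambda>s y. \<rho> (t - s) (c, y)" and K="{0..pi}" and T=t])
    show "continuous_on ({0..t} \<times> {0..pi}) (\<lambda>(s, y). \<rho> (t - s) (c, y))"
      unfolding case_prod_unfold using t
      by (intro jcont_compose[OF jcont_density(1)]) (auto intro!: continuous_intros)
    show "((\<lambda>s. \<rho> (t - s) (c, y)) has_real_derivative advect (\<psi> (t - s)) (\<rho> (t - s)) (c, y)) (at s within {0..t})"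
      if "s \<in> {0..t}" for s y
    proof -
      have "((\<lambda>r. \<rho> r (c, y)) has_real_derivative - advect (\<psi> (t - s)) (\<rho> (t - s)) (c, y)) (at (t - s) within (\<lambda>s. t - s) ` {0..t})"
        using t that by (intro DERIV_subset[OF deriv_density]) auto
      moreover have "((\<lambda>s. t - s) has_real_derivative - 1) (at s within {0..t})"
        by (auto intro!: derivative_eq_intros)
      ultimately show ?thesis by (rule DERIV_image_chain[THEN DERIV_cong, unfolded o_def]) simp
    qed
    fix s z assume s: "s \<in> {0..t}" and z: "z \<in> {0..pi}"
      and max: "\<And>y. y \<in> {0..pi} \<Longrightarrow> \<rho> (t - s) (c, y) \<le> \<rho> (t - s) (c, z)" and "W < \<rho> (t - s) (c, z)"
    moreover have ts: "t - s \<in> {0..T}" using s t by auto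
    ultimately have "z \<noteq> 0" "z \<noteq> pi" using ends[OF ts] W(1) by auto
    then have "d2 (\<rho> (t - s)) (c, z) = 0" using vertical_derivative_zero_at_max[OF ts, of 1] max z by auto
    then show "advect (\<psi> (t - s)) (\<rho> (t - s)) (c, z) \<le> 0" by (simp add: advect_def line[OF ts])
  qed (use W t y in auto)
  then show ?thesis by simp
qed

end

section \<open>Circulation around a quarter of the torus\<close>

abbreviation quarter_integral :: "(real \<times> real \<Rightarrow> real) \<Rightarrow> real" where
  "quarter_integral f \<equiv> integral (cbox (0, 0) (pi, pi)) f"

lemma rectangle_integral_mono:
  fixes f :: "real \<times> real \<Rightarrow> real"
  assumes "continuous_on UNIV f" "\<And>x. 0 \<le> f x" "a' \<le> a" "b \<le> b'" "c' \<le> c" "d \<le> d'"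
  shows "integral (cbox (a, c) (b, d)) f \<le> integral (cbox (a', c') (b', d')) f"
proof (rule integral_subset_le)
  show "cbox (a, c) (b, d) \<subseteq> cbox (a', c') (b', d')" using assms(3-6) by (auto simp: cbox_Pair_eq)
qed (use assms(2) in \<open>auto intro: continuous_integrable assms(1)\<close>)

lemma quarter_integral_le_torus_integral:
  assumes "continuous_on UNIV f" "\<And>x. 0 \<le> f x"
  shows "quarter_integral f \<le> torus_integral f"
  using assms by (rule rectangle_integral_mono) auto

lemma line_integral_continuous:
  assumes "continuous_on UNIV (f :: real \<times> real \<Rightarrow> real)"
  shows "continuous_on S (\<lambda>h. integral {0..pi} (\<lambda>y. f (h, y)))"
proof -
  have "continuous_on S (\<lambda>h. integral (cbox 0 pi) (\<lambda>y. f (h, y)))"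
    by (rule integral_continuous_on_param)
       (auto simp: case_prod_unfold intro: continuous_on_subset[OF assms])
  then show ?thesis by simp
qed

lemma strip_integral_le:
  assumes f: "continuous_on UNIV (f :: real \<times> real \<Rightarrow> real)" "\<And>x. 0 \<le> f x" and "0 \<le> a" "a \<le> b" "b \<le> pi"
  shows "integral {a..b} (\<lambda>h. integral {0..pi} (\<lambda>y. f (h, y))) \<le> quarter_integral f"
proof -
  have "integral {a..b} (\<lambda>h. integral {0..pi} (\<lambda>y. f (h, y))) = integral (cbox (a, 0) (b, pi)) f"
    using integral_prod_continuous[of a 0 b pi f] continuous_on_subset[OF f(1)] by simp
  also have "\<dots> \<le> quarter_integral f"
    by (rule rectangle_integral_mono[OF f]) (use assms in auto)
  finally show ?thesis .
qed

lemma wall_layers_integral_le: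
  assumes f: "continuous_on UNIV (f :: real \<times> real \<Rightarrow> real)" "\<And>x. 0 \<le> f x" and \<delta>: "0 \<le> \<delta>" "\<delta> \<le> pi"
  shows "integral {0..\<delta>} (\<lambda>h. integral {0..pi} (\<lambda>y. f (h, y)) + integral {0..pi} (\<lambda>y. f (pi - h, y)))
    \<le> 2 * quarter_integral f"
proof -
  define \<phi> where "\<phi> h = integral {0..pi} (\<lambda>y. f (h, y))" for h
  have c: "continuous_on S \<phi>" for S
    unfolding \<phi>_def by (rule line_integral_continuous[OF f(1)])
  have c2: "continuous_on S (\<lambda>h. \<phi> (pi - h))" for S
    by (rule continuous_on_compose2[OF c[of UNIV]]) (auto intro!: continuous_intros)
  have "integral {0..\<delta>} (\<lambda>h. \<phi> (pi - h)) = integral {-\<delta>..- 0} (\<lambda>h. \<phi> (h + pi))"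
    using Henstock_Kurzweil_Integration.integral_reflect_real[of \<delta> 0 "\<lambda>h. \<phi> (pi - h)"] by (simp add: add.commute)
  also have "\<dots> = integral {pi - \<delta>..pi} \<phi>"
    using integral_shift_real_ivl[of "pi - \<delta>" pi pi \<phi>] by simp
  also have "\<dots> \<le> quarter_integral f"
    unfolding \<phi>_def using f \<delta> by (intro strip_integral_le) auto
  finally have "integral {0..\<delta>} (\<lambda>h. \<phi> (pi - h)) \<le> quarter_integral f" .
  moreover have "integral {0..\<delta>} \<phi> \<le> quarter_integral f"
    unfolding \<phi>_def using f \<delta> by (intro strip_integral_le) auto
  moreover have "integral {0..\<delta>} (\<lambda>h. \<phi> h + \<phi> (pi - h)) = integral {0..\<delta>} \<phi> + integral {0..\<delta>} (\<lambda>h. \<phi> (pi - h))"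
    by (intro Henstock_Kurzweil_Integration.integral_add integrable_continuous_interval c c2)
  ultimately show ?thesis unfolding \<phi>_def by linarith
qed

text \<open>Young's inequality \<open>|v| \<le> l/2 + v\<^sup>2/(2l)\<close> replaces the velocity along the sides by its square,
  which the energy controls on average.\<close>

lemma side_integral_bound:
  fixes p q :: "real \<Rightarrow> real"
  assumes c: "continuous_on UNIV p" "continuous_on UNIV q" and h: "0 \<le> h" and l: "0 < l"
  shows "- integral {h..pi - h} (\<lambda>y. p y - q y) \<le>
    pi * l + (integral {0..pi} (\<lambda>y. (q y)\<^sup>2) + integral {0..pi} (\<lambda>y. (p y)\<^sup>2)) / (2 * l)"
proof -
  have i: "f integrable_on {a..b}" if "continuous_on UNIV f" for f :: "real \<Rightarrow> real" and a b
    using that by (meson continuous_on_subset integrable_continuous_interval subset_UNIV)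
  let ?g = "\<lambda>y. l + (1 / (2 * l)) * ((q y)\<^sup>2 + (p y)\<^sup>2)"
  have "integral {h..pi - h} (\<lambda>y. - (p y - q y)) \<le> integral {h..pi - h} ?g"
  proof (rule integral_le)
    fix y
    have "0 \<le> (q y - l)\<^sup>2 + (p y + l)\<^sup>2" by simp
    then have "2 * l * (q y - p y) \<le> 2 * l * l + ((q y)\<^sup>2 + (p y)\<^sup>2)"
      by (simp add: power2_eq_square algebra_simps)
    then show "- (p y - q y) \<le> ?g y" using l by (simp add: field_simps)
  qed (intro i continuous_intros c)+
  also have "\<dots> \<le> integral {0..pi} ?g"
    by (intro integral_subset_le i continuous_intros c) (use h l in auto)
  also have "\<dots> = integral {0..pi} (\<lambda>y. l) + integral {0..pi} (\<lambda>y. (1 / (2 * l)) * ((q y)\<^sup>2 + (p y)\<^sup>2))"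
    by (intro Henstock_Kurzweil_Integration.integral_add i continuous_intros c)
  also have "integral {0..pi} (\<lambda>y. (1 / (2 * l)) * ((q y)\<^sup>2 + (p y)\<^sup>2)) =
     (1 / (2 * l)) * integral {0..pi} (\<lambda>y. (q y)\<^sup>2 + (p y)\<^sup>2)" by (rule integral_mult_right)
  also have "integral {0..pi} (\<lambda>y. (q y)\<^sup>2 + (p y)\<^sup>2) = integral {0..pi} (\<lambda>y. (q y)\<^sup>2) + integral {0..pi} (\<lambda>y. (p y)\<^sup>2)"
    by (intro Henstock_Kurzweil_Integration.integral_add i continuous_intros c)
  finally show ?thesis by (simp only: Henstock_Kurzweil_Integration.integral_neg) simp
qed

text \<open>By Stokes' theorem the vorticity in the square shrunk by \<open>h\<close> is a line integral of the velocity along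
  its four sides; the removed frame has area at most \<open>4\<pi>h\<close> and carries at most \<open>4\<pi>h\<Omega>\<close>.\<close>

lemma circulation_bound_at_depth:
  assumes C: "C2 \<psi>" and \<Omega>: "\<And>x. \<bar>laplacian \<psi> x\<bar> \<le> \<Omega>" and h: "0 \<le> h" "h \<le> pi / 2" and l: "0 < l"
  shows "- quarter_integral (laplacian \<psi>) \<le> 4 * pi * h * \<Omega> + 2 * pi * l +
    ((integral {0..pi} (\<lambda>y. (d1 \<psi> (h, y))\<^sup>2) + integral {0..pi} (\<lambda>y. (d1 \<psi> (pi - h, y))\<^sup>2)) +
     (integral {0..pi} (\<lambda>x. (d2 \<psi> (x, h))\<^sup>2) + integral {0..pi} (\<lambda>x. (d2 \<psi> (x, pi - h))\<^sup>2))) / (2 * l)"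
proof -
  note C' = C2_D[OF C]
  let ?Qh = "cbox (h, h) (pi - h, pi - h) :: (real \<times> real) set"
  have c: "continuous_on UNIV (laplacian \<psi>)" by (rule laplacian_continuous[OF C])
  have "0 \<le> \<Omega>" using \<Omega>[of 0] by linarith
  have "integral ?Qh (\<lambda>x. \<Omega> + laplacian \<psi> x) \<le> quarter_integral (\<lambda>x. \<Omega> + laplacian \<psi> x)"
  proof (rule rectangle_integral_mono)
    show "0 \<le> \<Omega> + laplacian \<psi> x" for x using \<Omega>[of x] by (simp add: abs_le_iff)
  qed (use h in \<open>auto intro!: continuous_on_add c\<close>)
  moreover have "integral ?Qh (\<lambda>x. \<Omega> + laplacian \<psi> x) = integral ?Qh (\<lambda>x. \<Omega>) + integral ?Qh (laplacian \<psi>)"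
    "quarter_integral (\<lambda>x. \<Omega> + laplacian \<psi> x) = quarter_integral (\<lambda>x. \<Omega>) + quarter_integral (laplacian \<psi>)"
    by (intro Henstock_Kurzweil_Integration.integral_add continuous_integrable c continuous_on_const)+
  moreover have "integral ?Qh (\<lambda>x. \<Omega>) = \<Omega> * (pi - 2 * h)\<^sup>2" "quarter_integral (\<lambda>x. \<Omega>) = \<Omega> * pi\<^sup>2"
    using h by (simp_all add: content_Pair power2_eq_square)
  moreover have "\<Omega> * pi\<^sup>2 - \<Omega> * (pi - 2 * h)\<^sup>2 \<le> 4 * pi * h * \<Omega>"
  proof -
    have "0 \<le> \<Omega> * (4 * h\<^sup>2)" using \<open>0 \<le> \<Omega>\<close> by simp
    then show ?thesis by (simp add: power2_eq_square algebra_simps)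
  qed
  ultimately have "- quarter_integral (laplacian \<psi>) \<le> 4 * pi * h * \<Omega> - integral ?Qh (laplacian \<psi>)"
    by linarith
  also have "integral ?Qh (laplacian \<psi>) = integral {h..pi - h} (\<lambda>y. d1 \<psi> (pi - h, y) - d1 \<psi> (h, y))
      + integral {h..pi - h} (\<lambda>x. d2 \<psi> (x, pi - h) - d2 \<psi> (x, h))"
    unfolding laplacian_def[abs_def] using h by (intro divergence_theorem_rectangle C') auto
  finally show ?thesis
    using side_integral_bound[of "\<lambda>y. d1 \<psi> (pi - h, y)" "\<lambda>y. d1 \<psi> (h, y)", OF _ _ h(1) l]
      side_integral_bound[of "\<lambda>x. d2 \<psi> (x, pi - h)" "\<lambda>x. d2 \<psi> (x, h)", OF _ _ h(1) l]
      continuous_on_pair[OF C1_continuous[OF C'(2)]] continuous_on_pair[OF C1_continuous[OF C'(3)]]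
    by (simp add: add_divide_distrib)
qed

text \<open>Circulation of size \<open>A\<close> around the square requires a velocity of order \<open>A\<close> on its boundary, and a
  vorticity of size \<open>\<Omega>\<close> lets it decay only over a distance of order \<open>A/\<Omega>\<close>. The kinetic energy is
  therefore at least of order \<open>A\<^sup>2 \<cdot> A/\<Omega>\<close>. The proof averages the bound at depth \<open>h\<close> over
  \<open>0 \<le> h \<le> \<delta>\<close>.\<close>

lemma circulation_cubed_bound:
  assumes C: "C2 \<psi>" and \<Omega>: "\<And>x. \<bar>laplacian \<psi> x\<bar> \<le> \<Omega>"
    and E: "quarter_integral (\<lambda>x. ((d1 \<psi> x)\<^sup>2 + (d2 \<psi> x)\<^sup>2) / 2) \<le> E"
    and pos: "0 < - quarter_integral (laplacian \<psi>)"
  shows "(- quarter_integral (laplacian \<psi>)) ^ 3 \<le> 512 * pi\<^sup>2 * E * \<Omega>"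
proof -
  note C' = C2_D[OF C]
  define A where "A = - quarter_integral (laplacian \<psi>)"
  have c: "continuous_on S (\<lambda>x. (d1 \<psi> x)\<^sup>2)" "continuous_on S (\<lambda>x. (d2 \<psi> x)\<^sup>2)" for S
    by (intro continuous_intros C1_continuous C')+
  have "A = integral (cbox (0,0) (pi,pi)) (\<lambda>x. - laplacian \<psi> x)" by (simp add: A_def)
  also have "\<dots> \<le> quarter_integral (\<lambda>x. \<Omega>)"
    using \<Omega> by (intro integral_le continuous_integrable continuous_intros laplacian_continuous C)
      (auto simp: abs_le_iff)
  also have "\<dots> = pi * pi * \<Omega>" by (simp add: content_Pair)
  finally have A\<Omega>: "A \<le> pi * pi * \<Omega>" .
  have A: "0 < A" using pos by (simp add: A_def)
  have \<Omega>pos: "0 < \<Omega>"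
  proof (rule ccontr)
    assume "\<not> 0 < \<Omega>"
    then have "pi * pi * \<Omega> \<le> 0" by (simp add: mult_nonneg_nonpos)
    then show False using A A\<Omega> by linarith
  qed
  \<comment> \<open>With these choices the first two terms of the bound at depth \<open>h \<le> \<delta>\<close> absorb half of \<open>A\<close>.\<close>
  define l where "l = A / (8 * pi)"
  define \<delta> where "\<delta> = A / (16 * pi * \<Omega>)"
  have l: "0 < l" using A by (simp add: l_def)
  have "\<delta> \<le> (pi * pi * \<Omega>) / (16 * pi * \<Omega>)"
    unfolding \<delta>_def using A\<Omega> \<Omega>pos by (intro divide_right_mono) auto
  also have "\<dots> = pi / 16" using \<Omega>pos by simp
  finally have \<delta>: "0 < \<delta>" "\<delta> \<le> pi / 16" using A \<Omega>pos by (simp_all add: \<delta>_def)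
  define g1 where "g1 h = integral {0..pi} (\<lambda>y. (d1 \<psi> (h, y))\<^sup>2) + integral {0..pi} (\<lambda>y. (d1 \<psi> (pi - h, y))\<^sup>2)" for h
  define g2 where "g2 h = integral {0..pi} (\<lambda>x. (d2 \<psi> (x, h))\<^sup>2) + integral {0..pi} (\<lambda>x. (d2 \<psi> (x, pi - h))\<^sup>2)" for h
  have swap: "continuous_on S (\<lambda>z. (d2 \<psi> (snd z, fst z))\<^sup>2)" for S :: "(real \<times> real) set"
    by (rule continuous_on_compose2[OF c(2)[of UNIV]]) (auto intro!: continuous_intros)
  have refl: "continuous_on S (\<lambda>h. f (pi - h))" if "continuous_on UNIV f" for f :: "real \<Rightarrow> real" and S
    by (rule continuous_on_compose2[OF that]) (auto intro!: continuous_intros)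
  have gc: "continuous_on S g1" "continuous_on S g2" for S
    unfolding g1_def g2_def
    using line_integral_continuous[OF c(1)] refl[OF line_integral_continuous[OF c(1)]]
      line_integral_continuous[OF swap] refl[OF line_integral_continuous[OF swap]]
    by (auto intro!: continuous_on_add)
  have half: "A / 2 \<le> (g1 h + g2 h) / (2 * l)" if h: "h \<in> {0..\<delta>}" for h
  proof -
    have "4 * pi * h * \<Omega> \<le> 4 * pi * \<delta> * \<Omega>" using h \<Omega>pos by simp
    also have "\<dots> = A / 4" using \<Omega>pos by (simp add: \<delta>_def)
    finally have "4 * pi * h * \<Omega> \<le> A / 4" .
    moreover have "2 * pi * l = A / 4" by (simp add: l_def)
    moreover have "A \<le> 4 * pi * h * \<Omega> + 2 * pi * l + (g1 h + g2 h) / (2 * l)"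
      unfolding A_def g1_def g2_def using h \<delta>(2)
      by (intro circulation_bound_at_depth C \<Omega> l) (auto intro: order_trans)
    ultimately show ?thesis by linarith
  qed
  have "\<delta> * (A / 2) = integral {0..\<delta>} (\<lambda>h. A / 2)" using \<delta> by simp
  also have "\<dots> \<le> integral {0..\<delta>} (\<lambda>h. (1 / (2 * l)) * (g1 h + g2 h))"
    using half by (intro integral_le integrable_continuous_interval continuous_intros gc) simp
  also have "\<dots> = (1 / (2 * l)) * integral {0..\<delta>} (\<lambda>h. g1 h + g2 h)" by (rule integral_mult_right)
  also have "integral {0..\<delta>} (\<lambda>h. g1 h + g2 h) = integral {0..\<delta>} g1 + integral {0..\<delta>} g2"
    by (intro Henstock_Kurzweil_Integration.integral_add integrable_continuous_interval gc)
  finally have main: "\<delta> * (A / 2) \<le> (1 / (2 * l)) * (integral {0..\<delta>} g1 + integral {0..\<delta>} g2)" .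
  have "integral {0..\<delta>} g1 + integral {0..\<delta>} g2 \<le> 4 * E"
  proof -
    have "integral {0..\<delta>} g1 \<le> 2 * quarter_integral (\<lambda>x. (d1 \<psi> x)\<^sup>2)"
      unfolding g1_def using \<delta> by (intro wall_layers_integral_le c) auto
    moreover have "integral {0..\<delta>} g2 \<le> 2 * quarter_integral (\<lambda>x. (d2 \<psi> x)\<^sup>2)"
    proof -
      have "integral {0..\<delta>} g2 \<le> 2 * quarter_integral (\<lambda>z. (d2 \<psi> (snd z, fst z))\<^sup>2)"
        unfolding g2_def using wall_layers_integral_le[OF swap, of \<delta>] \<delta> by simp
      also have "quarter_integral (\<lambda>z. (d2 \<psi> (snd z, fst z))\<^sup>2) = quarter_integral (\<lambda>x. (d2 \<psi> x)\<^sup>2)"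
        using integral_swap_2dim[of 0 0 pi pi "\<lambda>y x. (d2 \<psi> (x, y))\<^sup>2"] swap
        by (simp add: case_prod_unfold)
      finally show ?thesis .
    qed
    moreover have "quarter_integral (\<lambda>x. (d1 \<psi> x)\<^sup>2 + (d2 \<psi> x)\<^sup>2) =
      quarter_integral (\<lambda>x. (d1 \<psi> x)\<^sup>2) + quarter_integral (\<lambda>x. (d2 \<psi> x)\<^sup>2)"
      by (intro Henstock_Kurzweil_Integration.integral_add continuous_integrable c)
    moreover have "quarter_integral (\<lambda>x. ((d1 \<psi> x)\<^sup>2 + (d2 \<psi> x)\<^sup>2) / 2) =
      quarter_integral (\<lambda>x. (d1 \<psi> x)\<^sup>2 + (d2 \<psi> x)\<^sup>2) / 2" by simp
    ultimately show ?thesis using E by linarith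
  qed
  then have "(1 / (2 * l)) * (integral {0..\<delta>} g1 + integral {0..\<delta>} g2) \<le> (1 / (2 * l)) * (4 * E)"
    using l by (intro mult_left_mono) auto
  with main have "\<delta> * (A / 2) \<le> (1 / (2 * l)) * (4 * E)" by (rule order_trans)
  then have "\<delta> * A * l \<le> 4 * E" using l by (simp add: field_simps)
  then have "A ^ 3 \<le> 512 * pi\<^sup>2 * E * \<Omega>"
    using \<Omega>pos by (simp add: \<delta>_def l_def field_simps power2_eq_square power3_eq_cube)
  then show ?thesis by (simp add: A_def)
qed

text \<open>With slope at most \<open>M\<close>, \<open>f\<close> stays above half of its value at \<open>z\<close> on an interval of length
  \<open>f z / (2 M)\<close>; the zero at the left end point gives this interval room inside \<open>[0, \<pi>]\<close>.\<close>

lemma integral_lower_bound_triangle: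
  fixes f f' :: "real \<Rightarrow> real"
  assumes deriv: "\<And>y. (f has_real_derivative f' y) (at y)" and M: "\<And>y. \<bar>f' y\<bar> \<le> M"
    and f: "f 0 = 0" "\<And>y. y \<in> {0..pi} \<Longrightarrow> 0 \<le> f y" and z: "z \<in> {0..pi}" "0 < f z"
  shows "(f z)\<^sup>2 / (4 * M) \<le> integral {0..pi} f" "f z \<le> M * pi"
proof -
  have lip: "f z - f y \<le> M * (z - y)" if y: "y \<le> z" for y
  proof (cases "y = z")
    case False
    then obtain w where "f z - f y = (z - y) * f' w"
      using MVT2[of y z f f'] deriv y by auto
    also have "\<dots> \<le> (z - y) * M" using M[of w] y by (intro mult_left_mono) auto
    finally show ?thesis by (simp add: mult.commute)
  qed simp
  have zM: "f z \<le> M * z" using lip[of 0] z f(1) by simp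
  then have "0 < M * z" using z by linarith
  then have Mpos: "0 < M" using z by (simp add: zero_less_mult_iff)
  have "M * z \<le> M * pi" using Mpos z(1) by simp
  then show "f z \<le> M * pi" using zM by linarith
  define w where "w = z - f z / (2 * M)"
  have w: "0 \<le> w" "w \<le> z"
  proof -
    have "f z / (2 * M) \<le> (M * z) / (2 * M)" using zM Mpos by (intro divide_right_mono) auto
    also have "\<dots> = z / 2" using Mpos by simp
    finally show "0 \<le> w" using z by (simp add: w_def)
    show "w \<le> z" using Mpos z by (simp add: w_def)
  qed
  have c: "continuous_on S f" for S
    by (meson DERIV_continuous_on deriv has_field_derivative_at_within)
  have "(f z)\<^sup>2 / (4 * M) = integral {w..z} (\<lambda>y. f z / 2)"
    using w Mpos by (simp add: w_def power2_eq_square field_simps)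
  also have "\<dots> \<le> integral {w..z} f"
  proof (intro integral_le integrable_continuous_interval c continuous_on_const)
    fix y assume y: "y \<in> {w..z}"
    have "M * (z - y) \<le> M * (z - w)" using y Mpos by simp
    also have "\<dots> = f z / 2" using Mpos by (simp add: w_def)
    finally show "f z / 2 \<le> f y" using lip[of y] y by simp
  qed
  also have "\<dots> \<le> integral {0..pi} f"
    using w z f(2) by (intro integral_subset_le integrable_continuous_interval c) auto
  finally show "(f z)\<^sup>2 / (4 * M) \<le> integral {0..pi} f" .
qed

text \<open>No vorticity is carried through the sides of the square, since no fluid crosses them. The
  circulation changes only through the density on the two vertical sides.\<close>

lemma (in boussinesq_flow) circulation_derivative:
  assumes v: "\<And>t y. t \<in> {0..T} \<Longrightarrow> d2 (\<psi> t) (0, y) = 0 \<and> d2 (\<psi> t) (pi, y) = 0"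
    and h: "\<And>t x. t \<in> {0..T} \<Longrightarrow> d1 (\<psi> t) (x, 0) = 0 \<and> d1 (\<psi> t) (x, pi) = 0"
    and t: "t \<in> {0..T}"
  shows "((\<lambda>s. - quarter_integral (laplacian (\<psi> s))) has_real_derivative
     - integral {0..pi} (\<lambda>y. \<rho> t (pi, y) - \<rho> t (0, y))) (at t within {0..T})"
proof -
  note C = C2_D[OF C2_stream[OF t]] C1_density[OF t] C1_laplacian[OF t] C2_stream[OF t]
  have "quarter_integral (advect (\<psi> t) (laplacian (\<psi> t))) = 0"
    unfolding advect_eq_divergence[OF C(6,5)]
    by (subst divergence_theorem_rectangle) (auto simp: v[OF t] h[OF t] intro!: C1_intros C)
  moreover have "quarter_integral (d1 (\<rho> t)) = integral {0..pi} (\<lambda>y. \<rho> t (pi, y) - \<rho> t (0, y))"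
    by (rule integral_d1_rectangle[OF C(4)]) simp
  moreover have "quarter_integral (\<lambda>x. d1 (\<rho> t) x - advect (\<psi> t) (laplacian (\<psi> t)) x) =
     quarter_integral (d1 (\<rho> t)) - quarter_integral (advect (\<psi> t) (laplacian (\<psi> t)))"
    by (intro Henstock_Kurzweil_Integration.integral_diff continuous_integrable advect_continuous C1_continuous_d1 C)
  moreover have "((\<lambda>s. quarter_integral (laplacian (\<psi> s))) has_real_derivative
     quarter_integral (\<lambda>x. d1 (\<rho> t) x - advect (\<psi> t) (laplacian (\<psi> t)) x)) (at t within {0..T})"
    by (rule derivative_under_integral[OF deriv_laplacian jcont_laplacian jcont_stream(8) t])
  ultimately show ?thesis by (intro DERIV_minus) simp
qed

section \<open>Stream functions of smooth solutions\<close>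

text \<open>Joint continuous differentiability, in a form that passes to restrictions and to
  components.\<close>

definition jointly_C1 :: "'a::real_normed_vector set \<Rightarrow> ('a \<Rightarrow> 'b::real_normed_vector) \<Rightarrow> bool" where
  "jointly_C1 S f \<longleftrightarrow> (\<exists>D. (\<forall>p\<in>S. (f has_derivative D p) (at p within S)) \<and>
     (\<forall>v. continuous_on S (\<lambda>p. D p v)))"

lemma smooth_on_jointly_C1:
  assumes "smooth_on S f" "S' \<subseteq> S"
  shows "jointly_C1 S' f"
proof -
  let ?D = "\<lambda>p. frechet_derivative f (at p within S)"
  have "Ck_on (Suc 0) S f" using assms(1) unfolding smooth_on_def by blast
  then have "f differentiable_on S" "\<forall>v. continuous_on S (\<lambda>p. ?D p v)" by simp_all
  then have "(f has_derivative ?D p) (at p within S')" if "p \<in> S'" for p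
    using that assms(2) by (meson differentiable_onD frechet_derivative_works has_derivative_subset subsetD)
  moreover have "continuous_on S' (\<lambda>p. ?D p v)" for v
    using \<open>\<forall>v. continuous_on S (\<lambda>p. ?D p v)\<close> assms(2) continuous_on_subset by blast
  ultimately show ?thesis unfolding jointly_C1_def by (intro exI[of _ ?D] conjI ballI allI)
qed

lemma jointly_C1_linear:
  assumes "jointly_C1 S f" "bounded_linear L"
  shows "jointly_C1 S (\<lambda>p. L (f p))"
proof -
  obtain D where D: "\<And>p. p \<in> S \<Longrightarrow> (f has_derivative D p) (at p within S)" "\<And>v. continuous_on S (\<lambda>p. D p v)"
    using assms(1) unfolding jointly_C1_def by blast
  show ?thesis unfolding jointly_C1_def
    using bounded_linear.has_derivative[OF assms(2) D(1)] bounded_linear.continuous_on[OF assms(2) D(2)]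
    by (intro exI[of _ "\<lambda>p v. L (D p v)"] conjI ballI allI)
qed

lemma jointly_C1_slices:
  fixes f :: "real \<Rightarrow> real \<times> real \<Rightarrow> real"
  assumes "jointly_C1 ({0..T} \<times> UNIV) (\<lambda>(t, x). f t x)"
  shows "\<And>t. t \<in> {0..T} \<Longrightarrow> C1 (f t)"
    and "jcont T f" "jcont T (\<lambda>t. d1 (f t))" "jcont T (\<lambda>t. d2 (f t))"
    and "\<exists>f'. jcont T f' \<and> (\<forall>t\<in>{0..T}. \<forall>x. ((\<lambda>s. f s x) has_real_derivative f' t x) (at t within {0..T}))"
proof -
  let ?S = "{0..T} \<times> (UNIV :: (real \<times> real) set)" and ?F = "\<lambda>(t, x). f t x"
  obtain D where D: "\<And>p. p \<in> ?S \<Longrightarrow> (?F has_derivative D p) (at p within ?S)"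
    and cD: "\<And>v. continuous_on ?S (\<lambda>p. D p v)"
    using assms unfolding jointly_C1_def by blast
  have "continuous_on ?S ?F"
    using D by (rule has_derivative_continuous_on)
  then show "jcont T f" unfolding jcont_def .
  have space: "(f t has_derivative (\<lambda>h. D (t, x) (0, h))) (at x)" if t: "t \<in> {0..T}" for t x
  proof -
    have g: "(Pair t has_derivative (\<lambda>h. (0, h))) (at x)" by (auto intro!: derivative_eq_intros)
    have "(?F has_derivative D (t, x)) (at (t, x) within range (Pair t))"
      by (rule has_derivative_subset[OF D]) (use t in auto)
    from has_derivative_in_compose[OF g this] show ?thesis by simp
  qed
  have time: "((\<lambda>s. f s x) has_real_derivative D (t, x) (1, 0)) (at t within {0..T})" if t: "t \<in> {0..T}" for t x
  proof -
    have g: "((\<lambda>s. (s, x)) has_derivative (\<lambda>h. (h, 0))) (at t within {0..T})" by (auto intro!: derivative_eq_intros)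
    have F: "(?F has_derivative D (t, x)) (at (t, x) within (\<lambda>s. (s, x)) ` {0..T})"
      by (rule has_derivative_subset[OF D]) (use t in auto)
    then interpret bounded_linear "D (t, x)" by (rule has_derivative_bounded_linear)
    have hom: "D (t, x) (h, 0) = h * D (t, x) (1, 0)" for h using scaleR[of h "(1, 0)"] by simp
    have "(\<lambda>h. D (t, x) (h, 0)) = (*) (D (t, x) (1, 0))"
      by (rule ext) (rule trans[OF hom mult.commute])
    with has_derivative_in_compose[OF g F] show ?thesis by (simp add: has_field_derivative_def)
  qed
  have d: "d1 (f t) x = D (t, x) (0, (1, 0))" "d2 (f t) x = D (t, x) (0, (0, 1))" if "t \<in> {0..T}" for t x
    using d1_eqI[OF space[OF that]] d2_eqI[OF space[OF that]] by auto
  show j1: "jcont T (\<lambda>t. d1 (f t))" unfolding jcont_def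
    by (rule continuous_on_eq[OF cD[of "(0, (1, 0))"]]) (auto simp: d)
  show j2: "jcont T (\<lambda>t. d2 (f t))" unfolding jcont_def
    by (rule continuous_on_eq[OF cD[of "(0, (0, 1))"]]) (auto simp: d)
  show "C1 (f t)" if "t \<in> {0..T}" for t
    unfolding C1_def using space[OF that] jcont_slice[OF j1 that] jcont_slice[OF j2 that]
    by (auto intro: differentiableI)
  have "jcont T (\<lambda>t x. D (t, x) (1, 0))" unfolding jcont_def
    by (rule continuous_on_eq[OF cD[of "(1, 0)"]]) auto
  then show "\<exists>f'. jcont T f' \<and> (\<forall>t\<in>{0..T}. \<forall>x. ((\<lambda>s. f s x) has_real_derivative f' t x) (at t within {0..T}))"
    using time by blast
qed

lemma torus_smooth_C1: 
  assumes "torus_smooth f" shows "C1 f"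
proof -
  have "Ck_on (Suc 0) UNIV f" using assms unfolding torus_smooth_def smooth_on_def by blast
  then show ?thesis unfolding C1_def d1_def[abs_def] d2_def[abs_def]
    by (simp add: differentiable_on_def)
qed

lemma torus_smooth_partials:
  assumes "torus_smooth f" shows "torus_smooth (d1 f)" "torus_smooth (d2 f)"
proof -
  have "Ck_on (Suc n) UNIV f" for n using assms unfolding torus_smooth_def smooth_on_def by blast
  then have "Ck_on n UNIV (d1 f)" "Ck_on n UNIV (d2 f)" for n
    unfolding d1_def[abs_def] d2_def[abs_def] by simp_all
  then show "torus_smooth (d1 f)" "torus_smooth (d2 f)"
    using assms periodic_partials[of f] torus_smooth_C1[OF assms] by (simp_all add: torus_smooth_def smooth_on_def)
qed

lemma torus_smooth_C2: "torus_smooth f \<Longrightarrow> C2 f"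
  unfolding C2_def using torus_smooth_C1 torus_smooth_partials by blast

text \<open>A stream function is chosen at each time; the regularity in time of its gradient is that of the
  velocity.\<close>

lemma boussinesq_solution_flow:
  assumes sol: "boussinesq_solution \<rho>0 \<omega>0 T \<rho> \<omega>" and t1: "0 < t1" "ereal t1 < T"
  obtains \<psi> A B where "boussinesq_flow t1 \<rho> \<psi> A B" "is_inverse_neg_laplacian \<omega>0 (\<psi> 0)"
proof -
  let ?J = "times_upto T" and ?I = "{0..t1}"
  have sub: "?I \<subseteq> ?J" using t1 by (auto simp: times_upto_def intro: le_less_trans[of "ereal _" "ereal t1"])
  from sol obtain u where init: "\<omega> 0 = \<omega>0"
    and smooth: "smooth_on (?J \<times> UNIV) (\<lambda>(t, x). \<rho> t x)" "smooth_on (?J \<times> UNIV) (\<lambda>(t, x). \<omega> t x)"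
      "smooth_on (?J \<times> UNIV) (\<lambda>(t, x). u t x)"
    and per: "\<And>t. t \<in> ?J \<Longrightarrow> periodic (\<rho> t) \<and> periodic (\<omega> t)"
    and bs: "\<And>t. t \<in> ?J \<Longrightarrow> biot_savart (\<omega> t) (u t)"
    and rho: "\<And>t x. t \<in> ?J \<Longrightarrow> ((\<lambda>s. \<rho> s x) has_real_derivative - (u t x \<bullet> grad (\<rho> t) x)) (at t within ?J)"
    and omega: "\<And>t x. t \<in> ?J \<Longrightarrow> ((\<lambda>s. \<omega> s x) has_real_derivative - (u t x \<bullet> grad (\<omega> t) x) - d1 (\<rho> t) x) (at t within ?J)"
    unfolding boussinesq_solution_def by blast
  have "\<forall>t\<in>?J. \<exists>\<psi>. is_inverse_neg_laplacian (\<omega> t) \<psi> \<and> u t = grad_perp \<psi>"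
    using bs unfolding biot_savart_def by blast
  then obtain \<psi> where \<psi>: "\<And>t. t \<in> ?J \<Longrightarrow> is_inverse_neg_laplacian (\<omega> t) (\<psi> t) \<and> u t = grad_perp (\<psi> t)"
    by metis
  have J: "t \<in> ?J" if "t \<in> ?I" for t using that sub by blast
  have sm: "torus_smooth (\<psi> t)" if "t \<in> ?I" for t
    using \<psi>[OF J[OF that]] unfolding is_inverse_neg_laplacian_def by blast
  have C2: "C2 (\<psi> t)" "periodic (\<psi> t)" if "t \<in> ?I" for t
    using sm[OF that] torus_smooth_C2 by (auto simp: torus_smooth_def)
  have lap: "laplacian (\<psi> t) = (\<lambda>x. - \<omega> t x)" if "t \<in> ?I" for t
    using \<psi>[OF J[OF that]] unfolding is_inverse_neg_laplacian_def by (simp add: fun_eq_iff minus_equation_iff)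
  have u: "u t x = (d2 (\<psi> t) x, - d1 (\<psi> t) x)" if "t \<in> ?I" for t x
    using \<psi>[OF J[OF that]] by (simp add: grad_perp_def)
  have sub': "?I \<times> UNIV \<subseteq> ?J \<times> UNIV" using sub by auto
  note jC1 = smooth_on_jointly_C1[OF smooth(1) sub'] smooth_on_jointly_C1[OF smooth(2) sub']
    smooth_on_jointly_C1[OF smooth(3) sub']
  have c1: "jointly_C1 (?I \<times> UNIV) (\<lambda>(t, x). fst (u t x))"
    using jointly_C1_linear[OF jC1(3) bounded_linear_fst] by (simp add: case_prod_unfold)
  have c2: "jointly_C1 (?I \<times> UNIV) (\<lambda>(t, x). - snd (u t x))"
    using jointly_C1_linear[OF jC1(3) bounded_linear_minus[OF bounded_linear_snd]] by (simp add: case_prod_unfold)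
  note s1 = jointly_C1_slices[OF c1] and s2 = jointly_C1_slices[OF c2]
    and sr = jointly_C1_slices[OF jC1(1)] and so = jointly_C1_slices[OF jC1(2)]
  have d: "d1 (\<psi> t) = (\<lambda>x. - snd (u t x))" "d2 (\<psi> t) = (\<lambda>x. fst (u t x))" if "t \<in> ?I" for t
    using u[OF that] by auto
  obtain A where A: "jcont t1 A" "\<And>t x. t \<in> ?I \<Longrightarrow> ((\<lambda>s. - snd (u s x)) has_real_derivative A t x) (at t within ?I)"
    using s2(5) by blast
  obtain B where B: "jcont t1 B" "\<And>t x. t \<in> ?I \<Longrightarrow> ((\<lambda>s. fst (u s x)) has_real_derivative B t x) (at t within ?I)"
    using s1(5) by blast
  have dlap: "d1 (laplacian (\<psi> t)) = (\<lambda>x. - d1 (\<omega> t) x)" "d2 (laplacian (\<psi> t)) = (\<lambda>x. - d2 (\<omega> t) x)" if "t \<in> ?I" for t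
    unfolding lap[OF that] by (intro partials_minus so(1) that)+
  have L: "d1 (\<rho> t) x - advect (\<psi> t) (laplacian (\<psi> t)) x = - (- (u t x \<bullet> grad (\<omega> t) x) - d1 (\<rho> t) x)"
    if "t \<in> ?I" for t x
    by (simp add: advect_def dlap[OF that] u[OF that] grad_def)
  have adv: "advect (\<psi> t) (\<rho> t) x = u t x \<bullet> grad (\<rho> t) x" if "t \<in> ?I" for t x
    by (simp add: advect_def u[OF that] grad_def)
  have "boussinesq_flow t1 \<rho> \<psi> A B"
  proof
    show "0 < t1" "jcont t1 A" "jcont t1 B" by fact+
    show "jcont t1 \<rho>" "jcont t1 (\<lambda>t. d1 (\<rho> t))" "jcont t1 (\<lambda>t. d2 (\<rho> t))" by fact+
    show "jcont t1 (\<lambda>t. d1 (\<psi> t))" by (rule jcont_cong[OF s2(2)]) (rule d)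
    show "jcont t1 (\<lambda>t. d2 (\<psi> t))" by (rule jcont_cong[OF s1(2)]) (rule d)
    show "jcont t1 (\<lambda>t. d1 (d1 (\<psi> t)))" by (rule jcont_cong[OF s2(3)]) (simp add: d)
    show "jcont t1 (\<lambda>t. d1 (d2 (\<psi> t)))" by (rule jcont_cong[OF s1(3)]) (simp add: d)
    show "jcont t1 (\<lambda>t. d2 (d2 (\<psi> t)))" by (rule jcont_cong[OF s1(4)]) (simp add: d)
    have "jcont t1 (\<lambda>t x. d1 (\<rho> t) x + (fst (u t x) * d1 (\<omega> t) x - - snd (u t x) * d2 (\<omega> t) x))"
      by (intro jcont_add jcont_diff jcont_mult sr so s1 s2)
    then show "jcont t1 (\<lambda>t x. d1 (\<rho> t) x - advect (\<psi> t) (laplacian (\<psi> t)) x)"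
      by (rule jcont_cong) (auto simp: L grad_def inner_prod_def)
    fix t x assume t: "t \<in> ?I"
    show "periodic (\<psi> t)" "C2 (\<psi> t)" using C2[OF t] by auto
    show "periodic (\<rho> t)" using per[OF J[OF t]] by blast
    show "C1 (\<rho> t)" by (rule sr(1)[OF t])
    show "C1 (laplacian (\<psi> t))" unfolding lap[OF t] by (intro C1_minus so(1) t)
    show "((\<lambda>s. d1 (\<psi> s) x) has_real_derivative A t x) (at t within ?I)"
      by (rule derivative_within_cong[OF t A(2)[OF t]]) (simp add: d)
    show "((\<lambda>s. d2 (\<psi> s) x) has_real_derivative B t x) (at t within ?I)"
      by (rule derivative_within_cong[OF t B(2)[OF t]]) (simp add: d)
    show "((\<lambda>s. laplacian (\<psi> s) x) has_real_derivative d1 (\<rho> t) x - advect (\<psi> t) (laplacian (\<psi> t)) x) (at t within ?I)"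
      unfolding L[OF t]
      by (rule derivative_within_cong[OF t DERIV_minus[OF DERIV_subset[OF omega[OF J[OF t]] sub]]]) (simp add: lap)
    show "((\<lambda>s. \<rho> s x) has_real_derivative - advect (\<psi> t) (\<rho> t) x) (at t within ?I)"
      unfolding adv[OF t] by (rule DERIV_subset[OF rho[OF J[OF t]] sub])
  qed
  moreover have "is_inverse_neg_laplacian \<omega>0 (\<psi> 0)"
    using \<psi>[of 0] J[of 0] t1(1) init by auto
  ultimately show ?thesis using that by blast
qed

text \<open>For a continuous gradient the essential supremum is a supremum: the set where the bound fails is
  open, and if it met the closed square it would meet the interior in positive measure.\<close>

lemma linfty_norm_bound:
  assumes C: "C1 f" and per: "periodic f" and le: "linfty_norm (grad f) \<le> ereal M"
  shows "\<bar>d1 f x\<bar> \<le> M" "\<bar>d2 f x\<bar> \<le> M"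
proof -
  let ?box = "box (-pi, -pi) (pi, pi) :: (real \<times> real) set"
  have c: "continuous_on UNIV (\<lambda>x. norm (grad f x))"
    unfolding grad_def[abs_def] by (intro continuous_intros C1_continuous_d1 C1_continuous_d2 C)
  define U where "U = {x. M < norm (grad f x)}"
  have opU: "open U" unfolding U_def by (intro open_Collect_less continuous_on_const c)
  have cell: "torus_cell \<in> sets lborel" unfolding torus_cell_def by (simp add: borel_Times)
  have "AE x in restrict_space lborel torus_cell. ereal (norm (grad f x)) \<le> linfty_norm (grad f)"
    unfolding linfty_norm_def by (rule esssup_AE)
  then have "AE x in restrict_space lborel torus_cell. norm (grad f x) \<le> M"
    by (rule eventually_mono) (use le order_trans in fastforce)
  then have "AE x in lborel. x \<in> torus_cell \<longrightarrow> norm (grad f x) \<le> M"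
    using cell by (simp add: AE_restrict_space_iff)
  then obtain N where "{x \<in> space lborel. \<not> (x \<in> torus_cell \<longrightarrow> norm (grad f x) \<le> M)} \<subseteq> N"
    "emeasure lborel N = 0" "N \<in> sets lborel"
    by (rule AE_E)
  then have N: "N \<in> null_sets lborel" "{x. \<not> (x \<in> torus_cell \<longrightarrow> norm (grad f x) \<le> M)} \<subseteq> N"
    by (auto intro: null_setsI)
  have "negligible N" using N(1) by (simp add: negligible_iff_null_sets null_sets_completionI)
  moreover have "U \<inter> ?box \<subseteq> N"
    using N(2) by (auto simp: U_def torus_cell_def mem_box Basis_prod_def not_le)
  ultimately have "negligible (U \<inter> ?box)" by (rule negligible_subset)
  then have empty: "U \<inter> ?box = {}"
    using open_not_negligible[of "U \<inter> ?box"] opU by (auto simp: open_Int)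
  obtain y where y: "y \<in> cbox (-pi, -pi) (pi, pi)" "\<And>g. periodic g \<Longrightarrow> g y = (g x :: real)"
    using torus_representative[of x] by blast
  have "box (-pi, -pi) (pi, pi) \<noteq> ({} :: (real \<times> real) set)" by (simp add: box_ne_empty Basis_prod_def)
  then have "y \<in> closure ?box" using y(1) by simp
  then have "y \<notin> U" using empty open_Int_closure_eq_empty[OF opU, of ?box] by blast
  then have "norm (grad f y) \<le> M" by (simp add: U_def)
  moreover have "\<bar>d1 f y\<bar> \<le> norm (grad f y)" "\<bar>d2 f y\<bar> \<le> norm (grad f y)"
    using norm_fst_le[of "d1 f y" "d2 f y"] norm_snd_le[of "d2 f y" "d1 f y"] by (simp_all add: grad_def)
  ultimately show "\<bar>d1 f x\<bar> \<le> M" "\<bar>d2 f x\<bar> \<le> M"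
    using y(2)[OF periodic_partials(1)[OF per C]] y(2)[OF periodic_partials(2)[OF per C]] by auto
qed

section \<open>Growth of the density gradient\<close>

context boussinesq_flow
begin

text \<open>The reflected flow solves the same system with the same data, so uniqueness makes the symmetry of
  the data persist. The normal velocity is then odd across the mirror line, which no fluid crosses.\<close>

lemma reflection_symmetry:
  assumes ab: "a \<in> {1, -1}" "b \<in> {1, -1 :: real}"
    and \<rho>: "\<And>x. \<rho> 0 x = b * \<rho> 0 (a * fst x, b * snd x)"
    and \<omega>: "\<And>x. laplacian (\<psi> 0) x = a * b * laplacian (\<psi> 0) (a * fst x, b * snd x)"
    and t: "t \<in> {0..T}"
  shows "\<rho> t x = b * \<rho> t (a * fst x, b * snd x)"
    and "d1 (\<psi> t) x = b * d1 (\<psi> t) (a * fst x, b * snd x)"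
    and "d2 (\<psi> t) x = a * d2 (\<psi> t) (a * fst x, b * snd x)"
proof -
  have zero: "0 \<in> {0..T}" using T_pos by simp
  note D = C1_differentiable[OF C2_D(1)[OF C2_stream[OF t]]]
  have lap_eq: "laplacian (\<psi> 0) = laplacian (\<lambda>x. a * b * \<psi> 0 (a * fst x, b * snd x))"
    unfolding laplacian_reflect[OF C2_stream[OF zero] ab] using \<omega> by (rule ext)
  have rho_eq: "\<rho> 0 = (\<lambda>x. b * \<rho> 0 (a * fst x, b * snd x))" using \<rho> by (rule ext)
  have eq: "\<rho> t x = b * \<rho> t (a * fst x, b * snd x)"
    "d1 (\<psi> t) x = d1 (\<lambda>x. a * b * \<psi> t (a * fst x, b * snd x)) x"
    "d2 (\<psi> t) x = d2 (\<lambda>x. a * b * \<psi> t (a * fst x, b * snd x)) x"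
    by (rule boussinesq_flow_unique[OF boussinesq_flow_axioms
          boussinesq_flow_reflect[OF boussinesq_flow_axioms ab] rho_eq lap_eq t])+
  show "\<rho> t x = b * \<rho> t (a * fst x, b * snd x)" by (rule eq)
  show "d1 (\<psi> t) x = b * d1 (\<psi> t) (a * fst x, b * snd x)"
    using ab by (subst eq(2)) (auto simp: partials_reflect D)
  show "d2 (\<psi> t) x = a * d2 (\<psi> t) (a * fst x, b * snd x)"
    using ab by (subst eq(3)) (auto simp: partials_reflect D)
qed

text \<open>\<open>X\<close> is a lower bound for the circulation at time \<open>T\<close>: on the left side of the square the
  density keeps its sign and its maximum, so with slope at most \<open>M\<close> its integral is at least
  \<open>(\<rho> 0 (0, z))\<^sup>2 / (4 M)\<close>, while on the right side it stays nonpositive. The conclusion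
  compares \<open>X\<close> with the upper bound in terms of the energy \<open>E\<close> and the vorticity bound \<open>W + M T\<close>.\<close>

theorem circulation_growth:
  assumes even: "even_x1 (\<rho> 0)" and odd: "odd_x2 (\<rho> 0)"
    and odd1: "odd_x1 (laplacian (\<psi> 0))" and odd2: "odd_x2 (laplacian (\<psi> 0))"
    and left: "\<And>y. y \<in> {0..pi} \<Longrightarrow> 0 \<le> \<rho> 0 (0, y)" and right: "\<And>y. y \<in> {0..pi} \<Longrightarrow> \<rho> 0 (pi, y) \<le> 0"
    and z: "z \<in> {0..pi}" "0 < \<rho> 0 (0, z)"
    and M: "\<And>t x. t \<in> {0..T} \<Longrightarrow> \<bar>d1 (\<rho> t) x\<bar> \<le> M" "\<And>t x. t \<in> {0..T} \<Longrightarrow> \<bar>d2 (\<rho> t) x\<bar> \<le> M"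
    and W: "\<And>x. \<bar>laplacian (\<psi> 0) x\<bar> \<le> W"
  defines "X \<equiv> - quarter_integral (laplacian (\<psi> 0)) + T * ((\<rho> 0 (0, z))\<^sup>2 / (4 * M))"
    and "E \<equiv> torus_integral (\<lambda>x. ((d1 (\<psi> 0) x)\<^sup>2 + (d2 (\<psi> 0) x)\<^sup>2) / 2) + torus_integral (\<lambda>x. pi\<^sup>2 + (\<rho> 0 x)\<^sup>2)"
  shows "0 < X \<longrightarrow> X ^ 3 \<le> 512 * pi\<^sup>2 * E * (W + M * T)"
proof
  assume Xpos: "0 < X"
  have T: "T \<in> {0..T}" "0 \<in> {0..T}" using T_pos by auto
  have sym1: "d2 (\<psi> t) (- x1, x2) = - d2 (\<psi> t) (x1, x2)" if "t \<in> {0..T}" for t x1 x2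
    using reflection_symmetry(3)[of "-1" 1 t "(- x1, x2)"] that even odd1 by (auto simp: even_x1_def odd_x1_def)
  have sym2: "d1 (\<psi> t) (x1, - x2) = - d1 (\<psi> t) (x1, x2)" "\<rho> t (x1, - x2) = - \<rho> t (x1, x2)"
    if "t \<in> {0..T}" for t x1 x2
    using reflection_symmetry(1,2)[of 1 "-1" t "(x1, - x2)"] that odd odd2 by (auto simp: odd_x2_def)
  have per: "f (- pi, y) = f (pi, y)" "f (y, - pi) = f (y, pi)" if "periodic f" for f :: "real \<times> real \<Rightarrow> real" and y
    using that unfolding periodic_def by (metis add.commute diff_add_cancel mult_2 uminus_add_conv_diff)+
  note pd = periodic_partials[OF periodic_stream C2_D(1)[OF C2_stream]]
  have v: "d2 (\<psi> t) (0, y) = 0 \<and> d2 (\<psi> t) (pi, y) = 0" if "t \<in> {0..T}" for t y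
    using sym1[OF that, of 0 y] sym1[OF that, of pi y] per(1)[OF pd(2), OF that that, of y] by simp
  have h: "d1 (\<psi> t) (x, 0) = 0 \<and> d1 (\<psi> t) (x, pi) = 0 \<and> d1 (\<psi> t) (x, - pi) = 0" if "t \<in> {0..T}" for t x
    using sym2(1)[OF that, of x 0] sym2(1)[OF that, of x pi] per(2)[OF pd(1), OF that that, of x] by simp
  have r: "\<rho> t (x, 0) = 0 \<and> \<rho> t (x, pi) = 0" if "t \<in> {0..T}" for t x
    using sym2(2)[OF that, of x 0] sym2(2)[OF that, of x pi] per(2)[OF periodic_density, OF that, of x] by simp
  have growth: "(\<rho> 0 (0, z))\<^sup>2 / (4 * M) \<le> - integral {0..pi} (\<lambda>y. \<rho> t (pi, y) - \<rho> t (0, y))"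
    if t: "t \<in> {0..T}" for t
  proof -
    have C: "C1 (\<rho> t)" by (rule C1_density[OF t])
    note c = continuous_on_pair[OF C1_continuous[OF C]]
    have pos: "0 \<le> \<rho> t (0, y)" if "y \<in> {0..pi}" for y
      using vertical_line_bound_forward[of 0 "-1" 0 t y] v r left t that by simp
    have neg: "\<rho> t (pi, y) \<le> 0" if "y \<in> {0..pi}" for y
      using vertical_line_bound_forward[of pi 1 0 t y] v r right t that by simp
    obtain w where w: "w \<in> {0..pi}" "\<And>y. y \<in> {0..pi} \<Longrightarrow> \<rho> t (0, y) \<le> \<rho> t (0, w)"
      using continuous_attains_sup[of "{0..pi}" "\<lambda>y. \<rho> t (0, y)"] c(1) by auto
    have k: "\<rho> 0 (0, z) \<le> \<rho> t (0, w)"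
      using vertical_line_bound_backward[of 0 "\<rho> t (0, w)" t z] v r pos w t z by simp
    have "0 \<le> M" using M(1)[OF t, of 0] by linarith
    have "(\<rho> 0 (0, z))\<^sup>2 / (4 * M) \<le> (\<rho> t (0, w))\<^sup>2 / (4 * M)"
      using k z(2) \<open>0 \<le> M\<close> by (intro divide_right_mono power_mono) auto
    also have "\<dots> \<le> integral {0..pi} (\<lambda>y. \<rho> t (0, y))"
    proof (rule integral_lower_bound_triangle(1)[where f'="\<lambda>y. d2 (\<rho> t) (0, y)"])
      show "((\<lambda>y. \<rho> t (0, y)) has_real_derivative d2 (\<rho> t) (0, y)) (at y)" for y
        by (intro has_real_derivative_d2 C1_differentiable C)
    qed (use M(2)[OF t] r[OF t] pos w k z in auto)
    also have "\<dots> \<le> integral {0..pi} (\<lambda>y. - (\<rho> t (pi, y) - \<rho> t (0, y)))"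
      using neg by (intro integral_le integrable_continuous_interval continuous_intros c) auto
    also have "\<dots> = - integral {0..pi} (\<lambda>y. \<rho> t (pi, y) - \<rho> t (0, y))"
      by (rule Henstock_Kurzweil_Integration.integral_neg)
    finally show ?thesis .
  qed
  define \<Gamma> where "\<Gamma> t = - quarter_integral (laplacian (\<psi> t))" for t
  obtain s where s: "0 \<le> s" "s \<le> T" "\<Gamma> T - \<Gamma> 0 = - integral {0..pi} (\<lambda>y. \<rho> s (pi, y) - \<rho> s (0, y)) * (T - 0)"
  proof (rule interval_mvt[where T=T and r=0 and t=T and f=\<Gamma>])
    show "(\<Gamma> has_real_derivative - integral {0..pi} (\<lambda>y. \<rho> s (pi, y) - \<rho> s (0, y))) (at s within {0..T})"
      if "s \<in> {0..T}" for s
      unfolding \<Gamma>_def using v h by (intro circulation_derivative that) auto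
  qed (use T_pos that in auto)
  have "T * ((\<rho> 0 (0, z))\<^sup>2 / (4 * M)) \<le> T * (- integral {0..pi} (\<lambda>y. \<rho> s (pi, y) - \<rho> s (0, y)))"
    using growth[of s] s(1,2) T_pos by (intro mult_left_mono) auto
  then have X: "X \<le> \<Gamma> T" using s(3) by (simp add: X_def \<Gamma>_def algebra_simps)
  have "X ^ 3 \<le> \<Gamma> T ^ 3" using X Xpos by (intro power_mono) auto
  also have "\<dots> \<le> 512 * pi\<^sup>2 * E * (W + M * T)"
    unfolding \<Gamma>_def
  proof (rule circulation_cubed_bound)
    show "C2 (\<psi> T)" by (rule C2_stream[OF T(1)])
    show "\<bar>laplacian (\<psi> T) x\<bar> \<le> W + M * T" for x by (rule vorticity_bound[OF M(1) W T(1)])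
    show "0 < - quarter_integral (laplacian (\<psi> T))" using X Xpos by (simp add: \<Gamma>_def)
    note C = C2_D[OF C2_stream[OF T(1)]]
    have "quarter_integral (\<lambda>x. ((d1 (\<psi> T) x)\<^sup>2 + (d2 (\<psi> T) x)\<^sup>2) / 2) \<le>
      torus_integral (\<lambda>x. ((d1 (\<psi> T) x)\<^sup>2 + (d2 (\<psi> T) x)\<^sup>2) / 2)"
      by (intro quarter_integral_le_torus_integral continuous_intros C1_continuous C) auto
    also have "\<dots> \<le> E" unfolding E_def using h by (intro kinetic_energy_bound T) auto
    finally show "quarter_integral (\<lambda>x. ((d1 (\<psi> T) x)\<^sup>2 + (d2 (\<psi> T) x)\<^sup>2) / 2) \<le> E" .
  qed
  finally show "X ^ 3 \<le> 512 * pi\<^sup>2 * E * (W + M * T)" .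
qed

end

text \<open>If \<open>M = c \<sqrt>t\<close>, the circulation is at least of order \<open>\<sqrt>t / c\<close> and the vorticity at most of order
  \<open>c t \<sqrt>t\<close>, so that for small \<open>c\<close> the cube of the first exceeds the second.\<close>

lemma small_constant_contradiction:
  fixes A W E k :: real
  assumes k: "0 < k" and W: "0 \<le> W" and E: "0 \<le> E"
  obtains c where "0 < c" "\<And>t. 0 \<le> t \<Longrightarrow> k \<le> c * sqrt t * pi \<Longrightarrow>
    0 < A + t * (k\<^sup>2 / (4 * (c * sqrt t))) \<and>
    512 * pi\<^sup>2 * E * (W + c * sqrt t * t) < (A + t * (k\<^sup>2 / (4 * (c * sqrt t)))) ^ 3"
proof -
  \<comment> \<open>The four entries provide, in this order, \<open>c\<^sup>4 \<le> c\<^sup>2\<close>, the absorption of \<open>A\<close>, the absorption of \<open>W\<close>, and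
    the final comparison. The hypothesis \<open>k \<le> c \<sqrt>t \<pi>\<close> makes \<open>t\<close> large when \<open>c\<close> is small.\<close>
  define m where "m = Min {1, k ^ 3 / (8 * pi * (\<bar>A\<bar> + 1)), k ^ 3 / (pi ^ 3 * (W + 1)), k ^ 6 / (2 * 512 * 1024 * pi\<^sup>2 * (E + 1))}"
  have m0: "0 < m" unfolding m_def using k W E by (simp add: add_nonneg_pos)
  have m: "m \<le> 1" "m \<le> k ^ 3 / (8 * pi * (\<bar>A\<bar> + 1))" "m \<le> k ^ 3 / (pi ^ 3 * (W + 1))"
    "m \<le> k ^ 6 / (2 * 512 * 1024 * pi\<^sup>2 * (E + 1))"
    unfolding m_def by (rule Min_le; simp)+
  define c where "c = sqrt m"
  have c: "0 < c" "c\<^sup>2 = m" using m0 by (simp_all add: c_def)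
  have swap: "B \<le> K / (p * m)" if "m \<le> K / (p * B)" "0 < B" "0 < p" for B K p :: real
  proof -
    have "m * (p * B) \<le> K" using that by (simp add: pos_le_divide_eq)
    then show ?thesis using that(3) m0 by (simp add: pos_le_divide_eq mult.commute mult.left_commute)
  qed
  show ?thesis
  proof (rule that[OF c(1)])
    fix t :: real assume t: "0 \<le> t" and kt: "k \<le> c * sqrt t * pi"
    define s where "s = sqrt t"
    have ts: "t = s\<^sup>2" using t by (simp add: s_def)
    have s0: "0 < s"
    proof (rule ccontr)
      assume "\<not> 0 < s"
      then have "s = 0" using t by (simp add: s_def)
      then show False using kt k by (simp add: s_def)
    qed
    have ks: "k / (pi * c) \<le> s" using kt c(1) by (simp add: s_def field_simps)
    \<comment> \<open>Half of the growth term; the other half absorbs \<open>A\<close>.\<close>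
    define Y where "Y = k\<^sup>2 * s / (8 * c)"
    have Y0: "0 < Y" using k s0 c by (simp add: Y_def)
    have eq: "t * (k\<^sup>2 / (4 * (c * sqrt t))) = 2 * Y"
      using s0 c by (simp add: s_def[symmetric] ts Y_def power2_eq_square field_simps)
    have "\<bar>A\<bar> + 1 \<le> k ^ 3 / (8 * pi * c\<^sup>2)"
      unfolding c(2) using m(2) by (rule swap) (auto intro: add_nonneg_pos)
    also have "\<dots> = k\<^sup>2 * (k / (pi * c)) / (8 * c)" using c by (simp add: power2_eq_square power3_eq_cube field_simps)
    also have "\<dots> \<le> Y" unfolding Y_def using ks c by (intro divide_right_mono mult_left_mono) auto
    finally have "\<bar>A\<bar> < Y" by linarith
    then have XY: "Y < A + 2 * Y" by linarith
    have "W \<le> k ^ 3 / (pi ^ 3 * c\<^sup>2)" 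
    proof -
      have "W + 1 \<le> k ^ 3 / (pi ^ 3 * c\<^sup>2)" 
        unfolding c(2) using m(3) by (rule swap) (use W in auto)
      then show ?thesis by linarith
    qed
    also have "\<dots> = c * (k / (pi * c)) ^ 3" using c by (simp add: power2_eq_square power3_eq_cube field_simps)
    also have "\<dots> \<le> c * s ^ 3" using ks c k by (intro mult_left_mono power_mono) auto
    finally have "W + c * sqrt t * t \<le> 2 * (c * s ^ 3)"
      using s0 by (simp add: s_def[symmetric] ts power2_eq_square power3_eq_cube)
    then have "512 * pi\<^sup>2 * E * (W + c * sqrt t * t) \<le> 512 * pi\<^sup>2 * E * (2 * (c * s ^ 3))"
      using E by (intro mult_left_mono) auto
    also have "\<dots> \<le> Y ^ 3"
    proof -
      have "c ^ 4 = c\<^sup>2 * c\<^sup>2" by (simp add: power4_eq_xxxx power2_eq_square mult.assoc)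
      also have "\<dots> = m * m" by (simp only: c(2))
      also have "\<dots> \<le> m * 1" using m(1) m0 by (intro mult_left_mono) auto
      finally have "c ^ 4 \<le> m" by simp
      then have "c ^ 4 \<le> k ^ 6 / (2 * 512 * 1024 * pi\<^sup>2 * (E + 1))" using m(4) by linarith
      then have "c ^ 4 * (2 * 512 * 1024 * pi\<^sup>2 * (E + 1)) \<le> k ^ 6" using E by (simp add: pos_le_divide_eq)
      moreover have "c ^ 4 * (512 * 1024 * pi\<^sup>2 * E) \<le> c ^ 4 * (2 * 512 * 1024 * pi\<^sup>2 * (E + 1))"
        using E by (intro mult_left_mono) (auto simp: mult_le_cancel_left)
      ultimately have "c ^ 4 * (512 * 1024 * pi\<^sup>2 * E) \<le> k ^ 6" by linarith
      then have "c ^ 4 * (512 * 1024 * pi\<^sup>2 * E) * s ^ 3 \<le> k ^ 6 * s ^ 3" using s0 by (intro mult_right_mono) auto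
      then show ?thesis using c(1)
        by (simp add: Y_def power_divide power_mult_distrib divide_simps) (simp add: eval_nat_numeral algebra_simps)
    qed
    also have "Y ^ 3 < (A + 2 * Y) ^ 3" using XY Y0 by (intro power_strict_mono) auto
    finally show "0 < A + t * (k\<^sup>2 / (4 * (c * sqrt t))) \<and>
      512 * pi\<^sup>2 * E * (W + c * sqrt t * t) < (A + t * (k\<^sup>2 / (4 * (c * sqrt t)))) ^ 3"
      using XY Y0 unfolding eq by simp
  qed
qed

theorem theorem1p3:
  fixes \<rho>0 \<omega>0 :: "real \<times> real \<Rightarrow> real"
  assumes "torus_smooth \<rho>0" and "odd_x2 \<rho>0" and "even_x1 \<rho>0"
    and "torus_smooth \<omega>0" and "odd_x1 \<omega>0" and "odd_x2 \<omega>0"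
    and "\<forall>x2\<in>{0..pi}. 0 \<le> \<rho>0 (0, x2)"
    and "0 < (SUP x2\<in>{0..pi}. \<rho>0 (0, x2))"
    and "\<forall>x2\<in>{0..pi}. \<rho>0 (pi, x2) \<le> 0"
  shows "\<exists>c::real. 0 < c \<and>
    (\<forall>T \<rho> \<omega>. maximal_boussinesq_solution \<rho>0 \<omega>0 T \<rho> \<omega> \<longrightarrow>
      (\<forall>t. 0 \<le> t \<and> ereal t < T \<longrightarrow>
        ereal (c * t powr (1/2)) < (SUP \<tau>\<in>{0..t}. linfty_norm (grad (\<rho> \<tau>)))))"
proof -
  have "\<exists>z\<in>{0..pi}. 0 < \<rho>0 (0, z)"
  proof (rule ccontr)
    assume "\<not> (\<exists>z\<in>{0..pi}. 0 < \<rho>0 (0, z))"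
    then have "\<rho>0 (0, y) \<le> 0" if "y \<in> {0..pi}" for y using that by (meson not_le)
    then have "(SUP x2\<in>{0..pi}. \<rho>0 (0, x2)) \<le> 0" by (intro cSUP_least) auto
    then show False using assms(8) by simp
  qed
  then obtain z where z: "z \<in> {0..pi}" "0 < \<rho>0 (0, z)" by blast
  have C\<rho>: "C1 \<rho>0" "periodic \<rho>0" using assms(1) torus_smooth_C1 by (auto simp: torus_smooth_def)
  \<comment> \<open>The constant may depend on the data only, so the initial velocity is fixed before the solution;
    any two stream functions of \<open>\<omega>0\<close> have the same gradient.\<close>
  define \<psi>0 where "\<psi>0 = (SOME \<psi>. is_inverse_neg_laplacian \<omega>0 \<psi>)"
  obtain W where W: "\<And>x. \<bar>\<omega>0 x\<bar> \<le> W"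
  proof -
    have "continuous_on ({0..0} \<times> UNIV) (\<lambda>z :: real \<times> real \<times> real. \<omega>0 (snd z))"
      by (rule continuous_on_compose2[OF C1_continuous[OF torus_smooth_C1[OF assms(4)], of UNIV]])
        (auto intro!: continuous_intros)
    then have "jcont 0 (\<lambda>t. \<omega>0)" unfolding jcont_def case_prod_unfold .
    then obtain K where K: "\<And>(t :: real) x. t \<in> {0..0} \<Longrightarrow> \<bar>\<omega>0 x\<bar> \<le> K"
      by (rule jcont_bounded) (use assms(4) in \<open>auto simp: torus_smooth_def\<close>)
    show ?thesis by (rule that[of K], rule K[of 0]) simp
  qed
  define E where "E = torus_integral (\<lambda>x. ((d1 \<psi>0 x)\<^sup>2 + (d2 \<psi>0 x)\<^sup>2) / 2) + torus_integral (\<lambda>x. pi\<^sup>2 + (\<rho>0 x)\<^sup>2)"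
  have W0: "0 \<le> W" using W[of 0] by linarith
  have E0: "0 \<le> E"
  proof -
    have "0 \<le> torus_integral f" if "\<And>x. 0 \<le> f x" for f :: "real \<times> real \<Rightarrow> real"
      using that by (cases "f integrable_on cbox (-pi, -pi) (pi, pi)")
        (auto intro: integral_nonneg simp: not_integrable_integral)
    then show ?thesis unfolding E_def by (intro add_nonneg_nonneg) auto
  qed
  obtain c where c: "0 < c" and contra: "\<And>t. 0 \<le> t \<Longrightarrow> \<rho>0 (0, z) \<le> c * sqrt t * pi \<Longrightarrow>
    0 < quarter_integral \<omega>0 + t * ((\<rho>0 (0, z))\<^sup>2 / (4 * (c * sqrt t))) \<and>
    512 * pi\<^sup>2 * E * (W + c * sqrt t * t) < (quarter_integral \<omega>0 + t * ((\<rho>0 (0, z))\<^sup>2 / (4 * (c * sqrt t)))) ^ 3"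
    using small_constant_contradiction[OF z(2) W0 E0, of "quarter_integral \<omega>0"] by blast
  show ?thesis
  proof (intro exI[of _ c] conjI c allI impI)
    fix T \<rho> \<omega> and t :: real
    assume sol: "maximal_boussinesq_solution \<rho>0 \<omega>0 T \<rho> \<omega>" and t: "0 \<le> t \<and> ereal t < T"
    then have bs: "boussinesq_solution \<rho>0 \<omega>0 T \<rho> \<omega>" by (simp add: maximal_boussinesq_solution_def)
    then have \<rho>0: "\<rho> 0 = \<rho>0" by (auto simp: boussinesq_solution_def)
    show "ereal (c * t powr (1/2)) < (SUP \<tau>\<in>{0..t}. linfty_norm (grad (\<rho> \<tau>)))"
    proof (rule ccontr)
      assume "\<not> ereal (c * t powr (1/2)) < (SUP \<tau>\<in>{0..t}. linfty_norm (grad (\<rho> \<tau>)))"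
      then have "(SUP \<tau>\<in>{0..t}. linfty_norm (grad (\<rho> \<tau>))) \<le> ereal (c * sqrt t)"
        using t by (simp add: not_less powr_half_sqrt)
      then have norm: "linfty_norm (grad (\<rho> s)) \<le> ereal (c * sqrt t)" if "s \<in> {0..t}" for s
        using that by (meson SUP_upper order_trans)
      have "\<bar>d2 \<rho>0 x\<bar> \<le> c * sqrt t" for x
        using linfty_norm_bound(2)[OF C\<rho>, of "c * sqrt t" x] norm[of 0] \<rho>0 t by simp
      moreover have "\<rho>0 (0, 0) = 0"
        using spec[OF spec[OF assms(2)[unfolded odd_x2_def], of 0], of 0] by simp
      ultimately have k: "\<rho>0 (0, z) \<le> c * sqrt t * pi"
        using z assms(7) has_real_derivative_d2[OF C1_differentiable[OF C\<rho>(1)]]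
        by (intro integral_lower_bound_triangle(2)[where f="\<lambda>y. \<rho>0 (0, y)" and f'="\<lambda>y. d2 \<rho>0 (0, y)"]) auto
      have "t \<noteq> 0" using k z(2) by auto
      then have tpos: "0 < t" using t by simp
      obtain \<psi> A B where flow: "boussinesq_flow t \<rho> \<psi> A B" and inv: "is_inverse_neg_laplacian \<omega>0 (\<psi> 0)"
        using boussinesq_solution_flow[OF bs tpos] t by blast
      interpret boussinesq_flow t \<rho> \<psi> A B by (rule flow)
      have inv0: "is_inverse_neg_laplacian \<omega>0 \<psi>0" unfolding \<psi>0_def by (rule someI[where P="is_inverse_neg_laplacian \<omega>0", OF inv])
      have lap: "laplacian (\<psi> 0) = (\<lambda>x. - \<omega>0 x)" "laplacian \<psi>0 = (\<lambda>x. - \<omega>0 x)"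
        using inv inv0 unfolding is_inverse_neg_laplacian_def by (auto simp: fun_eq_iff minus_equation_iff)
      have grad_eq: "d1 (\<psi> 0) x = d1 \<psi>0 x" "d2 (\<psi> 0) x = d2 \<psi>0 x" for x
        using inv inv0 lap unfolding is_inverse_neg_laplacian_def
        by (auto intro!: gradient_determined_by_laplacian torus_smooth_C2 simp: torus_smooth_def)
      have "0 < - quarter_integral (laplacian (\<psi> 0)) + t * ((\<rho> 0 (0, z))\<^sup>2 / (4 * (c * sqrt t))) \<longrightarrow>
        (- quarter_integral (laplacian (\<psi> 0)) + t * ((\<rho> 0 (0, z))\<^sup>2 / (4 * (c * sqrt t)))) ^ 3 \<le>
        512 * pi\<^sup>2 * (torus_integral (\<lambda>x. ((d1 (\<psi> 0) x)\<^sup>2 + (d2 (\<psi> 0) x)\<^sup>2) / 2) + torus_integral (\<lambda>x. pi\<^sup>2 + (\<rho> 0 x)\<^sup>2))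
          * (W + c * sqrt t * t)"
      proof (rule circulation_growth)
        show "even_x1 (\<rho> 0)" "odd_x2 (\<rho> 0)" using assms \<rho>0 by auto
        show "odd_x1 (laplacian (\<psi> 0))" "odd_x2 (laplacian (\<psi> 0))"
          using assms(5,6) by (auto simp: lap odd_x1_def odd_x2_def)
        show "\<bar>d1 (\<rho> s) x\<bar> \<le> c * sqrt t" "\<bar>d2 (\<rho> s) x\<bar> \<le> c * sqrt t" if "s \<in> {0..t}" for s x
          using linfty_norm_bound[OF C1_density periodic_density norm] that by blast+
        show "\<bar>laplacian (\<psi> 0) x\<bar> \<le> W" for x using W by (simp add: lap)
      qed (use assms(7,9) z \<rho>0 in auto)
      then show False
        using contra[OF _ k] t by (simp add: lap grad_eq \<rho>0 E_def not_less[symmetric])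
    qed
  qed
qed

end
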